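(* Let $\mathbb F$ be an algebraically closed field. Let $H(s)\in\mathbb F[s]^{m\times n}$ be a matrix pencil with Weyr characteristic $(\mathbf W,\mathbf r_*,\mathbf s_* )$, let $P(s)\in\mathbb F[s]^{m\times n}$ be a matrix pencil with $\operatorname{rank}(P(s))=1$, and let $(\widehat{\mathbf W},\widehat{\mathbf r}_*,\widehat{\mathbf s}_* )$ be the Weyr characteristic of $H(s)+P(s)$. Then: - $-2\le \widehat w_i(\lambda)-w_i(\lambda)\le 2$ for all $i\ge 1$, $\lambda\in\overline{\mathbb F}$; - if $\mathbf r=(0)$, then for all $i\ge0$ $$\min\left\{1-\left[\sqrt{|\mathbf r_*|+1}\right],-1\right\}\le \widehat r_i-r_i\le \max\left\{2,-1+\left[\sqrt{|\mathbf r_*|}\right]\right\},$$ and if $\mathbf r\neq(0)$, then for all $i\ge 0$ $$\min\left\{-\left[\sqrt{|\mathbf r_*|}\right],-1-\left[\sqrt{|\mathbf r|}\right]\right\}\le \widehat r_i-r_i\le \max\left\{2+\left[\sqrt{|\mathbf r|-1}\right],\left[\sqrt{|\mathbf r_*|}\right]\right\};$$ - if $\mathbf s=(0)$, then for all $i\ge0$ $$\min\left\{1-\left[\sqrt{|\mathbf s_*|+1}\right],-1\right\}\le \widehat s_i-s_i\le \max\left\{2,-1+\left[\sqrt{|\mathbf s_*|}\right]\right\},$$ and if $\mathbf s\neq(0)$, then for all $i\ge 0$ $$\min\left\{-\left[\sqrt{|\mathbf s_*|}\right],-1-\left[\sqrt{|\mathbf s|}\right]\right\}\le \widehat s_i-s_i\le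 \max\left\{2+\left[\sqrt{|\mathbf s|-1}\right],\left[\sqrt{|\mathbf s_*|}\right]\right\}.$$
   Context: Notation. $\overline{\mathbb F}=\mathbb F\cup\{\infty\}$; $[x]$ is the integer part of a real number $x$. A matrix pencil is a polynomial matrix $H(s)=H_0+sH_1\in\mathbb F[s]^{m\times n}$ of degree at most one; its rank is its normal rank (order of the largest minor that is not identically zero). Partitions. A partition is an infinite nonincreasing sequence of nonnegative integers, almost all zero; $|\mathbf a|$ is the sum of the components of $\mathbf a$; $(0)$ is the zero partition. The conjugate of a partition or finite nonincreasing sequence $\mathbf c=(c_1,c_2,\dots)$ of nonnegative integers is the partition $\overline{\mathbf c}=(r_1,r_2,\dots)$, $r_k=\#\{i:c_i\ge k\}$, $k\ge1$. For a partition written with a star and indexed from $0$, $\mathbf r_*=(r_0,r_1,r_2,\dots)$, one writes $\mathbf r=(r_1,r_2,\dots)$, so $|\mathbf r_*|=r_0+|\mathbf r|$. Weyr characteristic. Let $H(s)\in\mathbb F[s]^{m\times n}$ have rank $\rho$, homogeneous invariant factors $\pi_1(s,t)\mid\dots\mid\pi_\rho(s,t)$, column minimal indices $\mathbf c=(c_1\ge\dots\ge c_{n-\rho})$ and row minimal indices $\mathbf u=(u_1\ge\dots\ge u_{m-\rho})$ (the Kronecker invariants). The partial multiplicities $\mathbf z(\lambda)=(z_1(\lambda),z_2(\lambda),\dots)$ at $\lambda\in\overline{\mathbb F}$ are defined by $\pi_{\rho-i+1}(s,t)=t^{z_i(\infty)}\prod_{\lambda\in\mathbb F}(s-\lambda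 t)^{z_i(\lambda)}$ for $1\le i\le\rho$ (up to nonzero constants), and $z_i(\lambda)=0$ for $i>\rho$. The Weyr characteristic at $\lambda$ is $\mathbf w(\lambda)=\overline{\mathbf z(\lambda)}=(w_1(\lambda),w_2(\lambda),\dots)$. The Weyr characteristic of the regular part is the collection $\mathbf W$ of the $\mathbf w(\lambda)$ over the (finitely many) eigenvalues $\lambda\in\overline{\mathbb F}$ ($\mathbf w(\lambda)=(0)$ at all other $\lambda$). The column Brunovsky partition is $\mathbf r_*=(r_0,r_1,\dots)$ with $r_0=n-\rho$, $(r_1,r_2,\dots)=\overline{\mathbf c}$; the row Brunovsky partition is $\mathbf s_*=(s_0,s_1,\dots)$ with $s_0=m-\rho$, $(s_1,s_2,\dots)=\overline{\mathbf u}$. The Weyr characteristic of $H(s)$ is $(\mathbf W,\mathbf r_*,\mathbf s_* )$; decorated symbols ($\widehat w_i(\lambda)$, $\widehat r_i$, $\widehat s_i$) denote the components of the correspondingly decorated Weyr characteristic. *)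

theory Defs
  imports
    Complex_Main
    "HOL-Computational_Algebra.Polynomial_Factorial"
    "HOL-Library.Multiset"
    "Jordan_Normal_Form.Matrix_Kernel"
    "Jordan_Normal_Form.DL_Submatrix"
begin

section \<open>Matrix pencils, minors and normal rank\<close>

definition pencil :: "nat \<Rightarrow> nat \<Rightarrow> 'a::field poly mat set" where
  "pencil m n = {H \<in> carrier_mat m n. \<forall>i<m. \<forall>j<n. degree (H $$ (i, j)) \<le> 1}"

definition minors :: "nat \<Rightarrow> 'a::comm_ring_1 mat \<Rightarrow> 'a set" where
  "minors k A = {det (submatrix A I J) | I J.
     I \<subseteq> {..<dim_row A} \<and> J \<subseteq> {..<dim_col A} \<and> card I = k \<and> card J = k}"

text \<open>The empty minor (k = 0) is 1, so the maximum is over a nonempty set and the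
  zero matrix has rank 0.\<close>

definition normal_rank :: "'a::field poly mat \<Rightarrow> nat" where
  "normal_rank A = Max {k. \<exists>x\<in>minors k A. x \<noteq> 0}"


section \<open>Partitions\<close>

text \<open>A partition is a function on \<^typ>\<open>nat\<close> whose components are its values at the indices
  1, 2, 3 and so on; a starred partition also uses the index 0. Therefore the operations below,
  when applied to a starred partition \<open>r\<close>, refer to its unstarred part
  \<open>(r 1, r 2, \<dots>)\<close>.\<close>

definition conjugate :: "(nat \<Rightarrow> nat) \<Rightarrow> nat \<Rightarrow> nat" where
  "conjugate c k = card {i. 1 \<le> i \<and> k \<le> c i}"

definition zero_partition :: "(nat \<Rightarrow> nat) \<Rightarrow> bool" where
  "zero_partition a \<longleftrightarrow> (\<forall>i\<ge>1. a i = 0)"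

definition psize :: "(nat \<Rightarrow> nat) \<Rightarrow> nat" where
  "psize a = (\<Sum>i | 1 \<le> i \<and> a i \<noteq> 0. a i)"

definition psize_star :: "(nat \<Rightarrow> nat) \<Rightarrow> nat" where
  "psize_star a = a 0 + psize a"

text \<open>Padding a finite sequence by zeros does not change the components of index
  at least 1 of its conjugate.\<close>

definition seq_of_list :: "nat list \<Rightarrow> nat \<Rightarrow> nat" where
  "seq_of_list xs i = (if 1 \<le> i \<and> i \<le> length xs then xs ! (i - 1) else 0)"


section \<open>Homogeneous invariant factors and partial multiplicities\<close>

text \<open>Polynomials in \<open>s\<close> and \<open>t\<close> are elements of \<open>(F[t])[s]\<close>: the outer variable is \<open>s\<close>, the
  inner one is \<open>t\<close>. The entry \<open>h\<^sub>0 + s h\<^sub>1\<close> is homogenized to \<open>t h\<^sub>0 + s h\<^sub>1\<close>.\<close>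

definition homogenize :: "'a::field poly mat \<Rightarrow> 'a poly poly mat" where
  "homogenize H = map_mat (\<lambda>p. [:[:0, coeff p 0:], [:coeff p 1:]:]) H"

text \<open>Greatest common divisors in \<open>F[s,t]\<close> are unique only up to nonzero constants;
  the choice of the representative does not affect the partial multiplicities.\<close>

definition is_gcd_of :: "'b::comm_semiring_1 \<Rightarrow> 'b set \<Rightarrow> bool" where
  "is_gcd_of d S \<longleftrightarrow> (\<forall>x\<in>S. d dvd x) \<and> (\<forall>e. (\<forall>x\<in>S. e dvd x) \<longrightarrow> e dvd d)"

definition determinantal_divisor :: "'a::field poly mat \<Rightarrow> nat \<Rightarrow> 'a poly poly" where
  "determinantal_divisor H k = (SOME d. is_gcd_of d (minors k (homogenize H)))"

definition hom_invariant_factor :: "'a::field poly mat \<Rightarrow> nat \<Rightarrow> 'a poly poly" where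
  "hom_invariant_factor H i = determinantal_divisor H i div determinantal_divisor H (i - 1)"

text \<open>The set \<open>F \<union> {\<infinity>}\<close>.\<close>

datatype 'a closure_pt = Fin 'a | Infty

text \<open>\<open>s - \<lambda> t\<close> for a finite point \<open>\<lambda>\<close>, and \<open>t\<close> for \<open>\<infinity>\<close>.\<close>

fun linear_form :: "'a::field closure_pt \<Rightarrow> 'a poly poly" where
  "linear_form (Fin l) = [:[:0, - l:], 1:]"
| "linear_form Infty = [:[:0, 1:]:]"

text \<open>The library constant \<^const>\<open>multiplicity\<close> would force gcd type classes onto the field.\<close>

definition factor_exponent :: "'b::comm_semiring_1 \<Rightarrow> 'b \<Rightarrow> nat" where
  "factor_exponent p x = (GREATEST k. p ^ k dvd x)"

definition partial_multiplicity :: "'a::field poly mat \<Rightarrow> 'a closure_pt \<Rightarrow> nat \<Rightarrow> nat" where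
  "partial_multiplicity H \<mu> i =
     (if 1 \<le> i \<and> i \<le> normal_rank H
      then factor_exponent (linear_form \<mu>) (hom_invariant_factor H (normal_rank H - i + 1))
      else 0)"

text \<open>In a factorization \<open>c t\<^bsup>z(\<infinity>)\<^esup> \<Prod> (s - \<lambda> t)\<^bsup>z(\<lambda>)\<^esup>\<close> with \<open>c \<noteq> 0\<close> the exponents are
  recovered by \<^const>\<open>factor_exponent\<close>.\<close>

lemma prime_elem_linear_form: "prime_elem (linear_form (\<mu> :: 'a::field closure_pt))"
proof (cases \<mu>)
  case (Fin l)
  have dvd: "linear_form \<mu> dvd x \<longleftrightarrow> poly x [:0, l:] = 0" for x
    unfolding poly_eq_0_iff_dvd by (simp add: Fin)
  show ?thesis
  proof (rule prime_elemI)
    show "linear_form \<mu> \<noteq> 0" by (simp add: Fin)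
  qed (simp_all add: dvd)
next
  case Infty
  then show ?thesis by (simp add: lift_prime_elem_poly prime_elem_linear_field_poly)
qed

lemma prime_elem_dvd_prod:
  assumes p: "prime_elem (p :: 'b::comm_semiring_1)" and fin: "finite A" and dvd: "p dvd prod f A"
  shows "\<exists>a\<in>A. p dvd f a"
  using fin dvd
proof (induction A rule: finite_induct)
  case empty
  then show ?case using p by (simp add: prime_elem_def)
next
  case (insert a A)
  then show ?case using prime_elem_dvd_multD[OF p] by auto
qed

lemma linear_form_dvd_linear_form:
  assumes "linear_form \<mu> dvd linear_form \<nu>"
  shows "\<mu> = (\<nu> :: 'a::field closure_pt)"
proof (cases \<mu>)
  case (Fin l)
  then have "[:- [:0, l:], 1:] dvd linear_form \<nu>" using assms by simp
  then have "poly (linear_form \<nu>) [:0, l:] = 0" by (subst poly_eq_0_iff_dvd)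
  then show ?thesis using Fin by (cases \<nu>) auto
next
  case Infty
  then have "\<forall>n. [:0, 1:] dvd coeff (linear_form \<nu>) n"
    using assms by (simp add: const_poly_dvd_iff)
  then have "[:0, 1:] dvd coeff (linear_form \<nu>) 1" by blast
  then show ?thesis using Infty by (cases \<nu>) (auto simp: is_unit_poly_iff)
qed

lemma factor_exponent_linear_form:
  fixes z :: "'a::field closure_pt \<Rightarrow> nat"
  assumes c: "c \<noteq> 0" and fin: "finite {\<nu>. z \<nu> \<noteq> 0}"
    and p: "p = [:[:c:]:] * (\<Prod>\<nu> | z \<nu> \<noteq> 0. linear_form \<nu> ^ z \<nu>)"
  shows "factor_exponent (linear_form \<mu>) p = z \<mu>"
proof -
  let ?S = "{\<nu>. z \<nu> \<noteq> 0}"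
  define q where "q = [:[:c:]:] * (\<Prod>\<nu>\<in>?S - {\<mu>}. linear_form \<nu> ^ z \<nu>)"
  have pq: "p = linear_form \<mu> ^ z \<mu> * q"
  proof (cases "\<mu> \<in> ?S")
    case True
    then show ?thesis unfolding p q_def by (simp only: prod.remove[OF fin True] mult.left_commute)
  next
    case False
    then show ?thesis unfolding p q_def by simp
  qed
  note prime = prime_elem_linear_form[of \<mu>]
  have "\<not> linear_form \<mu> dvd q"
  proof
    assume "linear_form \<mu> dvd q"
    moreover have "\<not> linear_form \<mu> dvd [:[:c:]:]"
    proof
      assume "linear_form \<mu> dvd [:[:c:]:]"
      moreover have "[:[:c:]:] dvd 1" using c by (simp add: is_unit_const_poly_iff dvd_field_iff)
      ultimately have "linear_form \<mu> dvd 1" by (rule dvd_trans)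
      then show False using prime by (simp add: prime_elem_def)
    qed
    ultimately have "linear_form \<mu> dvd (\<Prod>\<nu>\<in>?S - {\<mu>}. linear_form \<nu> ^ z \<nu>)"
      unfolding q_def using prime_elem_dvd_multD[OF prime] by blast
    then obtain \<nu> where \<nu>: "\<nu> \<in> ?S - {\<mu>}" "linear_form \<mu> dvd linear_form \<nu> ^ z \<nu>"
      using prime_elem_dvd_prod[OF prime] fin by (meson finite_Diff)
    then have "linear_form \<mu> dvd linear_form \<nu>" using prime_elem_dvd_power[OF prime] by blast
    then show False using \<nu> linear_form_dvd_linear_form by blast
  qed
  then have "j \<le> z \<mu>" if "linear_form \<mu> ^ j dvd p" for j
  proof (rule_tac ccontr)
    assume "\<not> linear_form \<mu> dvd q" and "\<not> j \<le> z \<mu>"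
    then have "linear_form \<mu> ^ Suc (z \<mu>) dvd p"
      using that by (meson dvd_trans le_imp_power_dvd not_less_eq_eq)
    then have "linear_form \<mu> ^ z \<mu> * linear_form \<mu> dvd linear_form \<mu> ^ z \<mu> * q"
      unfolding pq by (simp only: power_Suc mult.commute)
    then have "linear_form \<mu> dvd q"
      using prime_elem_not_zeroI[OF prime] by (simp only: dvd_mult_cancel_left power_not_zero) simp
    with \<open>\<not> linear_form \<mu> dvd q\<close> show False by contradiction
  qed
  then show ?thesis unfolding factor_exponent_def
    by (intro Greatest_equality) (auto simp: pq)
qed


section \<open>Minimal indices\<close>

definition vec_degree :: "'a::zero poly vec \<Rightarrow> nat" where
  "vec_degree v = Max (insert 0 {degree (v $ i) | i. i < dim_vec v})"

text \<open>A polynomial basis of the rational null space \<open>{x \<in> F(s)\<^sup>n. H(s) x = 0}\<close>; the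
  embedding of \<open>F[s]\<^sup>n\<close> into \<open>F(s)\<^sup>n\<close> is injective.\<close>

definition polynomial_null_basis :: "'a::field poly mat \<Rightarrow> 'a poly vec set \<Rightarrow> bool" where
  "polynomial_null_basis H B \<longleftrightarrow>
     B \<subseteq> carrier_vec (dim_col H) \<and> finite B \<and>
     kernel.basis (dim_col H) (map_mat to_fract H) (map_vec to_fract ` B)"

definition minimal_null_basis :: "'a::field poly mat \<Rightarrow> 'a poly vec set \<Rightarrow> bool" where
  "minimal_null_basis H B \<longleftrightarrow> polynomial_null_basis H B \<and>
     (\<forall>B'. polynomial_null_basis H B' \<longrightarrow> (\<Sum>v\<in>B. vec_degree v) \<le> (\<Sum>v\<in>B'. vec_degree v))"

text \<open>The multiset of degrees is the same for all minimal bases; it is listed in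
  nonincreasing order.\<close>

definition column_minimal_indices :: "'a::field poly mat \<Rightarrow> nat list" where
  "column_minimal_indices H =
     rev (sorted_list_of_multiset
       (image_mset vec_degree (mset_set (SOME B. minimal_null_basis H B))))"

definition row_minimal_indices :: "'a::field poly mat \<Rightarrow> nat list" where
  "row_minimal_indices H = column_minimal_indices (transpose_mat H)"


section \<open>Weyr characteristic\<close>

definition weyr_regular :: "'a::field poly mat \<Rightarrow> 'a closure_pt \<Rightarrow> nat \<Rightarrow> nat" where
  "weyr_regular H \<mu> = conjugate (partial_multiplicity H \<mu>)"

definition column_brunovsky :: "'a::field poly mat \<Rightarrow> nat \<Rightarrow> nat" where
  "column_brunovsky H k =
     (if k = 0 then dim_col H - normal_rank H
      else conjugate (seq_of_list (column_minimal_indices H)) k)"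

definition row_brunovsky :: "'a::field poly mat \<Rightarrow> nat \<Rightarrow> nat" where
  "row_brunovsky H k =
     (if k = 0 then dim_row H - normal_rank H
      else conjugate (seq_of_list (row_minimal_indices H)) k)"

definition weyr_characteristic ::
  "'a::field poly mat \<Rightarrow> ('a closure_pt \<Rightarrow> nat \<Rightarrow> nat) \<times> (nat \<Rightarrow> nat) \<times> (nat \<Rightarrow> nat)" where
  "weyr_characteristic H = (weyr_regular H, column_brunovsky H, row_brunovsky H)"

end

theory Submission
  imports
    Defs
    "HOL-Library.Function_Algebras"
    "HOL-Computational_Algebra.Formal_Power_Series"
begin

text \<open>The regular part is a local matter. Near a point \<open>\<mu>\<close> of the projective line, with
local parameter \<open>x\<close>, the homogenized pencil is a matrix \<open>A\<close> of power series. By elimination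
it has elementary divisors \<open>x\<^bsup>\<gamma>\<^sub>1\<^esup>, \<dots>, x\<^bsup>\<gamma>\<^sub>\<rho>\<^esup>\<close>, where
\<open>\<rho>\<close> is the normal rank; the \<open>\<gamma>\<^sub>i\<close> are the partial multiplicities at \<open>\<mu>\<close>,
so the Weyr number of index \<open>j\<close> is \<open>\<rho>\<close> minus the number of \<open>\<gamma>\<^sub>i < j\<close>.
That last number is the codimension of the space of values at \<open>x = 0\<close> of all vectors \<open>y\<close> with
\<open>A y\<close> divisible by \<open>x\<^sup>j\<close>. A rank one update \<open>A + u v\<^sup>T\<close> imposes the same condition
as \<open>A\<close> on the vectors with \<open>v y = 0\<close>, and these miss at most one dimension, because of two
elements of a valuation ring one divides the other. Hence this codimension changes by at most one
(\<open>dim_res_sol_rank_one\<close>), and so does \<open>\<rho>\<close>, which gives the bound 2.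

For the column Brunovsky partition let \<open>N\<close> be the kernel of the pencil over the field of
rational functions. Then \<open>r\<^sub>0\<close> is the dimension of \<open>N\<close>, and
\<open>r\<^sub>0 - r\<^sub>k\<^sub>+\<^sub>1\<close> is the dimension of the span of the polynomial
vectors of degree at most \<open>k\<close> in \<open>N\<close>: no basis has more members of degree at most \<open>k\<close>, a
basis chosen greedily attains this number for all \<open>k\<close> at once, and therefore so does every basis
with least sum of degrees (\<open>column_brunovsky_eq\<close>). Now let \<open>N'\<close> be the
kernel in \<open>N\<close> of a linear form with polynomial coefficients of degree at most \<open>b\<close>, and let
\<open>a\<close> be the least degree of a polynomial vector of \<open>N\<close> outside \<open>N'\<close>. Passing from
\<open>N\<close> to \<open>N'\<close> lowers the entries of index at most \<open>a\<close> by exactly one and raises each later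
entry by a number between 0 and \<open>a + b\<close> (\<open>brunovsky_seq_form_kernel\<close>).

A pencil of rank one is a product \<open>u v\<^sup>T\<close> in which \<open>u\<close> or \<open>v\<close> is constant
(\<open>rank_one_pencil_factorization\<close>). If \<open>u\<close> is constant, the kernels of \<open>H\<close> and
\<open>H + P\<close> are cut out of one common space by forms of degree at most one; if \<open>v\<close> is constant, they
contain one common space cut out of each of them by the form \<open>v\<close>. So at most two steps of the above
kind lead from \<open>r\<close> to the new partition, and a large change at some index is possible
only if many entries of \<open>r\<close> are large, that is, if the diagram of \<open>r\<close> contains a large
rectangle. Counting its cells gives differences between \<open>- 1 - \<lfloor>sqrt |r|\<rfloor>\<close> and
\<open>2 + \<lfloor>sqrt (|r| - 1)\<rfloor>\<close>, and between -1 and 2 if \<open>r\<close> is zero;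
these intervals lie inside those of the theorem (\<open>brunovsky_boundsI\<close>). The
row Brunovsky partition is that of the transposed pencil.\<close>

section \<open>Minors with indices given by functions\<close>

text \<open>Rows and columns are selected by arbitrary functions, so that the minors occurring in a Laplace
expansion or after replacing a row are of the same kind. A selection with a repetition gives 0, and
the order of the selection affects only the sign.\<close>

definition fminor :: "(nat \<Rightarrow> nat \<Rightarrow> 'a::comm_ring_1) \<Rightarrow> nat \<Rightarrow> (nat \<Rightarrow> nat) \<Rightarrow> (nat \<Rightarrow> nat) \<Rightarrow> 'a" where
  "fminor A k f g = det (mat k k (\<lambda>(i, j). A (f i) (g j)))"

text \<open>For \<open>d = 0\<close> this says that all minors of order \<open>k\<close> vanish, so rank conditions are the
special case \<open>d = 0\<close> of divisibility conditions.\<close>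

definition dvd_minors :: "'a::comm_ring_1 \<Rightarrow> nat \<Rightarrow> (nat \<Rightarrow> nat \<Rightarrow> 'a) \<Rightarrow> nat set \<Rightarrow> nat set \<Rightarrow> bool" where
  "dvd_minors d k A I J \<longleftrightarrow>
     (\<forall>f g. f ` {..<k} \<subseteq> I \<longrightarrow> g ` {..<k} \<subseteq> J \<longrightarrow> d dvd fminor A k f g)"

lemma fminor_0 [simp]: "fminor A 0 f g = 1"
  by (simp add: fminor_def det_dim_zero)

lemma fminor_cong:
  assumes "\<And>i j. i < k \<Longrightarrow> j < k \<Longrightarrow> A (f i) (g j) = A' (f' i) (g' j)"
  shows "fminor A k f g = fminor A' k f' g'"
  unfolding fminor_def using assms by (intro arg_cong[where f = det] cong_mat) auto

lemma fminor_expand_row: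
  assumes "l < Suc k"
  shows "fminor A (Suc k) f g =
    (\<Sum>j<Suc k. A (f l) (g j) * ((-1) ^ (l + j) * fminor A k (f \<circ> insert_index l) (g \<circ> insert_index j)))"
proof -
  let ?M = "mat (Suc k) (Suc k) (\<lambda>(i, j). A (f i) (g j))"
  have "mat_delete ?M l j = mat k k (\<lambda>(i, j'). A ((f \<circ> insert_index l) i) ((g \<circ> insert_index j) j'))"
    if "j < Suc k" for j
    unfolding mat_delete_def using that assms by (intro eq_matI) (auto simp: insert_index_def)
  then have "cofactor ?M l j = (-1) ^ (l + j) * fminor A k (f \<circ> insert_index l) (g \<circ> insert_index j)"
    if "j < Suc k" for j
    using that by (simp add: cofactor_def fminor_def)
  then show ?thesis
    unfolding fminor_def[of A "Suc k"] using assms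
    by (subst laplace_expansion_row[of _ "Suc k" l]) (auto intro!: sum.cong)
qed

lemma fminor_transpose: "fminor (\<lambda>i j. A j i) k g f = fminor A k f g"
proof -
  have "mat k k (\<lambda>(i, j). A (f j) (g i)) = transpose_mat (mat k k (\<lambda>(i, j). A (f i) (g j)))"
    by (intro eq_matI) auto
  then show ?thesis unfolding fminor_def by (metis det_transpose mat_carrier)
qed

lemma fminor_not_inj_rows:
  assumes "\<not> inj_on f {..<k}"
  shows "fminor A k f g = 0"
proof -
  from assms obtain i j where ij: "i < k" "j < k" "i \<noteq> j" "f i = f j"
    unfolding inj_on_def by auto
  show ?thesis unfolding fminor_def
    by (rule det_identical_rows[OF _ ij(3,1,2)]) (use ij in \<open>auto intro!: eq_vecI\<close>)
qed

lemma fminor_not_inj_cols: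
  assumes "\<not> inj_on g {..<k}"
  shows "fminor A k f g = 0"
  using fminor_not_inj_rows[OF assms, of "\<lambda>i j. A j i" f] fminor_transpose[of A] by simp

lemma fminor_zero_row:
  assumes "l < k" "\<And>j. j < k \<Longrightarrow> A (f l) (g j) = 0"
  shows "fminor A k f g = 0"
proof -
  from assms(1) obtain k' where k: "k = Suc k'" by (cases k) auto
  show ?thesis unfolding k using assms unfolding k by (subst fminor_expand_row[of l]) auto
qed

lemma fminor_zero_col:
  assumes "l < k" "\<And>i. i < k \<Longrightarrow> A (f i) (g l) = 0"
  shows "fminor A k f g = 0"
  using fminor_zero_row[of l k "\<lambda>i j. A j i" g f] assms fminor_transpose[of A k g f] by simp

lemma insert_index_less: "i < k \<Longrightarrow> insert_index l i < Suc k"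
  by (auto simp: insert_index_def)

text \<open>The determinant is linear in each row. The rows are changed one after the other; the second summand
that arises when row \<open>l\<close> is changed has row \<open>i0\<close> of \<open>B\<close> in place \<open>l\<close>, so it is covered by the
induction hypothesis for the selection \<open>f(l := i0)\<close>.\<close>

lemma dvd_minors_row_operations:
  assumes B: "dvd_minors d k B I J" and i0: "i0 \<in> I"
  shows "dvd_minors d k (\<lambda>i j. B i j + c i * B i0 j) I J"
proof -
  let ?A = "\<lambda>i j. B i j + c i * B i0 j"
  define M where "M l f g = det (mat k k (\<lambda>(i, j). (if i < l then ?A else B) (f i) (g j)))" for l f g
  have "d dvd M l f g" if "l \<le> k" "f ` {..<k} \<subseteq> I" "g ` {..<k} \<subseteq> J" for l f g
    using that
  proof (induction l arbitrary: f)
    case 0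
    then show ?case using B by (simp add: dvd_minors_def fminor_def M_def)
  next
    case (Suc l)
    have lk: "l < k" using Suc.prems by simp
    then obtain k' where k: "k = Suc k'" by (cases k) auto
    define X where "X h = mat k k (\<lambda>(i, j). if i = l then h j
      else (if i < l then ?A else B) (f i) (g j))" for h :: "nat \<Rightarrow> 'a"
    have cof: "cofactor (X h) l j = cofactor (X h') l j" if "j < k" for h h' j
      unfolding cofactor_def using that lk unfolding X_def mat_delete_def k
      by (intro arg_cong[where f = "\<lambda>x. _ * det x"]) (auto intro!: eq_matI)
    have det_X: "det (X h) = (\<Sum>j<k. h j * cofactor (X (\<lambda>_. 0)) l j)" for h
    proof -
      have "det (X h) = (\<Sum>j<k. X h $$ (l, j) * cofactor (X h) l j)"
        by (rule laplace_expansion_row[OF _ lk]) (simp add: X_def)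
      also have "\<dots> = (\<Sum>j<k. h j * cofactor (X (\<lambda>_. 0)) l j)"
      proof (rule sum.cong)
        fix j assume "j \<in> {..<k}"
        then have "X h $$ (l, j) = h j" "cofactor (X h) l j = cofactor (X (\<lambda>_. 0)) l j"
          using lk cof by (auto simp: X_def)
        then show "X h $$ (l, j) * cofactor (X h) l j = h j * cofactor (X (\<lambda>_. 0)) l j" by simp
      qed simp
      finally show ?thesis .
    qed
    have "M (Suc l) f g = det (X (\<lambda>j. ?A (f l) (g j)))"
      unfolding M_def X_def by (intro arg_cong[where f = det] cong_mat) auto
    also have "\<dots> = det (X (\<lambda>j. B (f l) (g j))) + c (f l) * det (X (\<lambda>j. B i0 (g j)))"
      unfolding det_X by (simp add: algebra_simps sum.distrib sum_distrib_left)
    also have "det (X (\<lambda>j. B (f l) (g j))) = M l f g"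
      unfolding M_def X_def by (intro arg_cong[where f = det] cong_mat) auto
    also have "det (X (\<lambda>j. B i0 (g j))) = M l (f(l := i0)) g"
      unfolding M_def X_def by (intro arg_cong[where f = det] cong_mat) auto
    finally have *: "M (Suc l) f g = M l f g + c (f l) * M l (f(l := i0)) g" .
    have "d dvd M l f g" using Suc by simp
    moreover have "d dvd M l (f(l := i0)) g"
      using Suc.prems i0 by (intro Suc.IH) auto
    ultimately show ?case unfolding * by simp
  qed
  moreover have "M k f g = fminor ?A k f g" for f g
    unfolding M_def fminor_def by (intro arg_cong[where f = det] cong_mat) auto
  ultimately show ?thesis unfolding dvd_minors_def by (metis order_refl)
qed

text \<open>One step of elimination, with the Schur complement \<open>A'\<close> of the pivot. Row operations clear the
column of the pivot. Bordering a minor of \<open>A'\<close> by the pivot then multiplies it by the pivot.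
Conversely a minor of order \<open>k + 1\<close> has no repeated row and can be expanded along the pivot row if
that is selected, and along any row otherwise; the entries are multiples of the pivot, and the cofactors are
minors of \<open>A'\<close>.\<close>

lemma dvd_minors_pivot:
  fixes A :: "nat \<Rightarrow> nat \<Rightarrow> 'a::comm_ring_1"
  assumes i0: "i0 \<in> I" and j0: "j0 \<in> J"
    and pivot: "\<And>i j. i \<in> I \<Longrightarrow> j \<in> J \<Longrightarrow> A i0 j0 dvd A i j"
    and c: "\<And>i. i \<in> I \<Longrightarrow> A i j0 = c i * A i0 j0"
  defines "A' \<equiv> \<lambda>i j. A i j - c i * A i0 j"
  shows "dvd_minors d (Suc k) A I J \<longleftrightarrow>
    (\<forall>f g. f ` {..<k} \<subseteq> I - {i0} \<longrightarrow> g ` {..<k} \<subseteq> J - {j0} \<longrightarrow> d dvd A i0 j0 * fminor A' k f g)"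
    (is "?L \<longleftrightarrow> ?R")
proof -
  let ?a = "A i0 j0"
  \<comment> \<open>the coefficient 0 at \<open>i0\<close> keeps the pivot row\<close>
  define e where "e = c(i0 := 0)"
  define B where "B i j = A i j + (- e i) * A i0 j" for i j
  have B0: "B i0 j = A i0 j" for j by (simp add: B_def e_def)
  have B1: "B i j = A' i j" if "i \<noteq> i0" for i j
    using that by (simp add: B_def A'_def e_def)
  have AB: "A i j = B i j + e i * B i0 j" for i j
    by (simp add: B_def e_def)
  have LB: "?L \<longleftrightarrow> dvd_minors d (Suc k) B I J"
  proof
    assume ?L then show "dvd_minors d (Suc k) B I J"
      unfolding B_def[abs_def] by (rule dvd_minors_row_operations) fact
  next
    assume "dvd_minors d (Suc k) B I J"
    then have "dvd_minors d (Suc k) (\<lambda>i j. B i j + e i * B i0 j) I J"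
      by (rule dvd_minors_row_operations) fact
    moreover have "(\<lambda>i j. B i j + e i * B i0 j) = A" by (intro ext) (rule AB[symmetric])
    ultimately show ?L by simp
  qed
  have Bcol: "B i j0 = 0" if "i \<in> I" "i \<noteq> i0" for i
    using c[OF that(1)] that(2) by (simp add: B1 A'_def)
  have Bdvd: "?a dvd B i j" if "i \<in> I" "j \<in> J" for i j
    using pivot that i0 by (auto simp: B_def)
  have "dvd_minors d (Suc k) B I J \<longleftrightarrow> ?R"
  proof
    assume B: "dvd_minors d (Suc k) B I J"
    show ?R
    proof (intro allI impI)
      fix f g assume f: "f ` {..<k} \<subseteq> I - {i0}" and g: "g ` {..<k} \<subseteq> J - {j0}"
      define f' where "f' = case_nat i0 f"
      define g' where "g' = case_nat j0 g"
      let ?BT = "\<lambda>i j. B j i"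
      have "fminor B (Suc k) f' g' = fminor ?BT (Suc k) g' f'" by (rule fminor_transpose[symmetric])
      also have "\<dots> = (\<Sum>i<Suc k. ?BT (g' 0) (f' i) *
          ((-1) ^ (0 + i) * fminor ?BT k (g' \<circ> insert_index 0) (f' \<circ> insert_index i)))"
        by (rule fminor_expand_row) simp
      also have "\<dots> = (\<Sum>i\<in>{0}. ?BT (g' 0) (f' i) *
          ((-1) ^ (0 + i) * fminor ?BT k (g' \<circ> insert_index 0) (f' \<circ> insert_index i)))"
      proof (rule sum.mono_neutral_right)
        show "\<forall>i\<in>{..<Suc k} - {0}. ?BT (g' 0) (f' i) *
          ((-1) ^ (0 + i) * fminor ?BT k (g' \<circ> insert_index 0) (f' \<circ> insert_index i)) = 0"
        proof
          fix i assume "i \<in> {..<Suc k} - {0}"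
          then obtain i' where i': "i = Suc i'" "i' < k" by (cases i) auto
          then have "f i' \<in> I" "f i' \<noteq> i0" using f by auto
          then show "?BT (g' 0) (f' i) *
          ((-1) ^ (0 + i) * fminor ?BT k (g' \<circ> insert_index 0) (f' \<circ> insert_index i)) = 0"
            using Bcol i' by (simp add: g'_def f'_def)
        qed
      qed auto
      also have "\<dots> = ?a * fminor ?BT k (g' \<circ> insert_index 0) (f' \<circ> insert_index 0)"
        by (simp add: f'_def g'_def B0)
      also have "fminor ?BT k (g' \<circ> insert_index 0) (f' \<circ> insert_index 0) = fminor ?BT k g f"
        by (rule fminor_cong) (simp add: f'_def g'_def insert_index_def)
      also have "\<dots> = fminor B k f g" by (rule fminor_transpose)
      also have "\<dots> = fminor A' k f g" using f by (intro fminor_cong B1) auto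
      finally have "fminor B (Suc k) f' g' = ?a * fminor A' k f g" .
      moreover have "f' ` {..<Suc k} \<subseteq> I"
        using f i0 by (auto simp: f'_def lessThan_Suc_eq_insert_0)
      moreover have "g' ` {..<Suc k} \<subseteq> J"
        using g j0 by (auto simp: g'_def lessThan_Suc_eq_insert_0)
      moreover have "d dvd fminor B (Suc k) f' g'"
        using B calculation unfolding dvd_minors_def by blast
      ultimately show "d dvd ?a * fminor A' k f g" by simp
    qed
  next
    assume R: ?R
    have minor_B: "d dvd ?a * fminor B k f g"
      if f: "f ` {..<k} \<subseteq> I - {i0}" and g: "g ` {..<k} \<subseteq> J" for f g
    proof (cases "j0 \<in> g ` {..<k}")
      case True
      then obtain l where "l < k" "g l = j0" by auto
      then have "fminor B k f g = 0" using f Bcol by (intro fminor_zero_col[of l]) auto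
      then show ?thesis by simp
    next
      case False
      have "fminor B k f g = fminor A' k f g" using f by (intro fminor_cong B1) auto
      moreover have "g ` {..<k} \<subseteq> J - {j0}" using g False by blast
      ultimately show ?thesis using R f by simp
    qed
    show "dvd_minors d (Suc k) B I J" unfolding dvd_minors_def
    proof (intro allI impI)
      fix f g assume f: "f ` {..<Suc k} \<subseteq> I" and g: "g ` {..<Suc k} \<subseteq> J"
      show "d dvd fminor B (Suc k) f g"
      proof (cases "inj_on f {..<Suc k}")
        case False
        then show ?thesis by (simp add: fminor_not_inj_rows)
      next
        case inj: True
        define l where "l = (if i0 \<in> f ` {..<Suc k} then SOME l. l < Suc k \<and> f l = i0 else 0)"
        have l: "l < Suc k \<and> (i0 \<in> f ` {..<Suc k} \<longrightarrow> f l = i0)"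
        proof (cases "i0 \<in> f ` {..<Suc k}")
          case True
          then have "\<exists>l. l < Suc k \<and> f l = i0" by auto
          from someI_ex[OF this] show ?thesis using True by (auto simp: l_def)
        qed (simp add: l_def)
        have f_del: "(f \<circ> insert_index l) ` {..<k} \<subseteq> I - {i0}"
        proof
          fix x assume "x \<in> (f \<circ> insert_index l) ` {..<k}"
          then obtain i where i: "i < k" "x = f (insert_index l i)" by auto
          have lt: "insert_index l i < Suc k" using i insert_index_less by blast
          have ne: "insert_index l i \<noteq> l" by (auto simp: insert_index_def)
          have "x \<in> I" using f lt i by auto
          moreover have "x \<noteq> i0"
          proof
            assume x: "x = i0"
            then have "i0 \<in> f ` {..<Suc k}" using i lt by auto
            then have "f l = f (insert_index l i)" using l x i by simp
            then show False using inj l lt ne by (metis inj_onD lessThan_iff)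
          qed
          ultimately show "x \<in> I - {i0}" by simp
        qed
        have "d dvd B (f l) (g j) * ((-1) ^ (l + j) * fminor B k (f \<circ> insert_index l) (g \<circ> insert_index j))"
          if j: "j < Suc k" for j
        proof -
          have "f l \<in> I" "g j \<in> J" using f g l j by auto
          then obtain q where q: "B (f l) (g j) = ?a * q" using Bdvd by (auto simp: dvd_def)
          have "(g \<circ> insert_index j) ` {..<k} \<subseteq> J"
            using g insert_index_less by fastforce
          from dvd_mult2[OF minor_B[OF f_del this], of "q * (-1) ^ (l + j)"]
          show ?thesis unfolding q by (simp add: ac_simps)
        qed
        then show ?thesis
          unfolding fminor_expand_row[OF conjunct1[OF l]] by (intro dvd_sum) simp
      qed
    qed
  qed
  with LB show ?thesis by simp
qed

section \<open>Finite-dimensional spaces of functions\<close>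

text \<open>Vectors are functions of the coordinate index that vanish outside a finite set of coordinates. The
functions form a group under pointwise addition, so the theory of vector spaces applies without carrier sets.\<close>

definition fscale :: "'a::field \<Rightarrow> (nat \<Rightarrow> 'a) \<Rightarrow> nat \<Rightarrow> 'a" where
  "fscale c x = (\<lambda>i. c * x i)"

interpretation vs: vector_space fscale
  by unfold_locales (auto simp: fscale_def algebra_simps fun_eq_iff)

definition coord_space :: "nat set \<Rightarrow> (nat \<Rightarrow> 'a::zero) set" where
  "coord_space J = {x. \<forall>j. j \<notin> J \<longrightarrow> x j = 0}"

definition unit_fun :: "nat \<Rightarrow> nat \<Rightarrow> 'a::zero_neq_one" where
  "unit_fun j = (\<lambda>i. if i = j then 1 else 0)"

lemma fscale_apply [simp]: "fscale c x i = c * x i"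
  by (simp add: fscale_def)

lemma sum_fun_apply: "sum f A (i::nat) = (\<Sum>a\<in>A. (f a :: nat \<Rightarrow> 'a::comm_monoid_add) i)"
  by (induction A rule: infinite_finite_induct) auto

lemma subspace_coord_space: "vs.subspace (coord_space J)"
  by (auto simp: vs.subspace_def coord_space_def)

lemma inj_unit_fun: "inj (unit_fun :: nat \<Rightarrow> nat \<Rightarrow> 'a::zero_neq_one)"
  by (auto simp: inj_def unit_fun_def fun_eq_iff split: if_splits)

lemma coord_space_expand:
  assumes "finite J" "x \<in> coord_space J"
  shows "x = (\<Sum>j\<in>J. fscale (x j) (unit_fun j))"
proof
  fix i
  show "x i = (\<Sum>j\<in>J. fscale (x j) (unit_fun j)) i"
    using assms by (auto simp: sum_fun_apply unit_fun_def coord_space_def sum.delta if_distrib cong: if_cong)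
qed

lemma span_unit_fun:
  assumes "finite J"
  shows "vs.span (unit_fun ` J) = (coord_space J :: (nat \<Rightarrow> 'a::field) set)"
proof (rule vs.span_subspace)
  show "unit_fun ` J \<subseteq> (coord_space J :: (nat \<Rightarrow> 'a) set)"
    by (auto simp: coord_space_def unit_fun_def)
  show "(coord_space J :: (nat \<Rightarrow> 'a) set) \<subseteq> vs.span (unit_fun ` J)"
  proof
    fix x :: "nat \<Rightarrow> 'a" assume "x \<in> coord_space J"
    then show "x \<in> vs.span (unit_fun ` J)"
      by (subst coord_space_expand[OF assms], assumption) (intro vs.span_sum vs.span_scale vs.span_base imageI)
  qed
qed (rule subspace_coord_space)

lemma dim_coord_space:
  assumes "finite J"
  shows "vs.dim (coord_space J :: (nat \<Rightarrow> 'a::field) set) = card J"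
proof -
  have "vs.independent (unit_fun ` J :: (nat \<Rightarrow> 'a) set)"
  proof (rule vs.independent_if_scalars_zero)
    fix f :: "(nat \<Rightarrow> 'a) \<Rightarrow> 'a" and x :: "nat \<Rightarrow> 'a"
    assume 0: "(\<Sum>x\<in>unit_fun ` J. fscale (f x) x) = 0" and x: "x \<in> unit_fun ` J"
    then obtain j where j: "j \<in> J" "x = unit_fun j" by auto
    have "(\<Sum>x\<in>unit_fun ` J. fscale (f x) x) = (\<Sum>j\<in>J. fscale (f (unit_fun j)) (unit_fun j))"
      by (subst sum.reindex) (auto intro: inj_on_subset[OF inj_unit_fun])
    then have "0 = (\<Sum>j\<in>J. fscale (f (unit_fun j)) (unit_fun j)) j" using 0 by simp
    also have "\<dots> = f (unit_fun j)"
      using assms j by (simp add: sum_fun_apply unit_fun_def if_distrib cong: if_cong)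
    finally show "f x = 0" using j by simp
  qed (use assms in auto)
  then have "vs.dim (coord_space J :: (nat \<Rightarrow> 'a) set) = card (unit_fun ` J :: (nat \<Rightarrow> 'a) set)"
    unfolding span_unit_fun[OF assms, symmetric] by (rule vs.dim_span_eq_card_independent)
  then show ?thesis by (simp add: card_image inj_on_subset[OF inj_unit_fun])
qed

lemma finite_if_independent_coord_space:
  assumes "finite J" "S \<subseteq> coord_space J" "vs.independent S"
  shows "finite S"
proof -
  have "S \<subseteq> vs.span (unit_fun ` J)" using assms by (simp add: span_unit_fun)
  with vs.independent_span_bound[OF _ assms(3)] show ?thesis
    using assms by (meson finite_imageI)
qed

lemma fdim_basis:
  fixes S :: "(nat \<Rightarrow> 'a::field) set"
  assumes "finite J" "S \<subseteq> coord_space J"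
  obtains B where "B \<subseteq> S" "vs.independent B" "S \<subseteq> vs.span B" "card B = vs.dim S" "finite B"
proof -
  obtain B where B: "B \<subseteq> S" "vs.independent B" "S \<subseteq> vs.span B" "card B = vs.dim S"
    using vs.basis_exists by blast
  with assms finite_if_independent_coord_space[of J B] that show thesis by blast
qed

text \<open>The space of all functions is not finite-dimensional, so facts about dimensions need containment in
the space of functions supported in a finite set.\<close>

lemma fdim_mono:
  fixes S :: "(nat \<Rightarrow> 'a::field) set"
  assumes "finite J" "T \<subseteq> coord_space J" "S \<subseteq> vs.span T"
  shows "vs.dim S \<le> vs.dim T"
proof -
  obtain B where B: "B \<subseteq> T" "T \<subseteq> vs.span B" "card B = vs.dim T" "finite B"
    using fdim_basis[OF assms(1,2)] by metis
  have "vs.span T \<subseteq> vs.span B" using B(2) by (rule vs.span_minimal) (rule vs.subspace_span)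
  with assms(3) have "S \<subseteq> vs.span B" by (rule order_trans)
  from vs.dim_le_card[OF this B(4)] B(3) show ?thesis by simp
qed

lemma fdim_independent_le:
  fixes S :: "(nat \<Rightarrow> 'a::field) set"
  assumes "finite J" "T \<subseteq> coord_space J" "S \<subseteq> vs.span T" "vs.independent S"
  shows "card S \<le> vs.dim T"
  using fdim_mono[OF assms(1-3)] vs.dim_eq_card_independent[OF assms(4)] by simp

lemma fdim_le_Suc:
  fixes S :: "(nat \<Rightarrow> 'a::field) set"
  assumes "finite J" "T \<subseteq> coord_space J" "S \<subseteq> vs.span (insert x T)"
  shows "vs.dim S \<le> Suc (vs.dim T)"
proof -
  obtain B where B: "B \<subseteq> T" "T \<subseteq> vs.span B" "card B = vs.dim T" "finite B"
    using fdim_basis[OF assms(1,2)] by metis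
  have "insert x T \<subseteq> vs.span (insert x B)"
    using B vs.span_mono[of B "insert x B"] by (auto intro: vs.span_base)
  then have "vs.span (insert x T) \<subseteq> vs.span (insert x B)"
    by (rule vs.span_minimal) (rule vs.subspace_span)
  with assms(3) have "S \<subseteq> vs.span (insert x B)" by (rule order_trans)
  from vs.dim_le_card[OF this] B(4) have "vs.dim S \<le> card (insert x B)" by simp
  also have "\<dots> \<le> Suc (card B)" by (simp add: card_insert_le_m1 card_insert_if B)
  finally show ?thesis using B by simp
qed

lemma fdim_less:
  fixes S :: "(nat \<Rightarrow> 'a::field) set"
  assumes "finite J" "T \<subseteq> coord_space J" "S \<subseteq> T" "x \<in> T" "x \<notin> vs.span S"
  shows "Suc (vs.dim S) \<le> vs.dim T"
proof -
  obtain B where B: "B \<subseteq> S" "S \<subseteq> vs.span B" "card B = vs.dim S" "finite B" "vs.independent B"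
    using fdim_basis[OF assms(1), of S] assms by (metis order_trans)
  have "x \<notin> vs.span B" using assms(5) vs.span_mono[OF B(1)] by auto
  then have "vs.independent (insert x B)" using B by (intro vs.independent_insertI)
  moreover have "insert x B \<subseteq> vs.span T" using B assms vs.span_superset[of T] by blast
  ultimately have "card (insert x B) \<le> vs.dim T" using fdim_independent_le assms(1,2) by blast
  moreover have "x \<notin> B" using \<open>x \<notin> vs.span B\<close> vs.span_superset by blast
  ultimately show ?thesis using B by simp
qed

lemma fdim_linear_image:
  fixes S :: "(nat \<Rightarrow> 'a::field) set"
  assumes "finite J" "S \<subseteq> coord_space J" "Vector_Spaces.linear fscale fscale f" "inj_on f (coord_space J)"
  shows "vs.dim (f ` S) = vs.dim S"
proof -
  interpret f: Vector_Spaces.linear fscale fscale f by fact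
  obtain B where B: "B \<subseteq> S" "S \<subseteq> vs.span B" "card B = vs.dim S" "finite B" "vs.independent B"
    using fdim_basis[OF assms(1,2)] by metis
  have "vs.span B \<subseteq> coord_space J"
    using B(1) assms(2) subspace_coord_space[of J] vs.span_minimal[of B "coord_space J"] by blast
  then have inj: "inj_on f (vs.span B)" using assms(4) inj_on_subset by blast
  have "vs.independent (f ` B)" using B(5) inj by (rule f.independent_injective_image)
  moreover have "f ` S \<subseteq> vs.span (f ` B)" using B(2) by (rule f.spans_image)
  ultimately have "vs.dim (f ` S) = card (f ` B)"
    using B(1) by (intro vs.dim_unique[of "f ` B"]) auto
  also have "\<dots> = card B" using inj vs.span_superset by (intro card_image) (rule inj_on_subset)
  finally show ?thesis using B by simp
qed

section \<open>Elimination over a valuation ring\<close>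

text \<open>A valuation ring together with the reduction modulo its maximal ideal.\<close>

locale valuation_residue =
  fixes \<pi> :: "'r::idom \<Rightarrow> 'c::field"
  assumes res_add: "\<pi> (x + y) = \<pi> x + \<pi> y"
    and res_mult: "\<pi> (x * y) = \<pi> x * \<pi> y"
    and res_unit: "\<pi> x = 0 \<longleftrightarrow> \<not> x dvd 1"
    and res_surj: "\<exists>x. \<pi> x = c"
    and dvd_total: "x dvd y \<or> y dvd x"
begin

lemma res_0: "\<pi> 0 = 0"
  by (simp add: res_unit)

lemma res_minus: "\<pi> (- x) = - \<pi> x"
  using res_add[of x "- x"] by (simp add: eq_neg_iff_add_eq_0 add.commute res_0)

lemma res_sum: "\<pi> (sum f A) = (\<Sum>a\<in>A. \<pi> (f a))"
  by (induction A rule: infinite_finite_induct) (auto simp: res_add res_0)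

lemma res_eq_0:
  assumes "\<not> d dvd a" "d dvd a * y"
  shows "\<pi> y = 0"
proof -
  have "\<not> y dvd 1"
  proof
    assume "y dvd 1"
    then obtain z where "1 = y * z" by (auto simp: dvd_def)
    then have "a = a * y * z" by (simp add: mult.assoc)
    with assms show False by (metis dvd_mult2)
  qed
  then show ?thesis by (simp add: res_unit)
qed

lemma exists_least_divisor:
  assumes "finite S" "S \<noteq> {}"
  shows "\<exists>a\<in>S. \<forall>b\<in>S. a dvd (b :: 'r)"
  using assms
proof (induction S rule: finite_ne_induct)
  case (insert x F)
  then obtain a where a: "a \<in> F" "\<forall>b\<in>F. a dvd b" by blast
  show ?case
  proof (cases "a dvd x")
    case True
    then show ?thesis using a by (intro bexI[of _ a]) auto
  next
    case False
    then have "x dvd a" using dvd_total by blast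
    then have "\<forall>b\<in>F. x dvd b" using a(2) dvd_trans by blast
    then show ?thesis by (intro bexI[of _ x]) auto
  qed
qed auto

definition sol :: "'r \<Rightarrow> (nat \<Rightarrow> nat \<Rightarrow> 'r) \<Rightarrow> nat set \<Rightarrow> nat set \<Rightarrow> (nat \<Rightarrow> 'r) set" where
  "sol d A I J = {x \<in> coord_space J. \<forall>i\<in>I. d dvd (\<Sum>j\<in>J. A i j * x j)}"

text \<open>The reductions of the solutions of \<open>A x \<equiv> 0\<close> modulo \<open>d\<close>. Over a field, with the identity as
reduction and \<open>d = 0\<close>, this is the kernel of \<open>A\<close>. In general its codimension is the number of
elementary divisors of \<open>A\<close> that are not divisible by \<open>d\<close>.\<close>

definition res_sol :: "'r \<Rightarrow> (nat \<Rightarrow> nat \<Rightarrow> 'r) \<Rightarrow> nat set \<Rightarrow> nat set \<Rightarrow> (nat \<Rightarrow> 'c) set" where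
  "res_sol d A I J = (\<lambda>x j. \<pi> (x j)) ` sol d A I J"

lemma res_sol_coord: "res_sol d A I J \<subseteq> coord_space J"
  by (auto simp: res_sol_def sol_def coord_space_def res_0)

lemma res_sol_all:
  assumes "\<And>i j. i \<in> I \<Longrightarrow> j \<in> J \<Longrightarrow> d dvd A i j"
  shows "res_sol d A I J = coord_space J"
proof
  show "coord_space J \<subseteq> res_sol d A I J"
  proof
    fix y :: "nat \<Rightarrow> 'c" assume y: "y \<in> coord_space J"
    have "\<exists>z. \<pi> z = y j \<and> (j \<notin> J \<longrightarrow> z = 0)" for j
      using y res_surj[of "y j"] by (cases "j \<in> J") (auto simp: coord_space_def res_0)
    then obtain x where x: "\<And>j. \<pi> (x j) = y j" "\<And>j. j \<notin> J \<Longrightarrow> x j = 0" by metis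
    have "d dvd (\<Sum>j\<in>J. A i j * x j)" if "i \<in> I" for i
      using assms that by (intro dvd_sum dvd_mult2)
    then have "x \<in> sol d A I J" using x(2) by (simp add: sol_def coord_space_def)
    moreover have "y = (\<lambda>j. \<pi> (x j))" using x(1) by simp
    ultimately show "y \<in> res_sol d A I J" unfolding res_sol_def by blast
  qed
qed (rule res_sol_coord)

text \<open>If \<open>d\<close> does not divide the pivot, a multiple of the pivot can be divisible by \<open>d\<close> only if
the cofactor reduces to 0. So the congruence of the pivot row expresses the reduction of the coordinate \<open>j0\<close>
linearly through those of the other coordinates, and the solutions for \<open>A\<close> are the graph of
a linear map on the solutions for the Schur complement.\<close>

lemma dim_res_sol_pivot:
  fixes A :: "nat \<Rightarrow> nat \<Rightarrow> 'r"
  assumes fin: "finite J" and i0: "i0 \<in> I" and j0: "j0 \<in> J"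
    and c: "\<And>i. i \<in> I \<Longrightarrow> A i j0 = c i * A i0 j0"
    and c': "\<And>j. j \<in> J \<Longrightarrow> A i0 j = A i0 j0 * c' j"
    and d: "\<not> d dvd A i0 j0"
  defines "A' \<equiv> \<lambda>i j. A i j - c i * A i0 j"
  shows "vs.dim (res_sol d A I J) = vs.dim (res_sol d A' (I - {i0}) (J - {j0}))"
proof -
  let ?a = "A i0 j0" and ?J = "J - {j0}"
  \<comment> \<open>the map onto the graph: the residue of the pivot coordinate is determined by the others\<close>
  define T :: "(nat \<Rightarrow> 'c) \<Rightarrow> nat \<Rightarrow> 'c"
    where "T y = y(j0 := - (\<Sum>j\<in>?J. \<pi> (c' j) * y j))" for y
  have lin: "Vector_Spaces.linear fscale fscale T"
  proof (unfold_locales)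
    show "T (x + y) = T x + T y" for x y
      by (auto simp: T_def fun_eq_iff algebra_simps sum.distrib)
    show "T (fscale r x) = fscale r (T x)" for r x
      by (auto simp: T_def fun_eq_iff sum_distrib_left algebra_simps)
  qed
  have inj: "inj_on T (coord_space ?J)"
  proof (rule inj_onI)
    fix x y assume xy: "x \<in> coord_space ?J" "y \<in> coord_space ?J" "T x = T y"
    show "x = y"
    proof
      fix j
      have "T x j = T y j" using xy by simp
      then show "x j = y j" using xy(1,2) by (cases "j = j0") (auto simp: T_def coord_space_def)
    qed
  qed
  have row0: "(\<Sum>j\<in>J. A i0 j * x j) = ?a * (x j0 + (\<Sum>j\<in>?J. c' j * x j))" for x :: "nat \<Rightarrow> 'r"
  proof -
    have "(\<Sum>j\<in>J. A i0 j * x j) = ?a * x j0 + (\<Sum>j\<in>?J. A i0 j * x j)"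
      by (rule sum.remove[OF fin j0])
    also have "(\<Sum>j\<in>?J. A i0 j * x j) = ?a * (\<Sum>j\<in>?J. c' j * x j)"
      unfolding sum_distrib_left using c' by (intro sum.cong) auto
    finally show ?thesis by (simp add: distrib_left)
  qed
  have rowi: "(\<Sum>j\<in>J. A i j * x j) = (\<Sum>j\<in>?J. A' i j * x j) + c i * (\<Sum>j\<in>J. A i0 j * x j)"
    if "i \<in> I" for i and x :: "nat \<Rightarrow> 'r"
  proof -
    have "(\<Sum>j\<in>J. A i j * x j) = (\<Sum>j\<in>J. A' i j * x j) + c i * (\<Sum>j\<in>J. A i0 j * x j)"
      unfolding sum_distrib_left sum.distrib[symmetric]
      by (intro sum.cong) (auto simp: A'_def algebra_simps)
    also have "(\<Sum>j\<in>J. A' i j * x j) = A' i j0 * x j0 + (\<Sum>j\<in>?J. A' i j * x j)"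
      by (rule sum.remove[OF fin j0])
    also have "A' i j0 = 0" using c[OF that] by (simp add: A'_def)
    finally show ?thesis by simp
  qed
  have "res_sol d A I J = T ` res_sol d A' (I - {i0}) ?J"
  proof (intro equalityI subsetI)
    fix y assume "y \<in> res_sol d A I J"
    then obtain x where x: "x \<in> sol d A I J" "y = (\<lambda>j. \<pi> (x j))" by (auto simp: res_sol_def)
    define x' where "x' = x(j0 := 0)"
    have d0: "d dvd (\<Sum>j\<in>J. A i0 j * x j)" using x i0 by (auto simp: sol_def)
    then have "\<pi> (x j0 + (\<Sum>j\<in>?J. c' j * x j)) = 0" unfolding row0 using res_eq_0[OF d] by blast
    then have "\<pi> (x j0) = - (\<Sum>j\<in>?J. \<pi> (c' j) * \<pi> (x j))"
      by (simp add: res_add res_sum res_mult eq_neg_iff_add_eq_0)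
    then have "y = T (\<lambda>j. \<pi> (x' j))" by (auto simp: T_def x(2) x'_def fun_eq_iff)
    moreover have "x' \<in> sol d A' (I - {i0}) ?J"
    proof -
      have "d dvd (\<Sum>j\<in>?J. A' i j * x' j)" if i: "i \<in> I - {i0}" for i
      proof -
        have "(\<Sum>j\<in>?J. A' i j * x' j) = (\<Sum>j\<in>?J. A' i j * x j)"
          by (intro sum.cong) (auto simp: x'_def)
        also have "\<dots> = (\<Sum>j\<in>J. A i j * x j) - c i * (\<Sum>j\<in>J. A i0 j * x j)"
          using rowi[of i x] i by simp
        finally show ?thesis using x i d0 by (auto simp: sol_def intro!: dvd_diff)
      qed
      moreover have "x' \<in> coord_space ?J" using x by (auto simp: x'_def sol_def coord_space_def)
      ultimately show ?thesis by (simp add: sol_def)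
    qed
    ultimately show "y \<in> T ` res_sol d A' (I - {i0}) ?J" by (auto simp: res_sol_def)
  next
    fix y assume "y \<in> T ` res_sol d A' (I - {i0}) ?J"
    then obtain x where x: "x \<in> sol d A' (I - {i0}) ?J" "y = T (\<lambda>j. \<pi> (x j))"
      by (auto simp: res_sol_def)
    define x' where "x' = x(j0 := - (\<Sum>j\<in>?J. c' j * x j))"
    have same: "(\<Sum>j\<in>?J. h j * x' j) = (\<Sum>j\<in>?J. h j * x j)" for h
      by (intro sum.cong) (auto simp: x'_def)
    have 0: "(\<Sum>j\<in>J. A i0 j * x' j) = 0" unfolding row0 same by (simp add: x'_def)
    have "x' \<in> sol d A I J"
    proof -
      have "d dvd (\<Sum>j\<in>J. A i j * x' j)" if i: "i \<in> I" for i
      proof (cases "i = i0")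
        case False
        then show ?thesis using rowi[OF i, of x'] x i unfolding 0 same by (auto simp: sol_def)
      qed (simp add: 0)
      moreover have "x' \<in> coord_space J" using x j0 by (auto simp: x'_def sol_def coord_space_def)
      ultimately show ?thesis by (simp add: sol_def)
    qed
    moreover have "y = (\<lambda>j. \<pi> (x' j))"
      by (auto simp: x(2) T_def x'_def fun_eq_iff res_minus res_sum res_mult)
    ultimately show "y \<in> res_sol d A I J" by (auto simp: res_sol_def)
  qed
  then show ?thesis
    using fdim_linear_image[OF _ res_sol_coord lin inj] fin by simp
qed

text \<open>The list \<open>as\<close> is the diagonal of a Smith form of \<open>A\<close>, characterized by what it determines: the
determinantal divisors, the rank, and the dimensions of the solution spaces. The condition on
common divisors of the entries makes the induction work: it yields that a divisor of the pivot divides all later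
members of the list.\<close>

definition elementary_divisors :: "'r list \<Rightarrow> (nat \<Rightarrow> nat \<Rightarrow> 'r) \<Rightarrow> nat set \<Rightarrow> nat set \<Rightarrow> bool" where
  "elementary_divisors as A I J \<longleftrightarrow> 0 \<notin> set as \<and>
    (\<forall>e. (\<forall>i\<in>I. \<forall>j\<in>J. e dvd A i j) \<longrightarrow> (\<forall>a\<in>set as. e dvd a)) \<and>
    (\<forall>k\<le>length as. \<forall>e. dvd_minors e k A I J \<longleftrightarrow> e dvd prod_list (take k as)) \<and>
    (\<forall>k>length as. dvd_minors 0 k A I J) \<and>
    (\<forall>d. vs.dim (res_sol d A I J) + length (filter (\<lambda>a. \<not> d dvd a) as) = card J)"

lemma elementary_divisorsD:
  assumes "elementary_divisors as A I J"
  shows "0 \<notin> set as"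
    and "\<forall>i\<in>I. \<forall>j\<in>J. e dvd A i j \<Longrightarrow> \<forall>a\<in>set as. e dvd a"
    and "k \<le> length as \<Longrightarrow> dvd_minors e k A I J \<longleftrightarrow> e dvd prod_list (take k as)"
    and "k > length as \<Longrightarrow> dvd_minors 0 k A I J"
    and "vs.dim (res_sol d A I J) + length (filter (\<lambda>a. \<not> d dvd a) as) = card J"
  using assms unfolding elementary_divisors_def by simp_all

text \<open>Elimination with a pivot that divides all entries, which exists because divisibility is total.\<close>

theorem elementary_divisors_exist:
  fixes A :: "nat \<Rightarrow> nat \<Rightarrow> 'r"
  assumes "finite I" "finite J"
  shows "\<exists>as. elementary_divisors as A I J"
  using assms
proof (induction "card I" arbitrary: I J A rule: less_induct)
  case less
  note fin = less.prems
  show ?case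
  proof (cases "\<forall>i\<in>I. \<forall>j\<in>J. A i j = 0")
    case True
    have "dvd_minors 0 k A I J" if "k > 0" for k
      unfolding dvd_minors_def
    proof (intro allI impI)
      fix f g assume "f ` {..<k} \<subseteq> I" "g ` {..<k} \<subseteq> J"
      then have "fminor A k f g = 0" using True that
        by (intro fminor_zero_row[of 0]) (auto simp: image_subset_iff)
      then show "0 dvd fminor A k f g" by simp
    qed
    moreover have "res_sol d A I J = coord_space J" for d
      using True by (intro res_sol_all) auto
    moreover have "dvd_minors e 0 A I J \<longleftrightarrow> e dvd 1" for e
      by (simp add: dvd_minors_def)
    ultimately have "elementary_divisors [] A I J"
      using dim_coord_space[OF fin(2)] by (simp add: elementary_divisors_def)
    then show ?thesis ..
  next
    case False
    define S where "S = (\<lambda>(i, j). A i j) ` (I \<times> J)"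
    have "finite S" "S \<noteq> {}" using fin False by (auto simp: S_def)
    from exists_least_divisor[OF this] obtain i0 j0
      where i0: "i0 \<in> I" and j0: "j0 \<in> J" and piv: "\<And>i j. i \<in> I \<Longrightarrow> j \<in> J \<Longrightarrow> A i0 j0 dvd A i j"
      unfolding S_def by fastforce
    let ?a = "A i0 j0" and ?I = "I - {i0}" and ?J = "J - {j0}"
    have a0: "?a \<noteq> 0" using False piv by force
    have "\<exists>c. A i j0 = c * ?a" if "i \<in> I" for i
      using piv[OF that j0] by (metis dvdE mult.commute)
    then obtain c where c: "\<And>i. i \<in> I \<Longrightarrow> A i j0 = c i * ?a" by metis
    have "\<exists>c. A i0 j = ?a * c" if "j \<in> J" for j
      using piv[OF i0 that] by (meson dvdE)
    then obtain c' where c': "\<And>j. j \<in> J \<Longrightarrow> A i0 j = ?a * c' j" by metis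
    define A' where "A' = (\<lambda>i j. A i j - c i * A i0 j)"
    have "card ?I < card I" using i0 fin by (meson card_Diff1_less)
    have "finite ?I" "finite ?J" using fin by auto
    from less.hyps[OF \<open>card ?I < card I\<close> this, of A'] obtain as
      where as: "elementary_divisors as A' ?I ?J" ..
    note as0 = elementary_divisorsD(1)[OF as] and as1 = elementary_divisorsD(2)[OF as]
      and as2 = elementary_divisorsD(3)[OF as] and as3 = elementary_divisorsD(4)[OF as]
      and as4 = elementary_divisorsD(5)[OF as]
    have pivot: "dvd_minors e (Suc k) A I J \<longleftrightarrow>
      (\<forall>f g. f ` {..<k} \<subseteq> ?I \<longrightarrow> g ` {..<k} \<subseteq> ?J \<longrightarrow> e dvd ?a * fminor A' k f g)" for e k
      unfolding A'_def using i0 j0 piv c by (rule dvd_minors_pivot)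
    have all_dvd: "\<forall>i\<in>?I. \<forall>j\<in>?J. e dvd A' i j" if "\<forall>i\<in>I. \<forall>j\<in>J. e dvd A i j" for e
      using that i0 by (auto simp: A'_def)
    have "elementary_divisors (?a # as) A I J" unfolding elementary_divisors_def
    proof (intro conjI allI impI)
      show "0 \<notin> set (?a # as)" using a0 as0 by auto
    next
      fix e assume e: "\<forall>i\<in>I. \<forall>j\<in>J. e dvd A i j"
      then show "\<forall>a\<in>set (?a # as). e dvd a" using as1[OF all_dvd[OF e]] i0 j0 by auto
    next
      fix k e assume k: "k \<le> length (?a # as)"
      show "dvd_minors e k A I J \<longleftrightarrow> e dvd prod_list (take k (?a # as))"
      proof (cases k)
        case 0
        then show ?thesis by (simp add: dvd_minors_def)
      next
        case (Suc k')
        show ?thesis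
        proof (cases "e dvd ?a")
          case True
          then show ?thesis unfolding Suc pivot by auto
        next
          case False
          then obtain e' where e': "e = ?a * e'" using dvd_total[of e ?a] by (auto simp: dvd_def)
          have "dvd_minors e k A I J \<longleftrightarrow> dvd_minors e' k' A' ?I ?J"
            unfolding Suc pivot unfolding e' dvd_minors_def using a0 by (simp add: mult.assoc)
          also have "\<dots> \<longleftrightarrow> e' dvd prod_list (take k' as)" using k Suc by (intro as2) auto
          also have "\<dots> \<longleftrightarrow> e dvd prod_list (take k (?a # as))" unfolding Suc e' using a0 by simp
          finally show ?thesis .
        qed
      qed
    next
      fix k assume k: "k > length (?a # as)"
      then obtain k' where k': "k = Suc k'" "k' > length as" by (cases k) auto
      show "dvd_minors 0 k A I J"
        unfolding k' pivot using as3[OF k'(2)] by (auto simp: dvd_minors_def)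
    next
      fix d
      show "vs.dim (res_sol d A I J) + length (filter (\<lambda>a. \<not> d dvd a) (?a # as)) = card J"
      proof (cases "d dvd ?a")
        case True
        then have d: "\<forall>i\<in>I. \<forall>j\<in>J. d dvd A i j" using piv by (meson dvd_trans)
        then have "filter (\<lambda>a. \<not> d dvd a) as = []" using as1[OF all_dvd[OF d]] by auto
        moreover have "res_sol d A I J = coord_space J" using d by (intro res_sol_all) auto
        ultimately show ?thesis using True dim_coord_space[OF fin(2)] by simp
      next
        case False
        have "vs.dim (res_sol d A I J) = vs.dim (res_sol d A' ?I ?J)"
          unfolding A'_def using fin(2) i0 j0 c c' False by (rule dim_res_sol_pivot)
        then show ?thesis using as4[of d] False card.remove[OF fin(2) j0] by simp
      qed
    qed
    then show ?thesis ..
  qed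
qed

text \<open>Solutions \<open>x\<close> with \<open>v x = 0\<close> solve both systems. Of the values \<open>v x\<close> and \<open>v y\<close> at two solutions
of the first system one is a multiple of the other, so some \<open>y - q x\<close> or \<open>x - q y\<close> is
a common solution. Hence the reduced solutions of the first system lie in the span of the
reduced common solutions and one further vector.\<close>

lemma dim_res_sol_rank_one:
  fixes A :: "nat \<Rightarrow> nat \<Rightarrow> 'r"
  assumes fin: "finite J" and A': "\<And>i j. i \<in> I \<Longrightarrow> j \<in> J \<Longrightarrow> A' i j = A i j + u i * v j"
  shows "vs.dim (res_sol d A I J) \<le> Suc (vs.dim (res_sol d A' I J))"
proof -
  define vdot where "vdot x = (\<Sum>j\<in>J. v j * x j)" for x :: "nat \<Rightarrow> 'r"
  define M0 where "M0 = {x \<in> sol d A I J. vdot x = 0}"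
  define S0 where "S0 = (\<lambda>x j. \<pi> (x j)) ` M0"
  have sub: "S0 \<subseteq> res_sol d A' I J"
  proof -
    have "x \<in> sol d A' I J" if x: "x \<in> M0" for x
    proof -
      have "(\<Sum>j\<in>J. A' i j * x j) = (\<Sum>j\<in>J. A i j * x j) + u i * vdot x" if "i \<in> I" for i
        unfolding vdot_def sum_distrib_left sum.distrib[symmetric] using A'[OF that]
        by (intro sum.cong) (auto simp: algebra_simps)
      then show ?thesis using x by (auto simp: M0_def sol_def)
    qed
    then show ?thesis by (auto simp: S0_def res_sol_def)
  qed
  have diff: "(\<lambda>j. \<pi> (y j) - \<pi> q * \<pi> (x j)) \<in> S0"
    if xy: "x \<in> sol d A I J" "y \<in> sol d A I J" and q: "vdot y = vdot x * q" for x y q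
  proof -
    define z where "z j = y j + (- q) * x j" for j
    have sum_z: "(\<Sum>j\<in>J. h j * z j) = (\<Sum>j\<in>J. h j * y j) - q * (\<Sum>j\<in>J. h j * x j)" for h
      unfolding z_def sum_distrib_left sum_subtractf[symmetric]
      by (intro sum.cong) (auto simp: algebra_simps)
    have "vdot z = 0" using q sum_z[of v] by (simp add: vdot_def mult.commute)
    moreover have "d dvd (\<Sum>j\<in>J. A i j * z j)" if "i \<in> I" for i
      unfolding sum_z using xy that by (auto simp: sol_def intro!: dvd_diff)
    moreover have "z \<in> coord_space J" using xy by (simp add: sol_def coord_space_def z_def)
    ultimately have "z \<in> M0" by (simp add: M0_def sol_def)
    then have "(\<lambda>j. \<pi> (z j)) \<in> S0" by (auto simp: S0_def)
    then show ?thesis unfolding z_def res_add res_mult res_minus by simp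
  qed
  have "\<exists>w. res_sol d A I J \<subseteq> vs.span (insert w S0)"
  proof (cases "res_sol d A I J \<subseteq> vs.span S0")
    case True
    then show ?thesis using vs.span_mono[of S0 "insert 0 S0"] by blast
  next
    case False
    then obtain x where x: "x \<in> sol d A I J" and xn: "(\<lambda>j. \<pi> (x j)) \<notin> vs.span S0"
      by (auto simp: res_sol_def)
    let ?x = "\<lambda>j. \<pi> (x j)"
    have "(\<lambda>j. \<pi> (y j)) \<in> vs.span (insert ?x S0)" if y: "y \<in> sol d A I J" for y
    proof -
      let ?y = "\<lambda>j. \<pi> (y j)"
      consider "vdot x dvd vdot y" | "vdot y dvd vdot x" using dvd_total by blast
      then show ?thesis
      proof cases
        case 1
        then obtain q where "vdot y = vdot x * q" by (auto simp: dvd_def)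
        from diff[OF x y this] have "?y - fscale (\<pi> q) ?x \<in> vs.span S0"
          by (intro vs.span_base) (simp add: fun_diff_def fscale_def)
        then show ?thesis unfolding vs.span_breakdown_eq by blast
      next
        case 2
        then obtain q where "vdot x = vdot y * q" by (auto simp: dvd_def)
        from diff[OF y x this] have "?x - fscale (\<pi> q) ?y \<in> vs.span S0"
          by (intro vs.span_base) (simp add: fun_diff_def fscale_def)
        then have "?x \<in> vs.span (insert ?y S0)" unfolding vs.span_breakdown_eq by blast
        then show ?thesis using xn by (rule vs.in_span_insert)
      qed
    qed
    then show ?thesis by (auto simp: res_sol_def)
  qed
  then obtain w where w: "res_sol d A I J \<subseteq> vs.span (insert w S0)" ..
  have S0: "S0 \<subseteq> coord_space J" using sub res_sol_coord by blast
  have "vs.dim (res_sol d A I J) \<le> Suc (vs.dim S0)" by (rule fdim_le_Suc[OF fin S0 w])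
  also have "vs.dim S0 \<le> vs.dim (res_sol d A' I J)"
    using sub vs.span_superset by (intro fdim_mono[OF fin res_sol_coord]) blast
  finally show ?thesis by simp
qed

end

section \<open>Minors of matrices\<close>

lemma fminor_permute_rows:
  assumes p: "p permutes {0..<k}"
  shows "fminor A k (f \<circ> p) g = signof p * fminor A k f g"
proof -
  let ?M = "mat k k (\<lambda>(i, j). A (f i) (g j))"
  have "mat k k (\<lambda>(i, j). A ((f \<circ> p) i) (g j)) = mat k k (\<lambda>(i, j). ?M $$ (p i, j))"
    using permutes_in_image[OF p] by (intro cong_mat) (auto simp: less_Suc_eq)
  then show ?thesis unfolding fminor_def by (simp add: det_permute_rows[OF _ p])
qed

text \<open>The permutation sends \<open>i\<close> to the position of \<open>f i\<close> in the increasing enumeration of the selected rows.\<close>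

lemma fminor_sort_rows:
  assumes "inj_on f {..<k}"
  shows "\<exists>s. fminor A k f g = s * fminor A k (pick (f ` {..<k})) g"
proof -
  let ?I = "f ` {..<k}"
  define p where "p i = (if i < k then card {a \<in> ?I. a < f i} else i)" for i
  have pick_p: "pick ?I (p i) = f i" if "i < k" for i
    using that by (simp add: p_def pick_card_in_set)
  have card: "card ?I = k" using assms by (simp add: card_image)
  have "p i < k" if "i < k" for i
  proof -
    have "{a \<in> ?I. a < f i} \<subset> ?I" using that by blast
    then have "card {a \<in> ?I. a < f i} < card ?I" by (intro psubset_card_mono) auto
    then show ?thesis using that card by (simp add: p_def)
  qed
  moreover have "inj_on p {0..<k}"
  proof (rule inj_onI)
    fix i j assume "i \<in> {0..<k}" "j \<in> {0..<k}" "p i = p j"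
    then have "f i = f j" using pick_p[of i] pick_p[of j] by simp
    with assms \<open>i \<in> {0..<k}\<close> \<open>j \<in> {0..<k}\<close> show "i = j" by (simp add: inj_on_def)
  qed
  ultimately have p: "p permutes {0..<k}"
    by (intro inj_imp_permutes) (auto simp: p_def)
  have "fminor A k f g = fminor A k (pick ?I \<circ> p) g"
    by (intro fminor_cong) (simp add: pick_p)
  then show ?thesis using fminor_permute_rows[OF p] by metis
qed

lemma fminor_sort:
  assumes "inj_on f {..<k}" "inj_on g {..<k}"
  shows "\<exists>s. fminor A k f g = s * fminor A k (pick (f ` {..<k})) (pick (g ` {..<k}))"
proof -
  let ?f = "pick (f ` {..<k})" and ?g = "pick (g ` {..<k})"
  obtain s where s: "fminor A k f g = s * fminor A k ?f g"
    using fminor_sort_rows[OF assms(1)] by blast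
  obtain t where "fminor (\<lambda>i j. A j i) k g ?f = t * fminor (\<lambda>i j. A j i) k ?g ?f"
    using fminor_sort_rows[OF assms(2)] by blast
  then have "fminor A k ?f g = t * fminor A k ?f ?g"
    using fminor_transpose[of A k] by simp
  with s show ?thesis by (metis mult.assoc)
qed

lemma det_submatrix_eq_fminor:
  assumes "A \<in> carrier_mat m n" "I \<subseteq> {..<m}" "J \<subseteq> {..<n}" "card I = k" "card J = k"
  shows "det (submatrix A I J) = fminor (\<lambda>i j. A $$ (i, j)) k (pick I) (pick J)"
proof -
  have "{i. i < dim_row A \<and> i \<in> I} = I" "{j. j < dim_col A \<and> j \<in> J} = J" using assms by auto
  then show ?thesis using assms by (simp add: submatrix_def fminor_def)
qed

lemma dvd_minors_iff_minors:
  assumes A: "A \<in> carrier_mat m n"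
  shows "dvd_minors d k (\<lambda>i j. A $$ (i, j)) {..<m} {..<n} \<longleftrightarrow> (\<forall>x\<in>minors k A. d dvd x)"
proof
  assume L: "dvd_minors d k (\<lambda>i j. A $$ (i, j)) {..<m} {..<n}"
  show "\<forall>x\<in>minors k A. d dvd x"
  proof
    fix x assume "x \<in> minors k A"
    then obtain I J where IJ: "I \<subseteq> {..<m}" "J \<subseteq> {..<n}" "card I = k" "card J = k"
      and x: "x = det (submatrix A I J)" using A by (auto simp: minors_def)
    have "pick I ` {..<k} \<subseteq> I" "pick J ` {..<k} \<subseteq> J" using IJ by (auto simp: image_subset_iff pick_in_set_le)
    then have "pick I ` {..<k} \<subseteq> {..<m}" "pick J ` {..<k} \<subseteq> {..<n}" using IJ by blast+
    then show "d dvd x"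
      using L unfolding x det_submatrix_eq_fminor[OF A IJ] dvd_minors_def by blast
  qed
next
  assume R: "\<forall>x\<in>minors k A. d dvd x"
  show "dvd_minors d k (\<lambda>i j. A $$ (i, j)) {..<m} {..<n}" unfolding dvd_minors_def
  proof (intro allI impI)
    fix f g assume f: "f ` {..<k} \<subseteq> {..<m}" and g: "g ` {..<k} \<subseteq> {..<n}"
    show "d dvd fminor (\<lambda>i j. A $$ (i, j)) k f g"
    proof (cases "inj_on f {..<k} \<and> inj_on g {..<k}")
      case False
      then show ?thesis using fminor_not_inj_rows fminor_not_inj_cols by (metis dvd_0_right)
    next
      case True
      then have card: "card (f ` {..<k}) = k" "card (g ` {..<k}) = k" by (auto simp: card_image)
      have "det (submatrix A (f ` {..<k}) (g ` {..<k})) \<in> minors k A"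
        using A f g card unfolding minors_def by blast
      then have "d dvd fminor (\<lambda>i j. A $$ (i, j)) k (pick (f ` {..<k})) (pick (g ` {..<k}))"
        using R det_submatrix_eq_fminor[OF A f g card] by metis
      then show ?thesis using fminor_sort[of f k g] True by (metis dvd_mult)
    qed
  qed
qed

lemma dvd_minors_Suc:
  assumes "dvd_minors d k A I J"
  shows "dvd_minors d (Suc k) A I J"
  unfolding dvd_minors_def
proof (intro allI impI)
  fix f g assume f: "f ` {..<Suc k} \<subseteq> I" and g: "g ` {..<Suc k} \<subseteq> J"
  have "d dvd fminor A k (f \<circ> insert_index 0) (g \<circ> insert_index j)" for j
  proof -
    have "(f \<circ> insert_index 0) ` {..<k} \<subseteq> I" "(g \<circ> insert_index j) ` {..<k} \<subseteq> J"
      using f g insert_index_less[of _ k] by (auto simp: image_subset_iff)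
    then show ?thesis using assms unfolding dvd_minors_def by blast
  qed
  then show "d dvd fminor A (Suc k) f g"
    unfolding fminor_expand_row[of 0 k A f g, OF zero_less_Suc] by (intro dvd_sum dvd_mult) 
qed

lemma fminor_hom:
  assumes "comm_ring_hom h"
  shows "fminor (\<lambda>i j. h (A i j)) k f g = h (fminor A k f g)"
proof -
  interpret comm_ring_hom h by fact
  have "mat k k (\<lambda>(i, j). h (A (f i) (g j))) = map_mat h (mat k k (\<lambda>(i, j). A (f i) (g j)))"
    by (intro eq_matI) auto
  then show ?thesis unfolding fminor_def by simp
qed

lemma minors_transpose: "minors k (transpose_mat A) = minors k A"
proof -
  have *: "minors k (transpose_mat A) \<subseteq> minors k A" for A :: "'a::comm_ring_1 mat"
  proof
    fix x assume "x \<in> minors k (transpose_mat A)"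
    then obtain I J where IJ: "I \<subseteq> {..<dim_col A}" "J \<subseteq> {..<dim_row A}" "card I = k" "card J = k"
      and x: "x = det (submatrix (transpose_mat A) I J)" by (auto simp: minors_def)
    have in_range: "pick I i < dim_col A" "pick J i < dim_row A" if "i < k" for i
      using IJ pick_in_set_le[of i I] pick_in_set_le[of i J] that by auto
    have "x = fminor (\<lambda>i j. transpose_mat A $$ (i, j)) k (pick I) (pick J)"
      unfolding x by (rule det_submatrix_eq_fminor[OF _ IJ]) simp
    also have "\<dots> = fminor (\<lambda>i j. A $$ (j, i)) k (pick I) (pick J)"
      using in_range by (intro fminor_cong) simp
    also have "\<dots> = fminor (\<lambda>i j. A $$ (i, j)) k (pick J) (pick I)" by (rule fminor_transpose)
    also have "\<dots> = det (submatrix A J I)"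
      by (rule det_submatrix_eq_fminor[symmetric]) (use IJ in auto)
    finally show "x \<in> minors k A" using IJ unfolding minors_def by blast
  qed
  from *[of A] *[of "transpose_mat A"] show ?thesis by simp
qed

lemma normal_rank_transpose: "normal_rank (transpose_mat H) = normal_rank H"
  by (simp add: normal_rank_def minors_transpose)

section \<open>Fields and power series as valuation rings\<close>

interpretation fld: valuation_residue "\<lambda>x :: 'a::field. x"
proof
  fix x y :: 'a
  show "x = 0 \<longleftrightarrow> \<not> x dvd 1" by (simp add: dvd_field_iff)
  show "x dvd y \<or> y dvd x" by (cases "x = 0") (simp_all add: dvd_field_iff)
qed simp_all

interpretation ps: valuation_residue "\<lambda>x :: 'a::field fps. fps_nth x 0"
proof
  fix x y :: "'a fps"
  show "fps_nth x 0 = 0 \<longleftrightarrow> \<not> x dvd 1" by (simp only: fps_is_unit_iff not_not)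
  show "x dvd y \<or> y dvd x"
  proof (cases "x = 0 \<or> y = 0")
    case True
    then show ?thesis by (elim disjE) simp_all
  next
    case False
    then have "x dvd y \<longleftrightarrow> subdegree x \<le> subdegree y" "y dvd x \<longleftrightarrow> subdegree y \<le> subdegree x"
      by (simp_all only: fps_dvd_iff de_Morgan_disj not_False_eq_True)
    then show ?thesis by linarith
  qed
  show "\<exists>x. fps_nth x 0 = c" for c :: 'a by (intro exI[of _ "fps_const c"]) simp
qed auto

lemma (in valuation_residue) normal_rank_eq_length:
  assumes as: "elementary_divisors as B I J"
    and iff: "\<And>k. (\<exists>x\<in>minors k A. x \<noteq> 0) \<longleftrightarrow> \<not> dvd_minors 0 k B I J"
  shows "normal_rank A = length as"
proof -
  have "(\<exists>x\<in>minors k A. x \<noteq> 0) \<longleftrightarrow> k \<le> length as" for k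
  proof (cases "k \<le> length as")
    case True
    have "0 \<notin> set (take k as)" using elementary_divisorsD(1)[OF as] by (meson in_set_takeD)
    then have "prod_list (take k as) \<noteq> 0" by (simp add: prod_list_zero_iff)
    then have "\<not> dvd_minors 0 k B I J"
      using elementary_divisorsD(3)[OF as True, of 0] by simp
    then show ?thesis using iff[of k] True by blast
  next
    case False
    then have "dvd_minors 0 k B I J"
      using elementary_divisorsD(4)[OF as, of k] by (simp only: not_le)
    then show ?thesis using iff[of k] False by blast
  qed
  then have "{k. \<exists>x\<in>minors k A. x \<noteq> 0} = {..length as}" by auto
  moreover have "Max {..length as} = length as" by (rule Max_eqI) auto
  ultimately show ?thesis unfolding normal_rank_def by simp
qed

lemma to_fract_hom: "comm_ring_hom (to_fract :: 'a::idom \<Rightarrow> 'a fract)"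
  by unfold_locales (simp_all only: to_fract_0 to_fract_1 to_fract_add to_fract_mult)

lemma ex_nonzero_minor_iff:
  assumes "A \<in> carrier_mat m n" "comm_ring_hom h" "\<And>x. h x = 0 \<longleftrightarrow> x = 0"
  shows "(\<exists>x\<in>minors k A. x \<noteq> 0) \<longleftrightarrow> \<not> dvd_minors 0 k (\<lambda>i j. h (A $$ (i, j))) {..<m} {..<n}"
proof -
  have "dvd_minors 0 k (\<lambda>i j. h (A $$ (i, j))) {..<m} {..<n}
    \<longleftrightarrow> dvd_minors 0 k (\<lambda>i j. A $$ (i, j)) {..<m} {..<n}"
    unfolding dvd_minors_def by (simp add: fminor_hom[OF assms(2)] assms(3))
  then show ?thesis using dvd_minors_iff_minors[OF assms(1), of 0 k] by auto
qed

lemma subspace_field_sol: "vs.subspace (fld.res_sol 0 A I J)"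
proof -
  have "fld.res_sol 0 A I J = {x \<in> coord_space J. \<forall>i\<in>I. (\<Sum>j\<in>J. A i j * x j) = 0}"
    by (auto simp: fld.res_sol_def fld.sol_def)
  then show ?thesis
    unfolding vs.subspace_def
    by (auto simp: coord_space_def distrib_left sum.distrib mult.left_commute sum_distrib_left[symmetric])
qed

text \<open>As 0 divides only 0 and the reduction is the identity, this is the kernel of \<open>H\<close> over the field of
rational functions.\<close>

abbreviation null_space :: "'a::field poly mat \<Rightarrow> (nat \<Rightarrow> 'a poly fract) set" where
  "null_space H \<equiv> fld.res_sol 0 (\<lambda>i j. to_fract (H $$ (i, j))) {..<dim_row H} {..<dim_col H}"

text \<open>Rank and nullity are both read off from one list of elementary divisors over the field of rational
functions: there 0 divides only 0, so \<open>d = 0\<close> counts the whole list.\<close>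

lemma normal_rank_nullity:
  shows "vs.dim (null_space H) + normal_rank H = dim_col H"
proof -
  let ?B = "\<lambda>i j. to_fract (H $$ (i, j))"
  obtain as where as: "fld.elementary_divisors as ?B {..<dim_row H} {..<dim_col H}"
    using fld.elementary_divisors_exist[of "{..<dim_row H}" "{..<dim_col H}"] by auto
  have "normal_rank H = length as"
    by (rule fld.normal_rank_eq_length[OF as], rule ex_nonzero_minor_iff[OF _ to_fract_hom]) auto
  moreover have "filter (\<lambda>a. \<not> 0 dvd a) as = as"
    using fld.elementary_divisorsD(1)[OF as] by (auto simp: filter_id_conv)
  ultimately show ?thesis using fld.elementary_divisorsD(5)[OF as, of 0] by simp
qed

section \<open>Homogenization of minors\<close>

text \<open>This is \<open>t\<^sup>k f (s / t)\<close>, provided that the degree of \<open>f\<close> is at most \<open>k\<close>.\<close>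

definition hom_poly :: "nat \<Rightarrow> 'a::field poly \<Rightarrow> 'a poly poly" where
  "hom_poly k f = (\<Sum>j\<le>k. monom (monom (coeff f j) (k - j)) j)"

lemma coeff_hom_poly: "coeff (hom_poly k f) j = (if j \<le> k then monom (coeff f j) (k - j) else 0)"
proof -
  have "coeff (hom_poly k f) j = (\<Sum>i\<le>k. if i = j then monom (coeff f i) (k - i) else 0)"
    by (simp add: hom_poly_def coeff_sum)
  then show ?thesis by (simp add: sum.delta)
qed

lemma hom_poly_0 [simp]: "hom_poly k 0 = 0"
  by (intro poly_eqI) (simp add: coeff_hom_poly)

lemma hom_poly_add: "hom_poly k (f + g) = hom_poly k f + hom_poly k g"
  by (intro poly_eqI) (simp add: coeff_hom_poly add_monom)

lemma hom_poly_uminus: "hom_poly k (- f) = - hom_poly k f"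
  by (intro poly_eqI) (simp add: coeff_hom_poly minus_monom)

lemma hom_poly_sum: "hom_poly k (\<Sum>a\<in>A. f a) = (\<Sum>a\<in>A. hom_poly k (f a))"
  by (induction A rule: infinite_finite_induct) (simp_all add: hom_poly_add)

lemma hom_poly_sign: "hom_poly k ((-1) ^ j * f) = (-1) ^ j * hom_poly k f"
  by (induction j) (simp_all add: hom_poly_uminus)

lemma hom_poly_1_eq: "degree p \<le> 1 \<Longrightarrow> [:[:0, coeff p 0:], [:coeff p 1:]:] = hom_poly 1 p"
  by (intro poly_eqI)
    (auto simp: coeff_hom_poly coeff_pCons monom_0 monom_Suc split: nat.splits)

lemma hom_poly_mult:
  assumes p: "degree p \<le> 1" and f: "degree f \<le> k"
  shows "hom_poly (Suc k) (p * f) = hom_poly 1 p * hom_poly k f"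
proof -
  define a b where "a = coeff p 0" and "b = coeff p 1"
  have p_eq: "p = [:a, b:]"
    using p by (intro poly_eqI)
      (auto simp: a_def b_def coeff_pCons coeff_eq_0 split: nat.splits)
  have hp: "hom_poly 1 p = [:[:0, a:], [:b:]:]"
    using hom_poly_1_eq[OF p] by (simp add: a_def b_def)
  have m0: "[:0, a:] * monom c e = monom (a * c) (Suc e)" for c e
    by (simp add: monom_Suc Polynomial.smult_monom)
  have m1: "[:b:] * monom c e = monom (b * c) e" for c e
    by (simp add: Polynomial.smult_monom)
  have pf: "p * f = Polynomial.smult a f + pCons 0 (Polynomial.smult b f)" by (simp add: p_eq)
  show ?thesis
  proof (rule poly_eqI)
    fix j
    have R: "hom_poly 1 p * hom_poly k f
      = Polynomial.smult [:0, a:] (hom_poly k f) + pCons 0 (Polynomial.smult [:b:] (hom_poly k f))"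
      unfolding hp by simp
    show "coeff (hom_poly (Suc k) (p * f)) j = coeff (hom_poly 1 p * hom_poly k f) j"
    proof (cases j)
      case 0
      then show ?thesis
        unfolding R coeff_add coeff_smult coeff_pCons_0 coeff_hom_poly pf by (simp add: monom_Suc smult_monom)
    next
      case (Suc i)
      consider "i < k" | "i = k" | "i > k" by linarith
      then show ?thesis
      proof cases
        case 1
        then have "Suc (k - Suc i) = k - i" by simp
        with 1 show ?thesis
          unfolding R coeff_add coeff_smult coeff_hom_poly pf Suc coeff_pCons_Suc m0 m1
          by (simp add: m0 m1 add_monom del: mult_pCons_left)
      next
        case 2
        then show ?thesis using f
          unfolding R coeff_add coeff_smult coeff_hom_poly pf Suc coeff_pCons_Suc
          by (simp add: m0 m1 coeff_eq_0 del: mult_pCons_left)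
      next
        case 3
        then show ?thesis unfolding R coeff_add coeff_smult coeff_hom_poly pf Suc coeff_pCons_Suc by simp
      qed
    qed
  qed
qed

lemma degree_fminor_le:
  assumes "\<And>i j. i < k \<Longrightarrow> j < k \<Longrightarrow> degree (A (f i) (g j)) \<le> 1"
  shows "degree (fminor A k f g) \<le> k"
proof -
  have "degree (det (mat k k (\<lambda>(i, j). A (f i) (g j)))) \<le> 1 * k"
    using assms by (intro degree_det_le) auto
  then show ?thesis by (simp add: fminor_def)
qed

text \<open>Homogenization is additive in a fixed degree and multiplicative when the degrees are added, so it
commutes with Laplace expansion.\<close>

lemma fminor_hom_poly:
  assumes "\<And>i j. i < k \<Longrightarrow> j < k \<Longrightarrow> degree (A (f i) (g j)) \<le> 1"
  shows "fminor (\<lambda>i j. hom_poly 1 (A i j)) k f g = hom_poly k (fminor A k f g)"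
  using assms
proof (induction k arbitrary: f g)
  case 0
  then show ?case by (simp add: hom_poly_def)
next
  case (Suc k)
  let ?m = "\<lambda>j. fminor A k (f \<circ> insert_index 0) (g \<circ> insert_index j)"
  have deg: "degree (A ((f \<circ> insert_index 0) i) ((g \<circ> insert_index l) j)) \<le> 1"
    if "i < k" "j < k" for i j l
    using Suc.prems[of "insert_index 0 i" "insert_index l j"] that
    by (simp add: insert_index_less)
  have "hom_poly (Suc k) (fminor A (Suc k) f g)
    = (\<Sum>j<Suc k. hom_poly (Suc k) (A (f 0) (g j) * ((-1) ^ (0 + j) * ?m j)))"
    by (subst fminor_expand_row[of 0]) (simp_all only: hom_poly_sum zero_less_Suc)
  also have "\<dots> = (\<Sum>j<Suc k. hom_poly 1 (A (f 0) (g j)) * ((-1) ^ (0 + j) * hom_poly k (?m j)))"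
  proof (rule sum.cong)
    fix j assume "j \<in> {..<Suc k}"
    then have d: "degree (A (f 0) (g j)) \<le> 1" using Suc.prems by simp
    have "degree (?m j) \<le> k" using deg by (intro degree_fminor_le)
    moreover have "degree ((-1) ^ (0 + j) * ?m j) = degree (?m j)"
      by (cases "even j") simp_all
    ultimately show "hom_poly (Suc k) (A (f 0) (g j) * ((-1) ^ (0 + j) * ?m j))
      = hom_poly 1 (A (f 0) (g j)) * ((-1) ^ (0 + j) * hom_poly k (?m j))"
      using d by (simp only: hom_poly_mult hom_poly_sign)
  qed simp
  also have "\<dots> = (\<Sum>j<Suc k. hom_poly 1 (A (f 0) (g j)) * ((-1) ^ (0 + j) *
      fminor (\<lambda>i j. hom_poly 1 (A i j)) k (f \<circ> insert_index 0) (g \<circ> insert_index j)))"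
    using deg by (simp only: Suc.IH)
  also have "\<dots> = fminor (\<lambda>i j. hom_poly 1 (A i j)) (Suc k) f g"
    by (rule fminor_expand_row[symmetric]) simp
  finally show ?case ..
qed

lemma linear_form_eq_hom_poly:
  "linear_form Infty = hom_poly 1 1" "linear_form (Fin l) = hom_poly 1 [:- l, 1:]"
  using hom_poly_1_eq[of "1 :: 'a::field poly"] hom_poly_1_eq[of "[:- l, 1:]"]
  by (auto simp: pCons_one)

text \<open>If the degree of \<open>f\<close> is less than \<open>k\<close>, the homogenization is divisible by \<open>t\<close>; otherwise a
root of \<open>f\<close> gives a linear factor.\<close>

lemma hom_poly_splits:
  fixes f :: "'a::alg_closed_field poly"
  assumes "degree f \<le> k" "f \<noteq> 0"
  shows "\<exists>c ps. c \<noteq> 0 \<and> hom_poly k f = [:[:c:]:] * prod_list (map linear_form ps)"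
  using assms
proof (induction k arbitrary: f)
  case 0
  then obtain c where c: "f = [:c:]" "c \<noteq> 0" by (metis degree_eq_zeroE le_zero_eq pCons_0_0)
  then have "hom_poly 0 f = [:[:c:]:] * prod_list (map linear_form [])"
    by (simp add: hom_poly_def monom_0)
  then show ?case using c(2) by blast
next
  case (Suc k)
  have "\<exists>\<mu> g. degree g \<le> k \<and> g \<noteq> 0 \<and> hom_poly (Suc k) f = linear_form \<mu> * hom_poly k g"
  proof (cases "degree f \<le> k")
    case True
    then have "hom_poly (Suc k) (1 * f) = hom_poly 1 1 * hom_poly k f"
      by (intro hom_poly_mult) simp_all
    then show ?thesis using True Suc.prems(2) unfolding linear_form_eq_hom_poly(1)[symmetric]
      by (intro exI[of _ Infty] exI[of _ f]) (simp only: mult_1 conj_absorb simp_thms)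
  next
    case False
    then have "degree f > 0" by simp
    then obtain l where "poly f l = 0" using alg_closed_imp_poly_has_root by blast
    then obtain g where g: "f = [:- l, 1:] * g" by (auto simp: poly_eq_0_iff_dvd dvd_def)
    with Suc.prems have "g \<noteq> 0" by auto
    have "degree f = degree [:- l, 1:] + degree g"
      unfolding g by (rule degree_mult_eq) (use \<open>g \<noteq> 0\<close> in auto)
    then have "degree g \<le> k" using Suc.prems by simp
    then have "hom_poly (Suc k) f = hom_poly 1 [:- l, 1:] * hom_poly k g"
      unfolding g by (intro hom_poly_mult) simp_all
    then show ?thesis using \<open>g \<noteq> 0\<close> \<open>degree g \<le> k\<close> unfolding linear_form_eq_hom_poly(2)[symmetric]
      by blast
  qed
  then obtain \<mu> g where g: "degree g \<le> k" "g \<noteq> 0" "hom_poly (Suc k) f = linear_form \<mu> * hom_poly k g"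
    by blast
  from Suc.IH[OF g(1,2)] obtain c ps where c: "c \<noteq> 0"
    and ps: "hom_poly k g = [:[:c:]:] * prod_list (map linear_form ps)" by blast
  have "hom_poly (Suc k) f = [:[:c:]:] * prod_list (map linear_form (\<mu> # ps))"
    unfolding g(3) ps list.map prod_list.Cons by (rule mult.left_commute)
  then show ?case using c by blast
qed

section \<open>Localization at a point of the projective line\<close>

lemma eval_map_poly_hom:
  fixes h :: "'a::comm_ring_1 \<Rightarrow> 'b::comm_ring_1"
  assumes "comm_ring_hom h"
  shows "comm_ring_hom (\<lambda>p. poly (map_poly h p) c)"
proof -
  interpret h: comm_ring_hom h by fact
  have mult: "map_poly h (p * q) = map_poly h p * map_poly h q" for p q
    by (intro poly_eqI) (simp add: coeff_map_poly coeff_mult h.hom_sum h.hom_mult)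
  have add: "map_poly h (p + q) = map_poly h p + map_poly h q" for p q
    by (intro poly_eqI) (simp add: coeff_map_poly h.hom_add)
  have one: "map_poly h 1 = 1"
    by (intro poly_eqI) (simp add: coeff_map_poly coeff_1)
  show ?thesis by unfold_locales (simp_all add: mult add one)
qed

text \<open>The functions \<open>s\<close> and \<open>t\<close> in a local parameter at the point: \<open>s = l + x\<close>, \<open>t = 1\<close> at a finite
point \<open>l\<close> and \<open>s = 1\<close>, \<open>t = x\<close> at infinity.\<close>

fun point_s :: "'a::field closure_pt \<Rightarrow> 'a fps" where
  "point_s (Fin l) = fps_const l + fps_X"
| "point_s Infty = 1"

fun point_t :: "'a::field closure_pt \<Rightarrow> 'a fps" where
  "point_t (Fin l) = 1"
| "point_t Infty = fps_X"

definition localize :: "'a::field closure_pt \<Rightarrow> 'a poly poly \<Rightarrow> 'a fps" where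
  "localize \<mu> g = poly (map_poly (\<lambda>q. poly (map_poly fps_const q) (point_t \<mu>)) g) (point_s \<mu>)"

lemma localize_hom: "comm_ring_hom (localize \<mu>)"
proof -
  have "comm_ring_hom (fps_const :: 'a \<Rightarrow> 'a fps)" by unfold_locales simp_all
  from eval_map_poly_hom[OF eval_map_poly_hom[OF this]] show ?thesis
    unfolding localize_def[abs_def] .
qed

text \<open>The form vanishing at \<open>\<mu>\<close> becomes the local parameter, and every other linear form becomes a unit.\<close>

lemma localize_linear_form:
  "localize \<mu> (linear_form \<nu>) \<noteq> 0"
  "subdegree (localize \<mu> (linear_form \<nu>)) = (if \<nu> = \<mu> then 1 else 0)"
proof -
  have pt: "map_poly (\<lambda>q. poly (map_poly fps_const q) (point_t \<mu>)) [:a, b:]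
    = [:poly (map_poly fps_const a) (point_t \<mu>), poly (map_poly fps_const b) (point_t \<mu>):]" for a b
    by (intro poly_eqI) (auto simp: coeff_map_poly coeff_pCons split: nat.splits)
  have lin: "map_poly fps_const [:a, b:] = [:fps_const a, fps_const b:]" for a b :: 'a
    by (intro poly_eqI) (auto simp: coeff_map_poly coeff_pCons split: nat.splits)
  have const: "map_poly fps_const [:a:] = [:fps_const a:]" for a :: 'a
    by (intro poly_eqI) (auto simp: coeff_map_poly coeff_pCons split: nat.splits)
  have one: "map_poly fps_const (1 :: 'a poly) = 1"
    by (intro poly_eqI) (auto simp: coeff_map_poly coeff_pCons split: nat.splits)
  have loc: "localize \<mu> [:a, b:] = poly (map_poly fps_const a) (point_t \<mu>)
      + point_s \<mu> * poly (map_poly fps_const b) (point_t \<mu>)" for a b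
    unfolding localize_def pt by simp
  have FF: "localize \<mu> (linear_form (Fin l')) = fps_const (- l') + (fps_const l + fps_X)"
    if "\<mu> = Fin l" for l l'
    using loc[of "[:0, - l':]" 1] unfolding that by (simp add: lin one)
  have FI: "localize \<mu> (linear_form Infty) = 1" if "\<mu> = Fin l" for l
    using loc[of "[:0, 1:]" 0] unfolding that by (simp add: lin)
  have IF: "localize \<mu> (linear_form (Fin l')) = fps_X * fps_const (- l') + 1" if "\<mu> = Infty" for l'
    using loc[of "[:0, - l':]" 1] unfolding that by (simp add: lin one)
  have II: "localize \<mu> (linear_form Infty) = (fps_X :: 'a fps)" if "\<mu> = Infty"
    using loc[of "[:0, 1:]" 0] unfolding that by (simp add: lin)
  have nz: "x \<noteq> 0 \<and> subdegree x = 0" if "fps_nth x 0 \<noteq> 0" for x :: "'a fps"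
    using that by (auto simp: subdegree_eq_0_iff)
  have "localize \<mu> (linear_form \<nu>) \<noteq> 0 \<and>
    subdegree (localize \<mu> (linear_form \<nu>)) = (if \<nu> = \<mu> then 1 else 0)"
  proof (cases \<mu>; cases \<nu>)
    fix l l' assume m: "\<mu> = Fin l" and n: "\<nu> = Fin l'"
    show ?thesis
    proof (cases "l = l'")
      case True
      then have "localize \<mu> (linear_form \<nu>) = fps_X" unfolding n FF[OF m] by (simp add: fps_eq_iff)
      then show ?thesis using m n True by simp
    next
      case False
      then have "fps_nth (localize \<mu> (linear_form \<nu>)) 0 \<noteq> 0" unfolding n FF[OF m] by simp
      from nz[OF this] show ?thesis using m n False by simp
    qed
  next
    fix l assume m: "\<mu> = Fin l" and n: "\<nu> = Infty"
    then show ?thesis using FI[OF m] by simp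
  next
    fix l' assume m: "\<mu> = Infty" and n: "\<nu> = Fin l'"
    have "fps_nth (localize \<mu> (linear_form \<nu>)) 0 \<noteq> 0" unfolding n IF[OF m] by simp
    from nz[OF this] show ?thesis using m n by simp
  next
    assume m: "\<mu> = Infty" and n: "\<nu> = Infty"
    then show ?thesis using II[OF m] by simp
  qed
  then show "localize \<mu> (linear_form \<nu>) \<noteq> 0"
    "subdegree (localize \<mu> (linear_form \<nu>)) = (if \<nu> = \<mu> then 1 else 0)" by auto
qed

lemma localize_const: "c \<noteq> 0 \<Longrightarrow> localize \<mu> [:[:c:]:] \<noteq> 0 \<and> subdegree (localize \<mu> [:[:c:]:]) = 0"
proof -
  assume c: "c \<noteq> 0"
  have "map_poly fps_const [:c:] = [:fps_const c:]"
    by (intro poly_eqI) (auto simp: coeff_map_poly coeff_pCons split: nat.splits)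
  moreover have "map_poly (\<lambda>q. poly (map_poly fps_const q) (point_t \<mu>)) [:[:c:]:]
     = [:poly (map_poly fps_const [:c:]) (point_t \<mu>):]"
    by (intro poly_eqI) (auto simp: coeff_map_poly coeff_pCons split: nat.splits)
  ultimately have "localize \<mu> [:[:c:]:] = fps_const c" by (simp add: localize_def)
  then show ?thesis using c by simp
qed

lemma localize_product:
  assumes c: "c \<noteq> 0" and g: "g = [:[:c:]:] * prod_list (map linear_form ps)"
  shows "localize \<mu> g \<noteq> 0" "subdegree (localize \<mu> g) = count_list ps \<mu>"
    "linear_form \<mu> ^ count_list ps \<mu> dvd g"
proof -
  interpret loc: comm_ring_hom "localize \<mu>" by (rule localize_hom)
  have *: "localize \<mu> (prod_list (map linear_form ps)) \<noteq> 0 \<and>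
    subdegree (localize \<mu> (prod_list (map linear_form ps))) = count_list ps \<mu>"
    by (induction ps) (auto simp: loc.hom_mult loc.hom_one localize_linear_form)
  show "localize \<mu> g \<noteq> 0" "subdegree (localize \<mu> g) = count_list ps \<mu>"
    using * localize_const[OF c, of \<mu>] unfolding g loc.hom_mult by auto
  have "linear_form \<mu> ^ count_list ps \<mu> dvd prod_list (map linear_form ps)"
    by (induction ps) (auto intro: mult_dvd_mono dvd_mult)
  then show "linear_form \<mu> ^ count_list ps \<mu> dvd g" unfolding g by (rule dvd_mult)
qed

text \<open>Being a product of linear forms, a nonzero homogeneous polynomial is divisible by exactly as high a power of
the form of \<open>\<mu>\<close> as its localization is by the local parameter.\<close>

lemma linear_form_power_dvd_iff:
  fixes f :: "'a::alg_closed_field poly"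
  assumes "degree f \<le> k"
  shows "linear_form \<mu> ^ e dvd hom_poly k f \<longleftrightarrow> fps_X ^ e dvd localize \<mu> (hom_poly k f)"
proof -
  interpret loc: comm_ring_hom "localize \<mu>" by (rule localize_hom)
  show ?thesis
  proof (cases "f = 0")
    case True
    then show ?thesis by (simp add: loc.hom_zero)
  next
    case False
    from hom_poly_splits[OF assms this] obtain c ps where
      c: "c \<noteq> 0" and g: "hom_poly k f = [:[:c:]:] * prod_list (map linear_form ps)" by blast
    note loc = localize_product[OF c g, of \<mu>]
    have R: "fps_X ^ e' dvd localize \<mu> (hom_poly k f) \<longleftrightarrow> e' \<le> count_list ps \<mu>" for e'
      using loc(1,2) by (simp add: fps_dvd_iff)
    have loc_lin: "fps_X dvd localize \<mu> (linear_form \<mu>)"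
      using localize_linear_form[of \<mu> \<mu>] by (simp add: fps_dvd_iff)
    show ?thesis
    proof
      assume "linear_form \<mu> ^ e dvd hom_poly k f"
      then obtain q where "hom_poly k f = linear_form \<mu> ^ e * q" by (auto simp: dvd_def)
      then have "localize \<mu> (hom_poly k f) = localize \<mu> (linear_form \<mu>) ^ e * localize \<mu> q"
        by (simp only: loc.hom_mult loc.hom_power)
      moreover have "fps_X ^ e dvd localize \<mu> (linear_form \<mu>) ^ e"
        using loc_lin by (rule dvd_power_same)
      ultimately show "fps_X ^ e dvd localize \<mu> (hom_poly k f)" by (simp only: dvd_mult2)
    next
      assume "fps_X ^ e dvd localize \<mu> (hom_poly k f)"
      then have "e \<le> count_list ps \<mu>" by (simp only: R)
      then show "linear_form \<mu> ^ e dvd hom_poly k f"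
        by (rule dvd_trans[OF le_imp_power_dvd loc(3)])
    qed
  qed
qed

lemma localize_hom_poly_eq_0_iff:
  fixes f :: "'a::alg_closed_field poly"
  assumes "degree f \<le> k"
  shows "localize \<mu> (hom_poly k f) = 0 \<longleftrightarrow> f = 0" "hom_poly k f = 0 \<longleftrightarrow> f = 0"
proof -
  interpret loc: comm_ring_hom "localize \<mu>" by (rule localize_hom)
  have "localize \<mu> (hom_poly k f) \<noteq> 0" if "f \<noteq> 0"
  proof -
    from hom_poly_splits[OF assms that] obtain c ps where
      "c \<noteq> 0" "hom_poly k f = [:[:c:]:] * prod_list (map linear_form ps)" by blast
    then show ?thesis by (rule localize_product(1))
  qed
  moreover have "localize \<mu> (hom_poly k f) = 0" if "hom_poly k f = 0" for f :: "'a poly"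
    unfolding that by (rule loc.hom_zero)
  ultimately show "localize \<mu> (hom_poly k f) = 0 \<longleftrightarrow> f = 0" "hom_poly k f = 0 \<longleftrightarrow> f = 0"
    using hom_poly_0[of k, where 'a = 'a] by blast+
qed

section \<open>Greatest common divisors of products of primes\<close>

text \<open>A prime that divides all of \<open>S\<close> is split off. If none of the primes in \<open>ps\<close> divides all of \<open>S\<close>, then a common
divisor, being a divisor of the product of the list and not divisible by any of its members, is a unit.\<close>

lemma gcd_of_prime_product_exists:
  fixes S :: "'b::idom set"
  assumes "u * prod_list ps \<in> S" "u dvd 1" "\<And>p. p \<in> set ps \<Longrightarrow> prime_elem p"
  shows "\<exists>d. is_gcd_of d S"
  using assms
proof (induction "length ps" arbitrary: S ps)
  case 0
  then have "is_gcd_of u S" unfolding is_gcd_of_def by (auto intro: dvd_trans)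
  then show ?case ..
next
  case (Suc n)
  show ?case
  proof (cases "\<exists>p\<in>set ps. \<forall>x\<in>S. p dvd x")
    case True
    then obtain p where p: "p \<in> set ps" "\<forall>x\<in>S. p dvd x" by blast
    have prime: "prime_elem p" using Suc.prems p by auto
    then have p0: "p \<noteq> 0" by (rule prime_elem_not_zeroI)
    define S' where "S' = {y. p * y \<in> S}"
    have "prod_list ps = p * prod_list (remove1 p ps)"
      using p(1) by (induction ps) (auto simp: mult.left_commute)
    then have "u * prod_list (remove1 p ps) \<in> S'"
      using Suc.prems(1) by (simp add: S'_def mult.left_commute)
    moreover have "n = length (remove1 p ps)" using Suc.hyps(2) p(1) by (simp add: length_remove1)
    ultimately obtain d' where d': "is_gcd_of d' S'"
      using Suc.hyps(1)[of "remove1 p ps" S'] Suc.prems(2,3) notin_set_remove1 by metis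
    have "is_gcd_of (p * d') S" unfolding is_gcd_of_def
    proof (intro conjI ballI allI impI)
      fix x assume "x \<in> S"
      then obtain y where y: "x = p * y" using p by (auto simp: dvd_def)
      with \<open>x \<in> S\<close> have "y \<in> S'" by (simp add: S'_def)
      then show "p * d' dvd x" using d' by (simp add: y is_gcd_of_def)
    next
      fix e assume e: "\<forall>x\<in>S. e dvd x"
      show "e dvd p * d'"
      proof (cases "p dvd e")
        case True
        then obtain e' where e': "e = p * e'" by (auto simp: dvd_def)
        have "\<forall>y\<in>S'. e' dvd y" using e p0 by (auto simp: S'_def e')
        then show ?thesis using d' by (simp add: e' is_gcd_of_def)
      next
        case False
        have "e dvd y" if y: "y \<in> S'" for y
        proof -
          have "e dvd p * y" using e y by (simp add: S'_def)
          then obtain f where f: "p * y = e * f" by (auto simp: dvd_def)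
          then have "p dvd e * f" by (metis dvd_triv_left)
          then have "p dvd f" using prime False prime_elem_dvd_multD by blast
          then obtain f' where "f = p * f'" by (auto simp: dvd_def)
          then have "p * y = p * (e * f')" using f by (simp add: mult.left_commute)
          then show "e dvd y" using p0 by simp
        qed
        then have "e dvd d'" using d' by (simp add: is_gcd_of_def)
        then show ?thesis by (rule dvd_mult)
      qed
    qed
    then show ?thesis ..
  next
    case False
    have unit: "e dvd 1" if "e dvd u * prod_list qs" "set qs \<subseteq> set ps" "\<forall>x\<in>S. e dvd x" for e qs
      using that(1,2)
    proof (induction qs)
      case Nil
      then show ?case using Suc.prems(2) by (auto intro: dvd_trans)
    next
      case (Cons q qs)
      have q: "q \<in> set ps" using Cons by simp
      then have "prime_elem q" using Suc.prems(3) by auto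
      then have "q \<noteq> 0" by (rule prime_elem_not_zeroI)
      from Cons.prems obtain f where f: "u * (q * prod_list qs) = e * f" by (auto simp: dvd_def)
      then have "q dvd e * f" by (metis dvd_mult dvd_triv_left)
      moreover have "\<not> q dvd e" using False q that(3) by (meson dvd_trans)
      ultimately have "q dvd f" using \<open>prime_elem q\<close> prime_elem_dvd_multD by blast
      then obtain f' where "f = q * f'" by (auto simp: dvd_def)
      then have "q * (u * prod_list qs) = q * (e * f')" using f by (simp add: mult.left_commute)
      then have "e dvd u * prod_list qs" using \<open>q \<noteq> 0\<close> by simp
      then show ?case using Cons by simp
    qed
    have "is_gcd_of 1 S" unfolding is_gcd_of_def using unit[of _ ps] Suc.prems(1) by simp
    then show ?thesis ..
  qed
qed

section \<open>The Weyr characteristic of the regular part\<close>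

lemma prime_power_dvd_mult_cancel:
  fixes p :: "'b::idom"
  assumes p: "prime_elem p" and y: "\<not> p dvd y" and dvd: "p ^ e dvd y * q"
  shows "p ^ e dvd q"
  using dvd
proof (induction e arbitrary: q)
  case (Suc e)
  have "p dvd p ^ Suc e" by simp
  then have "p dvd y * q" using Suc.prems by (rule dvd_trans)
  then obtain q' where q': "q = p * q'" using prime_elem_dvd_multD[OF p] y by (auto simp: dvd_def)
  have "p * p ^ e dvd p * (y * q')" using Suc.prems by (simp add: q' mult.left_commute)
  then have "p ^ e dvd y * q'" using prime_elem_not_zeroI[OF p] by simp
  then have "p ^ e dvd q'" by (rule Suc.IH)
  then show ?case by (simp add: q')
qed simp

lemma factor_exponent_div:
  fixes p :: "'b::idom_divide"
  assumes p: "prime_elem p" and dvd: "D dvd D'" and D0: "D \<noteq> 0"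
    and D: "\<And>e. p ^ e dvd D \<longleftrightarrow> e \<le> a" and D': "\<And>e. p ^ e dvd D' \<longleftrightarrow> e \<le> b"
  shows "factor_exponent p (D' div D) = b - a"
proof -
  obtain q where q: "D' = D * q" using dvd by (auto simp: dvd_def)
  then have quot: "D' div D = q" using D0 by simp
  obtain y where y: "D = p ^ a * y" using D[of a] by (auto simp: dvd_def)
  have p0: "p \<noteq> 0" using p by (rule prime_elem_not_zeroI)
  have "\<not> p dvd y"
  proof
    assume "p dvd y"
    then have "p ^ a * p dvd D" unfolding y by (intro mult_dvd_mono) simp_all
    then have "p ^ Suc a dvd D" by (simp add: mult.commute)
    then show False using D[of "Suc a"] by simp
  qed
  then have "p ^ e dvd q \<longleftrightarrow> p ^ e dvd y * q" for e
    using prime_power_dvd_mult_cancel[OF p, of y e q] dvd_mult[of "p ^ e" q y] by blast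
  also have "p ^ e dvd y * q \<longleftrightarrow> p ^ a * p ^ e dvd p ^ a * (y * q)" for e using p0 by simp
  also have "p ^ a * p ^ e dvd p ^ a * (y * q) \<longleftrightarrow> p ^ (a + e) dvd D'" for e
    unfolding q y by (simp only: power_add mult.assoc)
  finally have *: "p ^ e dvd q \<longleftrightarrow> a + e \<le> b" for e by (simp only: D')
  have "p ^ a dvd D'" using dvd_trans[OF _ dvd, of "p ^ a"] D[of a] by simp
  then have "a \<le> b" by (simp only: D')
  then show ?thesis unfolding quot factor_exponent_def * by (intro Greatest_equality) auto
qed

lemma is_gcd_of_dvd_iff: "is_gcd_of d S \<Longrightarrow> e dvd d \<longleftrightarrow> (\<forall>x\<in>S. e dvd x)"
  unfolding is_gcd_of_def by (meson dvd_trans)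

context
  fixes H :: "'a::alg_closed_field poly mat" and m n :: nat
  assumes H: "H \<in> pencil m n"
begin

lemma pencil_carrier: "H \<in> carrier_mat m n" "dim_row H = m" "dim_col H = n"
  using H by (auto simp: pencil_def)

lemma homogenize_carrier: "homogenize H \<in> carrier_mat m n"
  using pencil_carrier by (simp add: homogenize_def)

lemma homogenize_index: "i < m \<Longrightarrow> j < n \<Longrightarrow> homogenize H $$ (i, j) = hom_poly 1 (H $$ (i, j))"
  using H pencil_carrier hom_poly_1_eq[of "H $$ (i, j)"] by (simp add: homogenize_def pencil_def)

lemma fminor_homogenize:
  assumes f: "f ` {..<k} \<subseteq> {..<m}" and g: "g ` {..<k} \<subseteq> {..<n}"
  shows "degree (fminor (\<lambda>i j. H $$ (i, j)) k f g) \<le> k"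
    "fminor (\<lambda>i j. homogenize H $$ (i, j)) k f g = hom_poly k (fminor (\<lambda>i j. H $$ (i, j)) k f g)"
proof -
  have range: "f i < m" "g i < n" if "i < k" for i using f g that by auto
  then have deg: "degree (H $$ (f i, g j)) \<le> 1" if "i < k" "j < k" for i j
    using H that by (simp add: pencil_def)
  then show "degree (fminor (\<lambda>i j. H $$ (i, j)) k f g) \<le> k" by (rule degree_fminor_le)
  have "fminor (\<lambda>i j. homogenize H $$ (i, j)) k f g = fminor (\<lambda>i j. hom_poly 1 (H $$ (i, j))) k f g"
    by (intro fminor_cong homogenize_index range)
  also have "\<dots> = hom_poly k (fminor (\<lambda>i j. H $$ (i, j)) k f g)"
    using deg by (rule fminor_hom_poly)
  finally show "fminor (\<lambda>i j. homogenize H $$ (i, j)) k f g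
    = hom_poly k (fminor (\<lambda>i j. H $$ (i, j)) k f g)" .
qed

definition localization :: "'a closure_pt \<Rightarrow> nat \<Rightarrow> nat \<Rightarrow> 'a fps" where
  "localization \<mu> i j = localize \<mu> (homogenize H $$ (i, j))"

lemma dvd_minors_localization:
  "dvd_minors (fps_X ^ e) k (localization \<mu>) {..<m} {..<n}
    \<longleftrightarrow> (\<forall>x\<in>minors k (homogenize H). linear_form \<mu> ^ e dvd x)"
  unfolding dvd_minors_iff_minors[OF homogenize_carrier, symmetric]
  unfolding dvd_minors_def localization_def[abs_def] fminor_hom[OF localize_hom]
  using fminor_homogenize linear_form_power_dvd_iff[OF fminor_homogenize(1)] by simp

lemma ex_nonzero_minor_localization:
  "(\<exists>x\<in>minors k H. x \<noteq> 0) \<longleftrightarrow> \<not> dvd_minors 0 k (localization \<mu>) {..<m} {..<n}"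
proof -
  have "dvd_minors 0 k (localization \<mu>) {..<m} {..<n}
    \<longleftrightarrow> dvd_minors 0 k (\<lambda>i j. H $$ (i, j)) {..<m} {..<n}"
    unfolding dvd_minors_def localization_def[abs_def] fminor_hom[OF localize_hom]
    using fminor_homogenize localize_hom_poly_eq_0_iff(1)[OF fminor_homogenize(1)] by simp
  also have "\<dots> \<longleftrightarrow> (\<forall>x\<in>minors k H. 0 dvd x)"
    by (rule dvd_minors_iff_minors[OF pencil_carrier(1)])
  finally show ?thesis by auto
qed

lemma ex_nonzero_minor_homogenize:
  "(\<exists>x\<in>minors k H. x \<noteq> 0) \<Longrightarrow> \<exists>f. degree f \<le> k \<and> f \<noteq> 0 \<and> hom_poly k f \<in> minors k (homogenize H)"
proof -
  assume "\<exists>x\<in>minors k H. x \<noteq> 0"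
  then have "\<exists>f\<in>minors k H. f \<noteq> 0" .
  then obtain I J where IJ: "I \<subseteq> {..<m}" "J \<subseteq> {..<n}" "card I = k" "card J = k"
    and nz: "det (submatrix H I J) \<noteq> 0" using pencil_carrier by (auto simp: minors_def)
  have range: "pick I ` {..<k} \<subseteq> {..<m}" "pick J ` {..<k} \<subseteq> {..<n}"
    using IJ pick_in_set_le[of _ I] pick_in_set_le[of _ J] by (auto simp: image_subset_iff subset_iff)
  let ?f = "fminor (\<lambda>i j. H $$ (i, j)) k (pick I) (pick J)"
  have "?f \<noteq> 0" using nz by (simp add: det_submatrix_eq_fminor[OF pencil_carrier(1) IJ])
  moreover have "hom_poly k ?f = det (submatrix (homogenize H) I J)"
    unfolding det_submatrix_eq_fminor[OF homogenize_carrier IJ] fminor_homogenize[OF range] ..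
  then have "hom_poly k ?f \<in> minors k (homogenize H)"
    using IJ homogenize_carrier unfolding minors_def by auto
  ultimately show ?thesis using fminor_homogenize(1)[OF range] by blast
qed

text \<open>A nonzero minor of the homogenized pencil is a product of linear forms, which are prime; so the
greatest common divisor chosen in the definition exists.\<close>

lemma determinantal_divisor_is_gcd:
  assumes "\<exists>x\<in>minors k H. x \<noteq> 0"
  shows "is_gcd_of (determinantal_divisor H k) (minors k (homogenize H))"
    and "determinantal_divisor H k \<noteq> 0"
proof -
  from ex_nonzero_minor_homogenize[OF assms] obtain f where
    f: "degree f \<le> k" "f \<noteq> 0" "hom_poly k f \<in> minors k (homogenize H)" by blast
  from hom_poly_splits[OF f(1,2)] obtain c ps where
    c: "c \<noteq> 0" and split: "hom_poly k f = [:[:c:]:] * prod_list (map linear_form ps)" by blast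
  have "[:[:c:]:] dvd 1" using c by (simp add: is_unit_const_poly_iff dvd_field_iff)
  with f(3) have "\<exists>d. is_gcd_of d (minors k (homogenize H))" unfolding split
    by (rule gcd_of_prime_product_exists) (auto simp: prime_elem_linear_form)
  then show gcd: "is_gcd_of (determinantal_divisor H k) (minors k (homogenize H))"
    unfolding determinantal_divisor_def by (rule someI_ex)
  show "determinantal_divisor H k \<noteq> 0"
  proof
    assume "determinantal_divisor H k = 0"
    then have "hom_poly k f = 0" using gcd f(3) by (auto simp: is_gcd_of_def)
    then show False using f(2) localize_hom_poly_eq_0_iff(2)[OF f(1)] by blast
  qed
qed

text \<open>The exponent of the determinantal divisor of order \<open>k\<close> at \<open>\<mu>\<close> is the sum of the orders of the first
\<open>k\<close> elementary divisors of the localized pencil, so the partial multiplicities are these orders,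
listed backwards. Those of order at least \<open>j\<close> are counted by the Weyr characteristic, the others by the
codimension of the space of reduced solutions modulo \<open>x\<^sup>j\<close>.\<close>

lemma weyr_regular_eq:
  assumes j: "j \<ge> 1"
  shows "weyr_regular H \<mu> j + n
    = normal_rank H + vs.dim (ps.res_sol (fps_X ^ j) (localization \<mu>) {..<m} {..<n})"
proof -
  obtain as where as: "ps.elementary_divisors as (localization \<mu>) {..<m} {..<n}"
    using ps.elementary_divisors_exist[of "{..<m}" "{..<n}"] by auto
  define \<rho> where "\<rho> = length as"
  have rank: "normal_rank H = \<rho>"
    unfolding \<rho>_def by (rule ps.normal_rank_eq_length[OF as ex_nonzero_minor_localization])
  have nz: "as ! i \<noteq> 0" if "i < \<rho>" for i
    using ps.elementary_divisorsD(1)[OF as] that nth_mem[of i as] unfolding \<rho>_def by metis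
  define v where "v k = (\<Sum>i<k. subdegree (as ! i))" for k
  have prod: "prod_list (take k as) \<noteq> 0 \<and> subdegree (prod_list (take k as)) = v k" if "k \<le> \<rho>" for k
    using that
  proof (induction k)
    case (Suc k)
    then have "prod_list (take (Suc k) as) = prod_list (take k as) * as ! k"
      by (simp add: take_Suc_conv_app_nth \<rho>_def)
    with Suc nz[of k] show ?case by (simp add: v_def)
  qed (simp add: v_def)
  have ex: "\<exists>x\<in>minors k H. x \<noteq> 0" if "k \<le> \<rho>" for k
    using ex_nonzero_minor_localization[of k \<mu>] ps.elementary_divisorsD(3)[OF as, of k 0] prod[OF that] that
    by (simp add: \<rho>_def)
  have D: "linear_form \<mu> ^ e dvd determinantal_divisor H k \<longleftrightarrow> e \<le> v k" if k: "k \<le> \<rho>" for k e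
  proof -
    have "linear_form \<mu> ^ e dvd determinantal_divisor H k
      \<longleftrightarrow> dvd_minors (fps_X ^ e) k (localization \<mu>) {..<m} {..<n}"
      unfolding dvd_minors_localization
      by (rule is_gcd_of_dvd_iff[OF determinantal_divisor_is_gcd(1)[OF ex[OF k]]])
    also have "\<dots> \<longleftrightarrow> fps_X ^ e dvd prod_list (take k as)"
      using k unfolding \<rho>_def by (rule ps.elementary_divisorsD(3)[OF as])
    also have "\<dots> \<longleftrightarrow> e \<le> v k" using prod[OF k] by (simp add: fps_dvd_iff)
    finally show ?thesis .
  qed
  have chain: "determinantal_divisor H k dvd determinantal_divisor H (Suc k)" if k: "Suc k \<le> \<rho>" for k
  proof -
    have "is_gcd_of (determinantal_divisor H k) (minors k (homogenize H))"
      using k by (intro determinantal_divisor_is_gcd ex) simp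
    then have "dvd_minors (determinantal_divisor H k) k (\<lambda>i j. homogenize H $$ (i, j)) {..<m} {..<n}"
      unfolding dvd_minors_iff_minors[OF homogenize_carrier] is_gcd_of_def by blast
    from dvd_minors_Suc[OF this]
    have "\<forall>x\<in>minors (Suc k) (homogenize H). determinantal_divisor H k dvd x"
      unfolding dvd_minors_iff_minors[OF homogenize_carrier] .
    then show ?thesis using determinantal_divisor_is_gcd(1)[OF ex[OF k]] unfolding is_gcd_of_def by blast
  qed
  have mult: "partial_multiplicity H \<mu> (\<rho> - k) = subdegree (as ! k)" if k: "k < \<rho>" for k
  proof -
    have "partial_multiplicity H \<mu> (\<rho> - k) =
      factor_exponent (linear_form \<mu>) (determinantal_divisor H (Suc k) div determinantal_divisor H k)"
      using k by (simp add: partial_multiplicity_def rank hom_invariant_factor_def)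
    also have "\<dots> = v (Suc k) - v k"
      using k by (intro factor_exponent_div prime_elem_linear_form chain D
        determinantal_divisor_is_gcd(2) ex) simp_all
    finally show ?thesis by (simp add: v_def)
  qed
  have "{i. 1 \<le> i \<and> j \<le> partial_multiplicity H \<mu> i}
    = (\<lambda>k. \<rho> - k) ` {k. k < length as \<and> fps_X ^ j dvd as ! k}"
  proof (intro equalityI subsetI)
    fix i assume i: "i \<in> {i. 1 \<le> i \<and> j \<le> partial_multiplicity H \<mu> i}"
    then have i\<rho>: "i \<le> \<rho>" using j by (auto simp: partial_multiplicity_def rank split: if_splits)
    then have "j \<le> subdegree (as ! (\<rho> - i))" "\<rho> - i < \<rho>" using mult[of "\<rho> - i"] i by auto
    then have "fps_X ^ j dvd as ! (\<rho> - i)" using nz by (simp add: fps_dvd_iff)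
    then show "i \<in> (\<lambda>k. \<rho> - k) ` {k. k < length as \<and> fps_X ^ j dvd as ! k}"
      using i\<rho> \<open>\<rho> - i < \<rho>\<close> by (intro image_eqI[of _ _ "\<rho> - i"]) (auto simp: \<rho>_def)
  next
    fix i assume "i \<in> (\<lambda>k. \<rho> - k) ` {k. k < length as \<and> fps_X ^ j dvd as ! k}"
    then obtain k where k: "k < \<rho>" "fps_X ^ j dvd as ! k" "i = \<rho> - k" by (auto simp: \<rho>_def)
    then have "j \<le> subdegree (as ! k)" using nz by (simp add: fps_dvd_iff)
    then show "i \<in> {i. 1 \<le> i \<and> j \<le> partial_multiplicity H \<mu> i}" using mult[OF k(1)] k by auto
  qed
  then have "weyr_regular H \<mu> j = card ((\<lambda>k. \<rho> - k) ` {k. k < length as \<and> fps_X ^ j dvd as ! k})"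
    by (simp add: weyr_regular_def conjugate_def)
  also have "\<dots> = card {k. k < length as \<and> fps_X ^ j dvd as ! k}"
    by (intro card_image) (auto simp: inj_on_def \<rho>_def)
  also have "\<dots> = length (filter (\<lambda>a. fps_X ^ j dvd a) as)" by (simp add: length_filter_conv_card)
  finally have "weyr_regular H \<mu> j = length (filter (\<lambda>a. fps_X ^ j dvd a) as)" .
  moreover have "length (filter (\<lambda>a. fps_X ^ j dvd a) as)
      + length (filter (\<lambda>a. \<not> fps_X ^ j dvd a) as) = \<rho>"
    unfolding \<rho>_def by (rule sum_length_filter_compl)
  ultimately show ?thesis
    using ps.elementary_divisorsD(5)[OF as, of "fps_X ^ j"] rank by simp
qed

end

section \<open>Bases of the kernel in function coordinates\<close>

definition vec_fun :: "'a::zero vec \<Rightarrow> nat \<Rightarrow> 'a" where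
  "vec_fun v = (\<lambda>i. if i < dim_vec v then v $ i else 0)"

lemma inj_vec_fun: "inj_on vec_fun (carrier_vec n)"
proof (rule inj_onI)
  fix v w :: "'a vec" assume "v \<in> carrier_vec n" "w \<in> carrier_vec n" and eq: "vec_fun v = vec_fun w"
  then have dim: "dim_vec v = n" "dim_vec w = n" by auto
  show "v = w"
  proof (rule eq_vecI)
    fix i assume "i < dim_vec w"
    then show "v $ i = w $ i" using fun_cong[OF eq, of i] dim by (simp add: vec_fun_def)
  qed (simp add: dim)
qed

lemma vec_fun_image_carrier: "vec_fun ` carrier_vec n = coord_space {..<n}"
proof (intro equalityI subsetI)
  fix x :: "nat \<Rightarrow> 'a" assume "x \<in> coord_space {..<n}"
  then have "x = vec_fun (vec n x)" by (auto simp: vec_fun_def coord_space_def fun_eq_iff)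
  then show "x \<in> vec_fun ` carrier_vec n" by auto
qed (auto simp: vec_fun_def coord_space_def)

context kernel
begin

lemma vec_fun_lincomb:
  assumes S: "S \<subseteq> mat_kernel A"
  shows "lincomb a S \<in> carrier_vec nc" "vec_fun (lincomb a S) = (\<Sum>v\<in>S. fscale (a v) (vec_fun v))"
proof -
  have carrier: "S \<subseteq> carrier_vec nc" using S mat_kernel_carrier[OF A] by blast
  have "NC.lincomb a S \<in> carrier_vec nc" using carrier by (intro NC.lincomb_closed) auto
  then show lc: "lincomb a S \<in> carrier_vec nc" by (simp add: lincomb_same[OF S])
  show "vec_fun (lincomb a S) = (\<Sum>v\<in>S. fscale (a v) (vec_fun v))"
  proof
    fix i
    have dims: "dim_vec v = nc" if "v \<in> S" for v using carrier that by auto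
    show "vec_fun (lincomb a S) i = (\<Sum>v\<in>S. fscale (a v) (vec_fun v)) i"
    proof (cases "i < nc")
      case True
      then show ?thesis using lc lincomb_index[OF True S]
        by (simp add: vec_fun_def sum_fun_apply dims)
    next
      case False
      then show ?thesis using lc by (simp add: vec_fun_def sum_fun_apply dims)
    qed
  qed
qed

lemma vec_fun_zero_iff: "v \<in> carrier_vec nc \<Longrightarrow> vec_fun v = 0 \<longleftrightarrow> v = 0\<^sub>v nc"
  using inj_onD[OF inj_vec_fun[of nc], of v "0\<^sub>v nc"] by (auto simp: vec_fun_def fun_eq_iff)

lemma lin_dep_iff_dependent:
  assumes S: "S \<subseteq> mat_kernel A" and fin: "finite S"
  shows "lin_dep S \<longleftrightarrow> vs.dependent (vec_fun ` S)"
proof -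
  have inj: "inj_on vec_fun S"
    using S mat_kernel_carrier[OF A] by (meson inj_on_subset inj_vec_fun order_trans)
  have "lin_dep S \<longleftrightarrow> (\<exists>a. (\<exists>v\<in>S. a v \<noteq> 0) \<and> lincomb a S = 0\<^sub>v nc)"
  proof
    assume "lin_dep S"
    from Ker.finite_lin_dep[OF fin this S] show "\<exists>a. (\<exists>v\<in>S. a v \<noteq> 0) \<and> lincomb a S = 0\<^sub>v nc" by auto
  next
    assume "\<exists>a. (\<exists>v\<in>S. a v \<noteq> 0) \<and> lincomb a S = 0\<^sub>v nc"
    then obtain a v where "v \<in> S" "a v \<noteq> 0" "lincomb a S = 0\<^sub>v nc" by auto
    then show "lin_dep S" using fin by (intro Ker.lin_dep_crit[of S S a v]) auto
  qed
  also have "\<dots> \<longleftrightarrow> (\<exists>a. (\<exists>v\<in>S. a v \<noteq> 0) \<and> (\<Sum>v\<in>S. fscale (a v) (vec_fun v)) = 0)"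
    using vec_fun_zero_iff[OF vec_fun_lincomb(1)[OF S]] vec_fun_lincomb(2)[OF S] by simp
  also have "\<dots> \<longleftrightarrow> (\<exists>u. (\<exists>x\<in>vec_fun ` S. u x \<noteq> 0) \<and> (\<Sum>x\<in>vec_fun ` S. fscale (u x) x) = 0)"
  proof
    assume "\<exists>a. (\<exists>v\<in>S. a v \<noteq> 0) \<and> (\<Sum>v\<in>S. fscale (a v) (vec_fun v)) = 0"
    then obtain a where a: "\<exists>v\<in>S. a v \<noteq> 0" "(\<Sum>v\<in>S. fscale (a v) (vec_fun v)) = 0" by blast
    define u where "u = a \<circ> the_inv_into S vec_fun"
    have u: "u (vec_fun v) = a v" if "v \<in> S" for v
      using that inj by (simp add: u_def the_inv_into_f_f)
    then show "\<exists>u. (\<exists>x\<in>vec_fun ` S. u x \<noteq> 0) \<and> (\<Sum>x\<in>vec_fun ` S. fscale (u x) x) = 0"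
      using a by (intro exI[of _ u]) (simp add: sum.reindex[OF inj])
  next
    assume "\<exists>u. (\<exists>x\<in>vec_fun ` S. u x \<noteq> 0) \<and> (\<Sum>x\<in>vec_fun ` S. fscale (u x) x) = 0"
    then obtain u where u: "\<exists>x\<in>vec_fun ` S. u x \<noteq> 0" "(\<Sum>x\<in>vec_fun ` S. fscale (u x) x) = 0" by blast
    then show "\<exists>a. (\<exists>v\<in>S. a v \<noteq> 0) \<and> (\<Sum>v\<in>S. fscale (a v) (vec_fun v)) = 0"
      by (intro exI[of _ "u \<circ> vec_fun"]) (simp add: sum.reindex[OF inj])
  qed
  also have "\<dots> \<longleftrightarrow> vs.dependent (vec_fun ` S)"
    using fin by (intro vs.dependent_finite[symmetric]) simp
  finally show ?thesis .
qed

lemma vec_fun_span: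
  assumes S: "S \<subseteq> mat_kernel A" and fin: "finite S"
  shows "vec_fun ` span S = vs.span (vec_fun ` S)"
proof -
  have inj: "inj_on vec_fun S"
    using S mat_kernel_carrier[OF A] by (meson inj_on_subset inj_vec_fun order_trans)
  have "span S = {lincomb a S | a. a \<in> S \<rightarrow> UNIV}" using fin S by (rule Ker.finite_span)
  then have "span S = range (\<lambda>a. lincomb a S)" by auto
  then have "vec_fun ` span S = range (\<lambda>a. \<Sum>v\<in>S. fscale (a v) (vec_fun v))"
    by (simp add: image_image vec_fun_lincomb(2)[OF S])
  also have "\<dots> = range (\<lambda>u. \<Sum>x\<in>vec_fun ` S. fscale (u x) x)"
  proof (intro equalityI subsetI)
    fix y assume "y \<in> range (\<lambda>a. \<Sum>v\<in>S. fscale (a v) (vec_fun v))"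
    then obtain a where y: "y = (\<Sum>v\<in>S. fscale (a v) (vec_fun v))" by blast
    have "y = (\<Sum>x\<in>vec_fun ` S. fscale ((a \<circ> the_inv_into S vec_fun) x) x)"
      unfolding y sum.reindex[OF inj] using inj by (intro sum.cong) (simp_all add: the_inv_into_f_f)
    then show "y \<in> range (\<lambda>u. \<Sum>x\<in>vec_fun ` S. fscale (u x) x)" by blast
  next
    fix y assume "y \<in> range (\<lambda>u. \<Sum>x\<in>vec_fun ` S. fscale (u x) x)"
    then obtain u where "y = (\<Sum>x\<in>vec_fun ` S. fscale (u x) x)" by blast
    then have "y = (\<Sum>v\<in>S. fscale ((u \<circ> vec_fun) v) (vec_fun v))" by (simp add: sum.reindex[OF inj])
    then show "y \<in> range (\<lambda>a. \<Sum>v\<in>S. fscale (a v) (vec_fun v))" by blast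
  qed
  also have "\<dots> = vs.span (vec_fun ` S)" using fin by (intro vs.span_finite[symmetric]) simp
  finally show ?thesis .
qed

lemma basis_iff:
  assumes fin: "finite S"
  shows "basis S \<longleftrightarrow> S \<subseteq> mat_kernel A \<and> vs.independent (vec_fun ` S)
    \<and> vs.span (vec_fun ` S) = vec_fun ` mat_kernel A"
proof (cases "S \<subseteq> mat_kernel A")
  case True
  have sub: "span S \<subseteq> carrier_vec nc"
    using NC.span_is_subset2[of S] True mat_kernel_carrier[OF A] span_same[OF True] by auto
  have "span S = mat_kernel A \<longleftrightarrow> vec_fun ` span S = vec_fun ` mat_kernel A"
    by (rule inj_on_image_eq_iff[symmetric, OF inj_vec_fun sub mat_kernel_carrier[OF A]])
  then show ?thesis unfolding Ker.basis_def vec_fun_span[OF True fin] lin_dep_iff_dependent[OF True fin]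
    using True by blast
next
  case False
  then show ?thesis unfolding Ker.basis_def by blast
qed

end

abbreviation fract_fun :: "'a::field poly vec \<Rightarrow> nat \<Rightarrow> 'a poly fract" where
  "fract_fun v \<equiv> vec_fun (map_vec to_fract v)"

lemma to_fract_inject: "to_fract p = to_fract q \<longleftrightarrow> p = (q :: 'a::idom)"
  by (simp add: to_fract_def eq_fract)

lemma to_fract_sum: "to_fract (\<Sum>a\<in>A. f a) = (\<Sum>a\<in>A. to_fract (f a :: 'a::idom))"
  by (induction A rule: infinite_finite_induct) simp_all

lemma inj_fract_fun: "inj_on fract_fun (carrier_vec n)"
proof (rule inj_onI)
  fix v w :: "'a poly vec" assume vw: "v \<in> carrier_vec n" "w \<in> carrier_vec n" "fract_fun v = fract_fun w"
  then have "map_vec to_fract v = map_vec to_fract w"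
    using inj_onD[OF inj_vec_fun[of n] vw(3)] by simp
  then show "v = w"
    using vw by (intro eq_vecI) (auto simp: vec_eq_iff to_fract_inject)
qed

lemma null_space_eq: "null_space H = vec_fun ` mat_kernel (map_mat to_fract H)"
proof -
  let ?A = "map_mat to_fract H"
  have iff: "?A *\<^sub>v v = 0\<^sub>v (dim_row ?A)
    \<longleftrightarrow> (\<forall>i\<in>{..<dim_row H}. (\<Sum>j\<in>{..<dim_col H}. to_fract (H $$ (i, j)) * vec_fun v j) = 0)"
    if v: "v \<in> carrier_vec (dim_col H)" for v
  proof -
    have "(?A *\<^sub>v v) $ i = (\<Sum>j\<in>{..<dim_col H}. to_fract (H $$ (i, j)) * vec_fun v j)"
      if "i < dim_row H" for i
      using that v by (auto simp: scalar_prod_def vec_fun_def atLeast0LessThan intro!: sum.cong)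
    then show ?thesis by (auto simp: vec_eq_iff)
  qed
  show ?thesis
  proof (intro equalityI subsetI)
    fix x assume x: "x \<in> null_space H"
    then have "x \<in> coord_space {..<dim_col H}" by (auto simp: fld.res_sol_def fld.sol_def)
    then obtain v where v: "v \<in> carrier_vec (dim_col H)" "x = vec_fun v"
      unfolding vec_fun_image_carrier[symmetric] by blast
    then have "v \<in> mat_kernel ?A" using x iff[OF v(1)] by (auto simp: mat_kernel_def fld.res_sol_def fld.sol_def)
    then show "x \<in> vec_fun ` mat_kernel ?A" using v by blast
  next
    fix x assume "x \<in> vec_fun ` mat_kernel ?A"
    then obtain v where v: "v \<in> mat_kernel ?A" "x = vec_fun v" by blast
    then have c: "v \<in> carrier_vec (dim_col H)" by (auto simp: mat_kernel_def)
    then have "x \<in> coord_space {..<dim_col H}" unfolding vec_fun_image_carrier[symmetric] using v by blast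
    then show "x \<in> null_space H" using v iff[OF c] by (auto simp: mat_kernel_def fld.res_sol_def fld.sol_def)
  qed
qed

lemma subspace_null_space: "vs.subspace (null_space H)"
  by (rule subspace_field_sol)

lemma null_space_coord: "null_space H \<subseteq> coord_space {..<dim_col H}"
  by (rule fld.res_sol_coord)

text \<open>Linear independence and spans are transported along the injective map from vectors to functions.\<close>

lemma polynomial_null_basis_iff:
  "polynomial_null_basis H B \<longleftrightarrow> B \<subseteq> carrier_vec (dim_col H) \<and> finite B \<and>
     vs.independent (fract_fun ` B) \<and> vs.span (fract_fun ` B) = null_space H"
proof -
  let ?A = "map_mat to_fract H"
  interpret K: kernel "dim_row H" "dim_col H" ?A by unfold_locales simp
  have *: "K.basis (map_vec to_fract ` B) \<longleftrightarrow>
      vs.independent (fract_fun ` B) \<and> vs.span (fract_fun ` B) = null_space H"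
    if B: "B \<subseteq> carrier_vec (dim_col H)" "finite B"
  proof -
    have fin: "finite (map_vec to_fract ` B)" using B by simp
    have img: "vec_fun ` map_vec to_fract ` B = fract_fun ` B" by (simp add: image_image)
    have "map_vec to_fract ` B \<subseteq> mat_kernel ?A" if span: "vs.span (fract_fun ` B) = null_space H"
    proof
      fix w assume w: "w \<in> map_vec to_fract ` B"
      then have wc: "w \<in> carrier_vec (dim_col H)" using B by auto
      have "vec_fun w \<in> vec_fun ` mat_kernel ?A"
        using w vs.span_superset[of "fract_fun ` B"] unfolding null_space_eq[symmetric] span[symmetric]
        by auto
      then obtain w' where w': "w' \<in> mat_kernel ?A" "vec_fun w = vec_fun w'" by blast
      then have "w = w'" using inj_onD[OF inj_vec_fun w'(2) wc] by (auto simp: mat_kernel_def)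
      then show "w \<in> mat_kernel ?A" using w' by simp
    qed
    then show ?thesis unfolding K.basis_iff[OF fin] img null_space_eq[symmetric] by blast
  qed
  then show ?thesis unfolding polynomial_null_basis_def by blast
qed

section \<open>Polynomial vectors of bounded degree in a subspace\<close>

text \<open>Only the span over the rational functions of this set will matter; the set itself is closed under
linear combinations with constant coefficients if \<open>N\<close> is a subspace.\<close>

definition poly_part :: "nat \<Rightarrow> (nat \<Rightarrow> 'a::field poly fract) set \<Rightarrow> (nat \<Rightarrow> 'a poly fract) set" where
  "poly_part k N = {x \<in> N. \<exists>p. \<forall>i. x i = to_fract (p i) \<and> degree (p i) \<le> k}"

lemma poly_part_subset: "poly_part k N \<subseteq> N"
  by (auto simp: poly_part_def)

lemma poly_partI:
  assumes "x \<in> N" "\<And>i. x i = to_fract (p i)" "\<And>i. degree (p i) \<le> k"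
  shows "x \<in> poly_part k N"
  using assms unfolding poly_part_def by blast

lemma poly_part_mono: "k \<le> l \<Longrightarrow> poly_part k N \<subseteq> poly_part l N"
  unfolding poly_part_def using order_trans by blast

lemma common_denominator:
  fixes x :: "nat \<Rightarrow> 'a::field poly fract"
  assumes "finite J"
  shows "\<exists>d. d \<noteq> 0 \<and> (\<forall>j\<in>J. \<exists>p. to_fract d * x j = to_fract p)"
  using assms
proof (induction J rule: finite_induct)
  case (insert j J)
  then obtain d where d: "d \<noteq> 0" "\<forall>j\<in>J. \<exists>p. to_fract d * x j = to_fract p" by blast
  obtain a b where ab: "x j = Fract a b" "b \<noteq> 0" by (cases "x j")
  have 1: "to_fract b * x j = to_fract a"
    using ab by (simp add: to_fract_def eq_fract)
  have "\<exists>p. to_fract (d * b) * x i = to_fract p" if i: "i \<in> insert j J" for i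
  proof (cases "i = j")
    case True
    have "to_fract (d * b) * x i = to_fract (d * a)" unfolding True using 1 by (simp add: mult.assoc)
    then show ?thesis by blast
  next
    case False
    then obtain p where "to_fract d * x i = to_fract p" using d i by blast
    then have "to_fract (d * b) * x i = to_fract (b * p)" by (simp add: ac_simps)
    then show ?thesis by blast
  qed
  moreover have "d * b \<noteq> 0" using d ab by simp
  ultimately show ?case by blast
qed (auto intro: exI[of _ 1])

lemma polynomial_multiple:
  fixes x :: "nat \<Rightarrow> 'a::field poly fract"
  assumes J: "finite J" and N: "vs.subspace N" "N \<subseteq> coord_space J" and x: "x \<in> N"
  shows "\<exists>d k. d \<noteq> 0 \<and> fscale (to_fract d) x \<in> poly_part k N"
proof -
  obtain d where d: "d \<noteq> 0" "\<forall>j\<in>J. \<exists>p. to_fract d * x j = to_fract p"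
    using common_denominator[OF J] by blast
  have "\<exists>p. to_fract d * x j = to_fract p \<and> (j \<notin> J \<longrightarrow> p = 0)" for j
  proof (cases "j \<in> J")
    case False
    then have "x j = 0" using x N by (auto simp: coord_space_def)
    then show ?thesis by (intro exI[of _ 0]) simp
  qed (use d in blast)
  then obtain p where p: "\<And>j. to_fract d * x j = to_fract (p j)" "\<And>j. j \<notin> J \<Longrightarrow> p j = 0" by metis
  define k where "k = Max (insert 0 ((\<lambda>j. degree (p j)) ` J))"
  have "degree (p j) \<le> k" for j
  proof (cases "j \<in> J")
    case True
    then show ?thesis unfolding k_def using J by (intro Max_ge) auto
  qed (simp add: p)
  moreover have "fscale (to_fract d) x \<in> N" using N(1) x by (rule vs.subspace_scale)
  ultimately have "fscale (to_fract d) x \<in> poly_part k N"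
    using p(1) by (auto simp: poly_part_def)
  then show ?thesis using d(1) by blast
qed

lemma in_span_scaled:
  assumes "c \<noteq> 0" "fscale c x \<in> vs.span S"
  shows "x \<in> vs.span S"
proof -
  have "fscale (inverse c) (fscale c x) \<in> vs.span S" using assms(2) by (rule vs.span_scale)
  moreover have "fscale (inverse c) (fscale c x) = x"
    using assms(1) by (simp add: fun_eq_iff fscale_def)
  ultimately show ?thesis by simp
qed

text \<open>Multiplying the members of a basis by common denominators makes them polynomial.\<close>

lemma span_poly_part:
  assumes J: "finite J" and N: "vs.subspace N" "N \<subseteq> coord_space J"
  shows "\<exists>D. N \<subseteq> vs.span (poly_part D N)"
proof -
  obtain B where B: "B \<subseteq> N" "N \<subseteq> vs.span B" "finite B"
    using fdim_basis[OF J N(2)] by metis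
  have "\<exists>D. \<forall>x\<in>B. x \<in> vs.span (poly_part D N)"
    using B(3,1)
  proof (induction B rule: finite_induct)
    case (insert x F)
    then obtain D where D: "\<forall>x\<in>F. x \<in> vs.span (poly_part D N)" by blast
    from polynomial_multiple[OF J N, of x] insert.prems obtain d k where
      d: "d \<noteq> 0" "fscale (to_fract d) x \<in> poly_part k N" by blast
    have "poly_part k N \<subseteq> poly_part (max D k) N" by (rule poly_part_mono) simp
    from subsetD[OF this d(2)] have "fscale (to_fract d) x \<in> vs.span (poly_part (max D k) N)"
      by (rule vs.span_base)
    moreover have "to_fract d \<noteq> 0" using d(1) by (simp only: to_fract_eq_0_iff not_False_eq_True)
    ultimately have "x \<in> vs.span (poly_part (max D k) N)" by (rule in_span_scaled[rotated])
    moreover have "vs.span (poly_part D N) \<subseteq> vs.span (poly_part (max D k) N)"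
      by (intro vs.span_mono poly_part_mono) simp
    ultimately show ?case using D by blast
  qed simp
  then obtain D where "\<forall>x\<in>B. x \<in> vs.span (poly_part D N)" ..
  then have "B \<subseteq> vs.span (poly_part D N)" by (intro subsetI) (erule (1) bspec)
  then have "vs.span B \<subseteq> vs.span (poly_part D N)" by (rule vs.span_minimal) (rule vs.subspace_span)
  with B(2) have "N \<subseteq> vs.span (poly_part D N)" by (rule order_trans)
  then show ?thesis ..
qed

text \<open>The number of members of degree at least \<open>k\<close> in a polynomial basis of \<open>N\<close> with least sum of
degrees, expressed without reference to a basis.\<close>

definition brunovsky_seq :: "(nat \<Rightarrow> 'a::field poly fract) set \<Rightarrow> nat \<Rightarrow> nat" where
  "brunovsky_seq N k = (case k of 0 \<Rightarrow> vs.dim N | Suc l \<Rightarrow> vs.dim N - vs.dim (poly_part l N))"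

lemma dim_poly_part_le:
  assumes "finite J" "N \<subseteq> coord_space J"
  shows "vs.dim (poly_part k N) \<le> vs.dim N" "k \<le> l \<Longrightarrow> vs.dim (poly_part k N) \<le> vs.dim (poly_part l N)"
proof -
  show "vs.dim (poly_part k N) \<le> vs.dim N"
    using poly_part_subset vs.span_superset by (intro fdim_mono[OF assms]) blast
  assume "k \<le> l"
  then show "vs.dim (poly_part k N) \<le> vs.dim (poly_part l N)"
    using poly_part_mono[of k l N] vs.span_superset[of "poly_part l N"] poly_part_subset[of l N] assms
    by (intro fdim_mono) blast+
qed

lemma antimono_brunovsky_seq:
  assumes "finite J" "N \<subseteq> coord_space J"
  shows "antimono (brunovsky_seq N)"
proof (rule decseq_SucI)
  show "brunovsky_seq N (Suc k) \<le> brunovsky_seq N k" for k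
    using dim_poly_part_le(2)[OF assms, of "k - 1" k]
    by (auto simp: brunovsky_seq_def split: nat.splits)
qed

section \<open>Minimal bases\<close>

text \<open>A maximal independent set of vectors of degree at most \<open>k\<close> is extended to one for degree at most
\<open>k + 1\<close>, for \<open>k = 0, 1, \<dots>\<close>.\<close>

lemma greedy_basis:
  assumes J: "finite J" and N: "N \<subseteq> coord_space J"
  shows "\<exists>C. C \<subseteq> poly_part D N \<and> vs.independent C \<and> poly_part D N \<subseteq> vs.span C \<and>
    (\<forall>k\<le>D. vs.dim (poly_part k N) \<le> card (C \<inter> poly_part k N))"
proof (induction D)
  case 0
  obtain C where C: "C \<subseteq> poly_part 0 N" "vs.independent C" "poly_part 0 N \<subseteq> vs.span C"
      "card C = vs.dim (poly_part 0 N)"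
    using vs.basis_exists by blast
  then have "C \<inter> poly_part 0 N = C" by blast
  with C show ?case by (intro exI[of _ C]) (simp del: fscale_apply)
next
  case (Suc D)
  then obtain C where C: "C \<subseteq> poly_part D N" "vs.independent C" "poly_part D N \<subseteq> vs.span C"
    "\<forall>k\<le>D. vs.dim (poly_part k N) \<le> card (C \<inter> poly_part k N)" by blast
  have "C \<subseteq> poly_part (Suc D) N" using C(1) poly_part_mono[of D "Suc D" N] by auto
  from vs.maximal_independent_subset_extend[OF this C(2)] obtain C' where
    C': "C \<subseteq> C'" "C' \<subseteq> poly_part (Suc D) N" "vs.independent C'" "poly_part (Suc D) N \<subseteq> vs.span C'"
    by blast
  have fin: "finite C'"
    using C' N poly_part_subset[of "Suc D" N] by (intro finite_if_independent_coord_space[OF J]) auto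
  have "vs.dim (poly_part k N) \<le> card (C' \<inter> poly_part k N)" if k: "k \<le> Suc D" for k
  proof (cases "k = Suc D")
    case True
    then have "C' \<inter> poly_part k N = C'" using C' by blast
    moreover have "card C' = vs.dim (poly_part k N)"
      unfolding True by (rule vs.basis_card_eq_dim) fact+
    ultimately show ?thesis by simp
  next
    case False
    then have "vs.dim (poly_part k N) \<le> card (C \<inter> poly_part k N)" using C(4) k by simp
    also have "\<dots> \<le> card (C' \<inter> poly_part k N)" using fin C'(1) by (intro card_mono) auto
    finally show ?thesis .
  qed
  then show ?case using C' by blast
qed

lemma vec_degree_le_iff:
  "vec_degree v \<le> k \<longleftrightarrow> (\<forall>i<dim_vec v. degree (v $ i) \<le> k)"
proof -
  have "finite {degree (v $ i) | i. i < dim_vec v}" by simp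
  then show ?thesis unfolding vec_degree_def by (subst Max_le_iff) auto
qed

lemma fract_fun_in_poly_part_iff:
  "fract_fun v \<in> poly_part k N \<longleftrightarrow> fract_fun v \<in> N \<and> vec_degree v \<le> k"
proof -
  have "(\<exists>p. \<forall>i. fract_fun v i = to_fract (p i) \<and> degree (p i) \<le> k) \<longleftrightarrow> vec_degree v \<le> k"
    unfolding vec_degree_le_iff
  proof
    assume "\<exists>p. \<forall>i. fract_fun v i = to_fract (p i) \<and> degree (p i) \<le> k"
    then obtain p where p: "\<And>i. fract_fun v i = to_fract (p i)" "\<And>i. degree (p i) \<le> k" by blast
    have "p i = v $ i" if "i < dim_vec v" for i
      using p(1)[of i] that by (simp add: vec_fun_def to_fract_inject)
    then show "\<forall>i<dim_vec v. degree (v $ i) \<le> k" using p(2) by metis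
  next
    assume d: "\<forall>i<dim_vec v. degree (v $ i) \<le> k"
    show "\<exists>p. \<forall>i. fract_fun v i = to_fract (p i) \<and> degree (p i) \<le> k"
      using d by (intro exI[of _ "\<lambda>i. if i < dim_vec v then v $ i else 0"]) (auto simp: vec_fun_def)
  qed
  then show ?thesis by (auto simp: poly_part_def)
qed

lemma polynomial_vector_of_fun:
  assumes "x \<in> poly_part k N" "N \<subseteq> coord_space {..<n}"
  shows "\<exists>v\<in>carrier_vec n. x = fract_fun v"
proof -
  obtain p where p: "\<And>i. x i = to_fract (p i)" using assms by (auto simp: poly_part_def)
  have "x i = 0" if "i \<ge> n" for i
    using assms that poly_part_subset[of k N] by (auto simp: coord_space_def)
  then have "x = fract_fun (vec n p)" by (auto simp: vec_fun_def fun_eq_iff p)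
  then show ?thesis by auto
qed

text \<open>Both sides count the pairs \<open>(v, k)\<close> with \<open>k < f v\<close>.\<close>

lemma sum_eq_card_levels:
  fixes f :: "'b \<Rightarrow> nat"
  assumes "finite B" "\<And>v. v \<in> B \<Longrightarrow> f v \<le> M"
  shows "(\<Sum>v\<in>B. f v) = (\<Sum>k<M. card {v \<in> B. k < f v})"
proof -
  have "f v = (\<Sum>k<M. if k < f v then 1 else 0)" if "v \<in> B" for v
  proof -
    have "{..<M} \<inter> {k. k < f v} = {..<f v}" using assms(2)[OF that] by auto
    then show ?thesis by (simp add: sum.If_cases)
  qed
  then have "(\<Sum>v\<in>B. f v) = (\<Sum>v\<in>B. \<Sum>k<M. if k < f v then 1 else 0)" by (rule sum.cong[OF refl])
  also have "\<dots> = (\<Sum>k<M. \<Sum>v\<in>B. if k < f v then 1 else 0)" by (rule sum.swap)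
  also have "\<dots> = (\<Sum>k<M. card {v \<in> B. k < f v})"
    using assms(1) by (simp add: sum.If_cases Int_def)
  finally show ?thesis .
qed

lemma poly_null_basis_card:
  assumes B: "polynomial_null_basis H B"
  shows "card B = vs.dim (null_space H)"
    and "card {v \<in> B. vec_degree v \<le> k} \<le> vs.dim (poly_part k (null_space H))"
proof -
  let ?n = "dim_col H"
  have carrier: "B \<subseteq> carrier_vec ?n" and fin: "finite B" and ind: "vs.independent (fract_fun ` B)"
    and span: "vs.span (fract_fun ` B) = null_space H"
    using B by (auto simp: polynomial_null_basis_iff)
  have inj: "inj_on fract_fun B" using carrier inj_on_subset[OF inj_fract_fun] by blast
  have "vs.dim (null_space H) = card (fract_fun ` B)"
    unfolding span[symmetric] using ind by (rule vs.dim_span_eq_card_independent)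
  then show "card B = vs.dim (null_space H)" using inj by (simp add: card_image)
  let ?B = "{v \<in> B. vec_degree v \<le> k}"
  have "fract_fun ` ?B \<subseteq> poly_part k (null_space H)"
    using span vs.span_superset[of "fract_fun ` B"] by (auto simp: fract_fun_in_poly_part_iff)
  moreover have "vs.independent (fract_fun ` ?B)"
    using ind by (rule vs.independent_mono) blast
  ultimately have "card (fract_fun ` ?B) \<le> vs.dim (poly_part k (null_space H))"
    using null_space_coord[of H] poly_part_subset[of k "null_space H"]
      vs.span_superset[of "poly_part k (null_space H)"]
    by (intro fdim_independent_le[of "{..<?n}"]) auto
  moreover have "card (fract_fun ` ?B) = card ?B"
    using inj by (intro card_image) (rule inj_on_subset, auto)
  ultimately show "card ?B \<le> vs.dim (poly_part k (null_space H))" by simp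
qed

lemma optimal_null_basis_exists:
  "\<exists>B. polynomial_null_basis H B \<and>
    (\<forall>k. vs.dim (poly_part k (null_space H)) \<le> card {v \<in> B. vec_degree v \<le> k})"
proof -
  let ?n = "dim_col H" and ?N = "null_space H"
  have J: "finite {..<?n}" by simp
  note N = null_space_coord[of H]
  obtain D where D: "?N \<subseteq> vs.span (poly_part D ?N)"
    using span_poly_part[OF J subspace_null_space N] by blast
  obtain C where C: "C \<subseteq> poly_part D ?N" "vs.independent C" "poly_part D ?N \<subseteq> vs.span C"
    "\<forall>k\<le>D. vs.dim (poly_part k ?N) \<le> card (C \<inter> poly_part k ?N)"
    using greedy_basis[OF J N] by blast
  have "vs.span (poly_part D ?N) \<subseteq> vs.span C" using C(3) by (rule vs.span_minimal) (rule vs.subspace_span)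
  with D have NC: "?N \<subseteq> vs.span C" by (rule order_trans)
  have CN: "C \<subseteq> ?N" using C(1) poly_part_subset by (rule order_trans)
  then have spanC: "vs.span C = ?N" using NC subspace_null_space by (rule vs.span_subspace)
  have finC: "finite C" using order_trans[OF CN N] C(2) by (rule finite_if_independent_coord_space[OF J])
  define B where "B = {v \<in> carrier_vec ?n. fract_fun v \<in> C}"
  have img: "fract_fun ` B = C"
  proof (intro equalityI subsetI)
    fix x assume "x \<in> C"
    then have "x \<in> poly_part D ?N" using C(1) by blast
    from polynomial_vector_of_fun[OF this N] obtain v where "v \<in> carrier_vec ?n" "x = fract_fun v" by blast
    then show "x \<in> fract_fun ` B" using \<open>x \<in> C\<close> by (auto simp: B_def)
  qed (auto simp: B_def)
  have inj: "inj_on fract_fun B" by (rule inj_on_subset[OF inj_fract_fun]) (auto simp: B_def)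
  have finB: "finite B" using finC img inj finite_imageD by blast
  have basis: "polynomial_null_basis H B"
    unfolding polynomial_null_basis_iff img using finB C(2) spanC by (auto simp: B_def)
  have "vs.dim (poly_part k ?N) \<le> card {v \<in> B. vec_degree v \<le> k}" for k
  proof (cases "k \<le> D")
    case True
    have "C \<inter> poly_part k ?N = fract_fun ` {v \<in> B. vec_degree v \<le> k}"
      unfolding img[symmetric] using CN[folded img] by (auto simp: fract_fun_in_poly_part_iff)
    then have "card (C \<inter> poly_part k ?N) \<le> card {v \<in> B. vec_degree v \<le> k}"
      using finB by (simp add: card_image_le)
    with C(4) True show ?thesis by (meson order_trans)
  next
    case False
    then have "poly_part D ?N \<subseteq> poly_part k ?N" by (intro poly_part_mono) simp
    then have "C \<subseteq> poly_part k ?N" using C(1) by (rule order_trans[rotated])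
    then have "{v \<in> B. vec_degree v \<le> k} = B"
      using img by (auto simp: B_def fract_fun_in_poly_part_iff subset_iff)
    then show ?thesis
      using poly_null_basis_card(1)[OF basis] dim_poly_part_le(1)[OF J N, of k] by simp
  qed
  then show ?thesis using basis by blast
qed

lemma minimal_null_basis_exists: "\<exists>B. minimal_null_basis H B"
proof -
  have "\<exists>B. polynomial_null_basis H B" using optimal_null_basis_exists[of H] by blast
  from ex_has_least_nat[of "polynomial_null_basis H" _ "\<lambda>B. \<Sum>v\<in>B. vec_degree v"] this
  show ?thesis unfolding minimal_null_basis_def by blast
qed

text \<open>The sum of the degrees is the sum over \<open>k\<close> of the numbers of members of degree greater than \<open>k\<close>. The
greedy basis makes each of these numbers as small as it can be in any basis; so a basis with least sum must
agree with it in every summand.\<close>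

lemma minimal_null_basis_card:
  assumes B: "minimal_null_basis H B"
  shows "card {v \<in> B. k < vec_degree v} = vs.dim (null_space H) - vs.dim (poly_part k (null_space H))"
proof -
  let ?N = "null_space H"
  obtain B0 where B0: "polynomial_null_basis H B0"
    and opt: "\<And>k. vs.dim (poly_part k ?N) \<le> card {v \<in> B0. vec_degree v \<le> k}"
    using optimal_null_basis_exists by blast
  have pB: "polynomial_null_basis H B" and le: "(\<Sum>v\<in>B. vec_degree v) \<le> (\<Sum>v\<in>B0. vec_degree v)"
    using B B0 by (auto simp: minimal_null_basis_def)
  have fin: "finite B" "finite B0" using pB B0 by (auto simp: polynomial_null_basis_iff)
  have split: "card {v \<in> B'. k < vec_degree v} = vs.dim ?N - card {v \<in> B'. vec_degree v \<le> k}"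
    if "polynomial_null_basis H B'" for B' k
  proof -
    have "finite B'" using that by (simp add: polynomial_null_basis_iff)
    moreover have "{v \<in> B'. k < vec_degree v} = B' - {v \<in> B'. vec_degree v \<le> k}" by auto
    ultimately show ?thesis
      using poly_null_basis_card(1)[OF that] by (simp add: card_Diff_subset)
  qed
  \<comment> \<open>any number that exceeds \<open>k\<close> and bounds all degrees would do\<close>
  define M where "M = Suc k + (\<Sum>v\<in>B \<union> B0. vec_degree v)"
  have M: "vec_degree v \<le> M" if "v \<in> B \<union> B0" for v
  proof -
    have "vec_degree v \<le> (\<Sum>v\<in>B \<union> B0. vec_degree v)" using fin that by (intro member_le_sum) auto
    then show ?thesis by (simp add: M_def)
  qed
  let ?f = "\<lambda>B k. card {v \<in> B. k < vec_degree v}"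
  have ge: "?f B0 l \<le> ?f B l" for l
    using split[OF pB, of l] split[OF B0, of l] opt[of l] poly_null_basis_card(2)[OF pB, of l] by simp
  have "(\<Sum>l<M. ?f B l) \<le> (\<Sum>l<M. ?f B0 l)"
    using le sum_eq_card_levels[OF fin(1), of vec_degree M] sum_eq_card_levels[OF fin(2), of vec_degree M] M
    by auto
  moreover have "(\<Sum>l<M. ?f B0 l) < (\<Sum>l<M. ?f B l)" if "?f B0 k < ?f B k"
    using that ge by (intro sum_strict_mono_ex1) (auto simp: M_def)
  ultimately have "?f B k \<le> ?f B0 k" by linarith
  moreover have "?f B0 k \<le> vs.dim ?N - vs.dim (poly_part k ?N)" using split[OF B0, of k] opt[of k] by simp
  moreover have "vs.dim ?N - vs.dim (poly_part k ?N) \<le> ?f B k"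
    using split[OF pB, of k] poly_null_basis_card(2)[OF pB, of k] by simp
  ultimately show ?thesis by linarith
qed

lemma conjugate_seq_of_list:
  assumes "k \<ge> 1"
  shows "conjugate (seq_of_list xs) k = length (filter (\<lambda>x. k \<le> x) xs)"
proof -
  have "{i. 1 \<le> i \<and> k \<le> seq_of_list xs i} = Suc ` {i. i < length xs \<and> k \<le> xs ! i}"
  proof (intro equalityI subsetI)
    fix i assume i: "i \<in> {i. 1 \<le> i \<and> k \<le> seq_of_list xs i}"
    then obtain i' where i': "i = Suc i'" by (cases i) auto
    then show "i \<in> Suc ` {i. i < length xs \<and> k \<le> xs ! i}"
      using i assms by (auto simp: seq_of_list_def split: if_splits)
  qed (auto simp: seq_of_list_def)
  then show ?thesis
    by (simp add: conjugate_def card_image length_filter_conv_card)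
qed

theorem column_brunovsky_eq: "column_brunovsky H = brunovsky_seq (null_space H)"
proof
  fix k
  show "column_brunovsky H k = brunovsky_seq (null_space H) k"
  proof (cases k)
    case 0
    then show ?thesis using normal_rank_nullity[of H] by (simp add: column_brunovsky_def brunovsky_seq_def)
  next
    case (Suc l)
    define B where "B = (SOME B. minimal_null_basis H B)"
    have B: "minimal_null_basis H B"
      unfolding B_def by (rule someI_ex[OF minimal_null_basis_exists])
    let ?M = "image_mset vec_degree (mset_set B)"
    have "column_brunovsky H k
      = length (filter (\<lambda>x. k \<le> x) (rev (sorted_list_of_multiset ?M)))"
      unfolding column_brunovsky_def column_minimal_indices_def B_def[symmetric]
      using conjugate_seq_of_list[of k] Suc by simp
    also have "\<dots> = size (mset (filter (\<lambda>x. k \<le> x) (rev (sorted_list_of_multiset ?M))))"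
      by (rule size_mset[symmetric])
    also have "\<dots> = size (filter_mset (\<lambda>x. k \<le> x) ?M)"
      by (simp only: mset_filter mset_rev mset_sorted_list_of_multiset)
    also have "\<dots> = card {v \<in> B. k \<le> vec_degree v}"
      using B by (simp add: filter_mset_image_mset minimal_null_basis_def polynomial_null_basis_iff)
    also have "{v \<in> B. k \<le> vec_degree v} = {v \<in> B. l < vec_degree v}" using Suc by auto
    finally show ?thesis using minimal_null_basis_card[OF B, of l] Suc by (simp add: brunovsky_seq_def)
  qed
qed

section \<open>Cutting a subspace by a linear form with polynomial coefficients\<close>

text \<open>The rank is at most the number of equations, because a larger minor repeats a row.\<close>

lemma underdetermined_system:
  fixes A :: "nat \<Rightarrow> nat \<Rightarrow> 'a::field"
  assumes "M < L"
  shows "\<exists>\<alpha>. (\<exists>j<L. \<alpha> j \<noteq> 0) \<and> (\<forall>i<M. (\<Sum>j<L. A i j * \<alpha> j) = 0)"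
proof (rule ccontr)
  assume no: "\<not> ?thesis"
  obtain as where as: "fld.elementary_divisors as A {..<M} {..<L}"
    using fld.elementary_divisors_exist[of "{..<M}" "{..<L}"] by auto
  have nz: "0 \<notin> set as" by (rule fld.elementary_divisorsD(1)[OF as])
  have "length as \<le> M"
  proof (rule ccontr)
    assume l: "\<not> length as \<le> M"
    have "dvd_minors 0 (length as) A {..<M} {..<L}" unfolding dvd_minors_def
    proof (intro allI impI)
      fix f g assume "f ` {..<length as} \<subseteq> {..<M}"
      then have "\<not> inj_on f {..<length as}" using l card_inj_on_le[of f "{..<length as}" "{..<M}"] by auto
      then show "0 dvd fminor A (length as) f g" by (simp add: fminor_not_inj_rows)
    qed
    then have "prod_list as = 0"
      using fld.elementary_divisorsD(3)[OF as, of "length as" 0] by simp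
    then show False using nz by (simp add: prod_list_zero_iff)
  qed
  moreover have "filter (\<lambda>a. \<not> 0 dvd a) as = as" using nz by (auto simp: filter_id_conv)
  ultimately have "vs.dim (fld.res_sol 0 A {..<M} {..<L}) > 0"
    using fld.elementary_divisorsD(5)[OF as, of 0] assms by simp
  moreover have "fld.res_sol 0 A {..<M} {..<L} \<subseteq> vs.span {}"
  proof
    fix x assume x: "x \<in> fld.res_sol 0 A {..<M} {..<L}"
    then have "\<forall>i<M. (\<Sum>j<L. A i j * x j) = 0" and c: "x \<in> coord_space {..<L}"
      by (auto simp: fld.res_sol_def fld.sol_def)
    with no have "\<forall>j<L. x j = 0" by blast
    with c have "x = 0" by (auto simp: coord_space_def fun_eq_iff)
    then show "x \<in> vs.span {}" by (simp add: vs.span_zero)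
  qed
  then have "vs.dim (fld.res_sol 0 A {..<M} {..<L}) \<le> card ({} :: (nat \<Rightarrow> 'a) set)"
    by (rule vs.dim_le_card) simp
  ultimately show False by simp
qed

definition eval_form :: "nat \<Rightarrow> (nat \<Rightarrow> 'a::field poly) \<Rightarrow> (nat \<Rightarrow> 'a poly fract) \<Rightarrow> 'a poly fract" where
  "eval_form n l x = (\<Sum>j<n. to_fract (l j) * x j)"

definition form_kernel :: "nat \<Rightarrow> (nat \<Rightarrow> 'a::field poly) \<Rightarrow> (nat \<Rightarrow> 'a poly fract) set \<Rightarrow> (nat \<Rightarrow> 'a poly fract) set" where
  "form_kernel n l N = {x \<in> N. eval_form n l x = 0}"

lemma eval_form_add: "eval_form n l (x + y) = eval_form n l x + eval_form n l y"
  by (simp add: eval_form_def distrib_left sum.distrib)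

lemma eval_form_scale: "eval_form n l (fscale c x) = c * eval_form n l x"
  by (simp add: eval_form_def sum_distrib_left mult.left_commute)

lemma eval_form_sum: "eval_form n l (\<Sum>a\<in>A. f a) = (\<Sum>a\<in>A. eval_form n l (f a))"
proof (induction A rule: infinite_finite_induct)
  case (insert a A)
  show ?case unfolding sum.insert[OF insert.hyps] eval_form_add insert.IH ..
qed (simp_all add: eval_form_def)

lemma subspace_form_kernel: "vs.subspace N \<Longrightarrow> vs.subspace (form_kernel n l N)"
proof -
  assume N: "vs.subspace N"
  have "eval_form n l 0 = 0" by (simp add: eval_form_def)
  then show ?thesis using vs.subspace_0[OF N] vs.subspace_add[OF N] vs.subspace_scale[OF N]
    unfolding vs.subspace_def form_kernel_def by (simp add: eval_form_add eval_form_scale)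
qed

lemma poly_part_combination:
  fixes u :: "nat \<Rightarrow> nat \<Rightarrow> 'a::field poly fract"
  assumes N: "vs.subspace N" and u: "\<And>j. j < L \<Longrightarrow> u j \<in> poly_part k N"
  shows "(\<Sum>j<L. fscale (to_fract [:\<alpha> j:]) (u j)) \<in> poly_part k N"
proof -
  have "\<exists>p. \<forall>i. u j i = to_fract (p i) \<and> degree (p i) \<le> k" if "j < L" for j
    using u[OF that] by (auto simp: poly_part_def)
  then obtain p where p: "\<And>i j. j < L \<Longrightarrow> u j i = to_fract (p j i)" "\<And>i j. j < L \<Longrightarrow> degree (p j i) \<le> k"
    by metis
  have "(\<Sum>j<L. fscale (to_fract [:\<alpha> j:]) (u j)) i = to_fract (\<Sum>j<L. [:\<alpha> j:] * p j i)" for i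
    unfolding sum_fun_apply to_fract_sum by (intro sum.cong) (simp_all add: p(1) del: mult_pCons_left)
  moreover have "degree (\<Sum>j<L. [:\<alpha> j:] * p j i) \<le> k" for i
    using p(2) by (intro degree_sum_le) (auto intro: order_trans[OF degree_smult_le])
  moreover have "(\<Sum>j<L. fscale (to_fract [:\<alpha> j:]) (u j)) \<in> N"
    using u poly_part_subset[of k N] by (intro vs.subspace_sum[OF N] vs.subspace_scale[OF N]) auto
  ultimately show ?thesis by (intro poly_partI)
qed

text \<open>On vectors of degree at most \<open>k\<close> the form takes polynomial values of degree at most \<open>k + b\<close>, which are
determined by \<open>k + b + 1\<close> coefficients. The relation has constant coefficients, so the combination
again has degree at most \<open>k\<close>.\<close>

lemma combination_in_form_kernel:
  fixes u :: "nat \<Rightarrow> nat \<Rightarrow> 'a::field poly fract"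
  assumes N: "vs.subspace N" and l: "\<And>j. j < n \<Longrightarrow> degree (l j) \<le> b"
    and u: "\<And>j. j < L \<Longrightarrow> u j \<in> poly_part k N" and L: "k + b + 1 < L"
  shows "\<exists>\<alpha>. (\<exists>j<L. \<alpha> j \<noteq> 0) \<and> (\<Sum>j<L. fscale (to_fract [:\<alpha> j:]) (u j)) \<in> poly_part k (form_kernel n l N)"
proof -
  have "\<exists>e. eval_form n l (u j) = to_fract e \<and> degree e \<le> k + b" if j: "j < L" for j
  proof -
    obtain p where p: "\<And>i. u j i = to_fract (p i)" "\<And>i. degree (p i) \<le> k"
      using u[OF j] by (auto simp: poly_part_def)
    have "eval_form n l (u j) = to_fract (\<Sum>i<n. l i * p i)"
      by (simp add: eval_form_def p(1) to_fract_sum)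
    moreover have "degree (\<Sum>i<n. l i * p i) \<le> k + b"
    proof (rule degree_sum_le)
      fix i assume "i \<in> {..<n}"
      then show "degree (l i * p i) \<le> k + b"
        using degree_mult_le[of "l i" "p i"] l[of i] p(2)[of i] by simp
    qed simp
    ultimately show ?thesis by blast
  qed
  then obtain e where e: "\<And>j. j < L \<Longrightarrow> eval_form n l (u j) = to_fract (e j)"
    "\<And>j. j < L \<Longrightarrow> degree (e j) \<le> k + b" by metis
  from underdetermined_system[OF L, of "\<lambda>i j. coeff (e j) i"] obtain \<alpha> where
    nz: "\<exists>j<L. \<alpha> j \<noteq> 0" and sol: "\<And>i. i < k + b + 1 \<Longrightarrow> (\<Sum>j<L. coeff (e j) i * \<alpha> j) = 0" by blast
  let ?w = "\<Sum>j<L. fscale (to_fract [:\<alpha> j:]) (u j)"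
  have "(\<Sum>j<L. Polynomial.smult (\<alpha> j) (e j)) = 0"
  proof (rule poly_eqI)
    fix i
    show "coeff (\<Sum>j<L. Polynomial.smult (\<alpha> j) (e j)) i = coeff 0 i"
    proof (cases "i < k + b + 1")
      case True
      then show ?thesis using sol[OF True] by (simp add: coeff_sum mult.commute)
    next
      case False
      have "coeff (e j) i = 0" if "j < L" for j
        using e(2)[OF that] False by (intro coeff_eq_0) simp
      then show ?thesis by (simp add: coeff_sum)
    qed
  qed
  moreover have "eval_form n l ?w = to_fract (\<Sum>j<L. Polynomial.smult (\<alpha> j) (e j))"
  proof -
    have "eval_form n l ?w = (\<Sum>j<L. to_fract [:\<alpha> j:] * eval_form n l (u j))"
      by (simp only: eval_form_sum eval_form_scale)
    also have "\<dots> = (\<Sum>j<L. to_fract ([:\<alpha> j:] * e j))"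
      by (intro sum.cong) (simp_all only: e to_fract_mult lessThan_iff)
    finally show ?thesis by (simp add: to_fract_sum)
  qed
  ultimately have "eval_form n l ?w = 0" by simp
  moreover have "?w \<in> poly_part k N" using N u by (rule poly_part_combination)
  ultimately have "?w \<in> poly_part k (form_kernel n l N)" by (simp add: poly_part_def form_kernel_def)
  with nz show ?thesis by blast
qed

text \<open>The relation between the sequence \<open>R\<close> of a space and the sequence \<open>r\<close> of the kernel in it of a
form with coefficients of degree at most \<open>b\<close> that does not vanish on the space; \<open>a\<close> is the least degree of a polynomial vector outside the kernel.\<close>

definition one_step_relation :: "nat \<Rightarrow> (nat \<Rightarrow> nat) \<Rightarrow> (nat \<Rightarrow> nat) \<Rightarrow> bool" where
  "one_step_relation b R r \<longleftrightarrow>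
     (\<exists>a. (\<forall>k\<le>a. R k = Suc (r k)) \<and> (\<forall>k>a. R k \<le> r k \<and> r k \<le> R k + a + b))"

text \<open>Let \<open>C'\<close> be a basis of the span of the vectors of degree at most \<open>k\<close> in the kernel of the form, and
complete \<open>C'\<close> and \<open>g\<close> to a basis by vectors \<open>v\<^sub>0, \<dots>\<close> of degree at most \<open>k\<close>. If there were
more than \<open>a + b\<close> of these, a combination with constant coefficients of them and of
\<open>g, s g, \<dots>, s\<^bsup>k-a\<^esup> g\<close> would lie in the kernel and hence in the span of \<open>C'\<close>. If a
\<open>v\<^sub>j\<close> occurs in it, this contradicts linear independence; otherwise a nonzero multiple of \<open>g\<close> would lie in
the kernel.\<close>

lemma poly_part_dim_drop_bound:
  fixes N :: "(nat \<Rightarrow> 'a::field poly fract) set"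
  assumes N: "vs.subspace N" "N \<subseteq> coord_space {..<n}"
    and l: "\<And>j. j < n \<Longrightarrow> degree (l j) \<le> b"
    and g: "g \<in> poly_part a N" "eval_form n l g \<noteq> 0" and ak: "a \<le> k"
  shows "vs.dim (poly_part k N) \<le> vs.dim (poly_part k (form_kernel n l N)) + 1 + a + b"
proof -
  let ?N' = "form_kernel n l N"
  let ?P = "poly_part k N" and ?P' = "poly_part k ?N'"
  have J: "finite {..<n}" by simp
  have P'P: "?P' \<subseteq> ?P" by (auto simp: poly_part_def form_kernel_def)
  have gP: "g \<in> ?P" using g(1) poly_part_mono[OF ak, of N] by blast
  have Pc: "?P \<subseteq> coord_space {..<n}" using N(2) poly_part_subset[of k N] by blast
  obtain C' where C': "C' \<subseteq> ?P'" "vs.independent C'" "?P' \<subseteq> vs.span C'" "card C' = vs.dim ?P'" "finite C'"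
    using fdim_basis[OF J order_trans[OF P'P Pc]] by metis
  have "vs.span C' \<subseteq> ?N'"
    by (rule vs.span_minimal[OF order_trans[OF C'(1) poly_part_subset] subspace_form_kernel[OF N(1)]])
  then have g_notin: "g \<notin> vs.span C'" using g(2) by (auto simp: form_kernel_def)
  then have ind: "vs.independent (insert g C')" using C'(2) by (rule vs.independent_insertI)
  have "insert g C' \<subseteq> ?P" using gP C'(1) P'P by blast
  from vs.maximal_independent_subset_extend[OF this ind] obtain C where
    C: "insert g C' \<subseteq> C" "C \<subseteq> ?P" "vs.independent C" "?P \<subseteq> vs.span C" by blast
  have finC: "finite C" using C(2,3) Pc by (intro finite_if_independent_coord_space[OF J]) auto
  have cardC: "card C = vs.dim ?P" using C by (intro vs.basis_card_eq_dim)
  define V where "V = C - insert g C'"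
  define z where "z = card V"
  have "g \<notin> C'" using g_notin vs.span_superset by blast
  then have "card (insert g C') = Suc (vs.dim ?P')" using C' by simp
  then have dims: "vs.dim ?P = z + Suc (vs.dim ?P')"
    using cardC C(1) finC card_mono[OF finC C(1)] by (simp add: z_def V_def card_Diff_subset C'(5))
  have "z \<le> a + b"
  proof (rule ccontr)
    assume "\<not> z \<le> a + b"
    \<comment> \<open>the vectors \<open>v\<^sub>j\<close> and \<open>s\<^sup>i g\<close> outnumber the coefficients of the values of the form\<close>
    then have L: "k + b + 1 < z + (k - a + 1)" using ak by simp
    obtain v where v: "bij_betw v {..<z} V"
      using ex_bij_betw_nat_finite[of V] finC by (auto simp: V_def z_def atLeast0LessThan)
    define u where "u j = (if j < z then v j else fscale (to_fract (monom 1 (j - z))) g)" for j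
    have vP: "v j \<in> ?P" if "j < z" for j
      using v that C(2) by (auto simp: V_def bij_betw_def)
    have uP: "u j \<in> ?P" if j: "j < z + (k - a + 1)" for j
    proof (cases "j < z")
      case False
      obtain p where p: "\<And>i. g i = to_fract (p i)" "\<And>i. degree (p i) \<le> a"
        using g(1) by (auto simp: poly_part_def)
      have "fscale (to_fract (monom 1 (j - z))) g i = to_fract (monom 1 (j - z) * p i)" for i
        by (simp add: p(1))
      moreover have "degree (monom 1 (j - z) * p i) \<le> k" for i
      proof -
        have "degree (monom 1 (j - z) * p i) \<le> degree (monom (1 :: 'a) (j - z)) + degree (p i)"
          by (rule degree_mult_le)
        also have "\<dots> \<le> (j - z) + a" using p(2)[of i] degree_monom_le[of "1 :: 'a" "j - z"] by simp
        also have "\<dots> \<le> k" using j False ak by simp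
        finally show ?thesis .
      qed
      moreover have "fscale (to_fract (monom 1 (j - z))) g \<in> N"
        using vs.subspace_scale[OF N(1)] g(1) poly_part_subset[of a N] by blast
      ultimately have "fscale (to_fract (monom 1 (j - z))) g \<in> ?P" by (intro poly_partI)
      then show ?thesis using False by (simp add: u_def)
    qed (simp add: u_def vP)
    have "\<exists>\<alpha>. (\<exists>j<z + (k - a + 1). \<alpha> j \<noteq> 0)
        \<and> (\<Sum>j<z + (k - a + 1). fscale (to_fract [:\<alpha> j:]) (u j)) \<in> ?P'"
      by (rule combination_in_form_kernel[OF N(1) l uP L])
    then obtain \<alpha> where \<alpha>w: "(\<exists>j<z + (k - a + 1). \<alpha> j \<noteq> 0)
        \<and> (\<Sum>j<z + (k - a + 1). fscale (to_fract [:\<alpha> j:]) (u j)) \<in> ?P'" (is "_ \<and> ?w \<in> _") ..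
    note \<alpha> = conjunct1[OF \<alpha>w] and w = conjunct2[OF \<alpha>w]
    define q where "q = (\<Sum>i<k - a + 1. monom (\<alpha> (z + i)) i)"
    have q_eq: "fscale (to_fract q) g = (\<Sum>i<k - a + 1. fscale (to_fract [:\<alpha> (z + i):]) (u (z + i)))"
    proof
      fix j
      have "to_fract [:\<alpha> (z + i):] * to_fract (monom 1 i) = to_fract (monom (\<alpha> (z + i)) i)" for i
        unfolding to_fract_mult[symmetric] by (simp add: smult_monom)
      then show "fscale (to_fract q) g j
          = (\<Sum>i<k - a + 1. fscale (to_fract [:\<alpha> (z + i):]) (u (z + i))) j"
        unfolding sum_fun_apply
        by (simp add: u_def q_def to_fract_sum sum_distrib_right mult.assoc[symmetric]
            del: sum.lessThan_Suc)
    qed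
    have split: "sum h {..<z + c} = sum h {..<z} + (\<Sum>i<c. h (z + i))"
      for h :: "nat \<Rightarrow> nat \<Rightarrow> 'a poly fract" and c
      by (induction c) (simp_all add: add.assoc)
    have "(\<Sum>j<z. fscale (to_fract [:\<alpha> j:]) (u j)) = (\<Sum>j<z. fscale (to_fract [:\<alpha> j:]) (v j))"
      by (intro sum.cong) (simp_all add: u_def)
    then have w_eq: "?w = (\<Sum>j<z. fscale (to_fract [:\<alpha> j:]) (v j)) + fscale (to_fract q) g"
      unfolding q_eq split by simp
    have w_span: "?w \<in> vs.span C'" using w C'(3) by blast
    show False
    proof (cases "\<exists>j<z. \<alpha> j \<noteq> 0")
      case True
      then obtain j0 where j0: "j0 < z" "\<alpha> j0 \<noteq> 0" by blast
      have v0: "v j0 \<in> V" using v j0 by (auto simp: bij_betw_def)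
      let ?S = "C - {v j0}"
      have S1: "C' \<subseteq> ?S" "g \<in> ?S" using v0 C(1) by (auto simp: V_def)
      have S2: "v j \<in> ?S" if "j < z" "j \<noteq> j0" for j
        using v that j0 by (auto simp: bij_betw_def V_def inj_on_def)
      have "(\<Sum>j<z. fscale (to_fract [:\<alpha> j:]) (v j))
        = fscale (to_fract [:\<alpha> j0:]) (v j0) + (\<Sum>j\<in>{..<z} - {j0}. fscale (to_fract [:\<alpha> j:]) (v j))"
        using j0 by (intro sum.remove) auto
      then have "fscale (to_fract [:\<alpha> j0:]) (v j0)
        = ?w - (\<Sum>j\<in>{..<z} - {j0}. fscale (to_fract [:\<alpha> j:]) (v j)) - fscale (to_fract q) g"
        unfolding w_eq by (simp add: algebra_simps del: fscale_apply)
      moreover have "?w \<in> vs.span ?S" using w_span vs.span_mono[OF S1(1)] by blast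
      moreover have "(\<Sum>j\<in>{..<z} - {j0}. fscale (to_fract [:\<alpha> j:]) (v j)) \<in> vs.span ?S"
        by (intro vs.span_sum vs.span_scale vs.span_base S2) auto
      moreover have "fscale (to_fract q) g \<in> vs.span ?S"
        by (intro vs.span_scale vs.span_base S1)
      ultimately have "fscale (to_fract [:\<alpha> j0:]) (v j0) \<in> vs.span ?S"
        by (simp only: vs.span_diff)
      moreover have "to_fract [:\<alpha> j0:] \<noteq> 0" using j0 by simp
      ultimately have "v j0 \<in> vs.span ?S" by (rule in_span_scaled[rotated])
      then have "vs.dependent C" using v0 unfolding vs.dependent_def by (auto simp: V_def)
      then show False using C(3) by contradiction
    next
      case False
      then have "(\<Sum>j<z. fscale (to_fract [:\<alpha> j:]) (v j)) = (\<Sum>j<z. 0)"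
        by (intro sum.cong) (auto simp: fun_eq_iff)
      then have "?w = fscale (to_fract q) g" unfolding w_eq by simp
      then have "fscale (to_fract q) g \<in> ?N'" using w poly_part_subset[of k ?N'] by auto
      then have "to_fract q * eval_form n l g = 0" by (simp add: form_kernel_def eval_form_scale)
      then have q0: "q = 0" using g(2) by simp
      obtain j where j: "j < z + (k - a + 1)" "\<alpha> j \<noteq> 0" using \<alpha> by blast
      then have jz: "j \<ge> z" using False by (meson not_le)
      have "coeff q (j - z) = \<alpha> j"
        using j jz by (simp add: q_def coeff_sum del: sum.lessThan_Suc)
      then show False using q0 j by simp
    qed
  qed
  with dims show ?thesis by simp
qed

text \<open>Below degree \<open>a\<close> the space and the kernel contain the same polynomial vectors, while their dimensions
differ by one. From degree \<open>a\<close> on, the vector \<open>g\<close> is missing in the kernel, so its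
polynomial part has smaller dimension too.\<close>

theorem brunovsky_seq_form_kernel:
  fixes N :: "(nat \<Rightarrow> 'a::field poly fract) set"
  assumes N: "vs.subspace N" "N \<subseteq> coord_space {..<n}"
    and l: "\<And>j. j < n \<Longrightarrow> degree (l j) \<le> b" and proper: "form_kernel n l N \<noteq> N"
  shows "one_step_relation b (brunovsky_seq N) (brunovsky_seq (form_kernel n l N))"
proof -
  let ?N' = "form_kernel n l N"
  have J: "finite {..<n}" by simp
  have N'N: "?N' \<subseteq> N" by (auto simp: form_kernel_def)
  have N'c: "?N' \<subseteq> coord_space {..<n}" using N'N N(2) by (rule order_trans)
  obtain x where x: "x \<in> N" "eval_form n l x \<noteq> 0" using proper by (auto simp: form_kernel_def)
  obtain d k0 where d: "d \<noteq> 0" "fscale (to_fract d) x \<in> poly_part k0 N"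
    using polynomial_multiple[OF J N x(1)] by blast
  have "eval_form n l (fscale (to_fract d) x) \<noteq> 0" using d(1) x(2) by (simp add: eval_form_scale)
  then have ex: "\<exists>k. \<exists>g\<in>poly_part k N. eval_form n l g \<noteq> 0" using d(2) by blast
  define a where "a = (LEAST k. \<exists>g\<in>poly_part k N. eval_form n l g \<noteq> 0)"
  obtain g where g: "g \<in> poly_part a N" "eval_form n l g \<noteq> 0"
    using LeastI_ex[OF ex] unfolding a_def by blast
  have below: "poly_part k ?N' = poly_part k N" if "k < a" for k
  proof -
    have "\<forall>g\<in>poly_part k N. eval_form n l g = 0"
      using not_less_Least[of k] that unfolding a_def by blast
    then show ?thesis by (auto simp: poly_part_def form_kernel_def)
  qed
  have gN: "g \<in> N" using g(1) poly_part_subset[of a N] by blast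
  have dimN: "vs.dim N = Suc (vs.dim ?N')"
  proof (rule antisym)
    have "x \<in> vs.span (insert g ?N')" if "x \<in> N" for x
    proof -
      let ?c = "eval_form n l x / eval_form n l g"
      have "x + fscale (- ?c) g \<in> N" using that gN vs.subspace_add[OF N(1)] vs.subspace_scale[OF N(1)] by blast
      moreover have "eval_form n l (x + fscale (- ?c) g) = eval_form n l x + - ?c * eval_form n l g"
        by (simp only: eval_form_add eval_form_scale)
      then have "eval_form n l (x + fscale (- ?c) g) = 0" using g(2) by simp
      ultimately have "x + fscale (- ?c) g \<in> ?N'" unfolding form_kernel_def by blast
      then have "x + fscale (- ?c) g \<in> vs.span ?N'" by (rule vs.span_base)
      then have "x - fscale ?c g \<in> vs.span ?N'" by (simp add: vs.scale_minus_left del: fscale_apply)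
      then show ?thesis unfolding vs.span_breakdown_eq by blast
    qed
    then show "vs.dim N \<le> Suc (vs.dim ?N')" by (intro fdim_le_Suc[OF J N'c]) blast
    have "g \<notin> vs.span ?N'"
      using g(2) vs.span_minimal[OF order_refl subspace_form_kernel[OF N(1)], of n l] by (auto simp: form_kernel_def)
    then show "Suc (vs.dim ?N') \<le> vs.dim N" by (rule fdim_less[OF J N(2) N'N gN])
  qed
  have above: "Suc (vs.dim (poly_part k ?N')) \<le> vs.dim (poly_part k N)" if "a \<le> k" for k
  proof (rule fdim_less[OF J])
    show "poly_part k N \<subseteq> coord_space {..<n}" using N(2) poly_part_subset[of k N] by blast
    show "poly_part k ?N' \<subseteq> poly_part k N" by (auto simp: poly_part_def form_kernel_def)
    show "g \<in> poly_part k N" using g(1) poly_part_mono[OF that, of N] by blast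
    have "vs.span (poly_part k ?N') \<subseteq> ?N'"
      using poly_part_subset subspace_form_kernel[OF N(1)] by (rule vs.span_minimal)
    then show "g \<notin> vs.span (poly_part k ?N')" using g(2) by (auto simp: form_kernel_def)
  qed
  show ?thesis unfolding one_step_relation_def
  proof (intro exI[of _ a] conjI allI impI)
    fix k assume "k \<le> a"
    then show "brunovsky_seq N k = Suc (brunovsky_seq ?N' k)"
      using dimN below[of "k - 1"] dim_poly_part_le(1)[OF J N'c, of "k - 1"]
      by (cases k) (simp_all add: brunovsky_seq_def)
  next
    fix k assume k: "a < k"
    then obtain k' where k': "k = Suc k'" "a \<le> k'" by (cases k) auto
    show "brunovsky_seq N k \<le> brunovsky_seq ?N' k"
      using above[OF k'(2)] dimN by (simp add: brunovsky_seq_def k'(1))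
    show "brunovsky_seq ?N' k \<le> brunovsky_seq N k + a + b"
      using poly_part_dim_drop_bound[OF N l g k'(2)] dimN by (simp add: brunovsky_seq_def k'(1))
  qed
qed

section \<open>Inequalities between Brunovsky sequences\<close>

lemma one_step_relationE:
  assumes "one_step_relation b R r" "b \<le> c"
  obtains a where "\<And>k. k \<le> a \<Longrightarrow> R k = Suc (r k)" "\<And>k. a < k \<Longrightarrow> R k \<le> r k"
    "\<And>k. a < k \<Longrightarrow> r k \<le> R k + a + c"
proof -
  obtain a where a: "\<forall>k\<le>a. R k = Suc (r k)" "\<forall>k>a. R k \<le> r k \<and> r k \<le> R k + a + b"
    using assms(1) unfolding one_step_relation_def by blast
  have "r k \<le> R k + a + c" if "a < k" for k
  proof -
    have "r k \<le> R k + a + b" using a(2) that by blast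
    then show ?thesis using assms(2) by simp
  qed
  then show thesis using a by (intro that[of a]) simp_all
qed

text \<open>The diagram of the partition contains a rectangle with sides \<open>k\<close> and \<open>x\<close>.\<close>

lemma psize_ge:
  assumes anti: "antimono r" and fin: "finite {i. r i \<noteq> 0}" and x: "x \<le> r k"
  shows "k * x \<le> psize r"
proof -
  have r: "x \<le> r i" if "i \<le> k" for i
    using x antimonoD[OF anti that] by simp
  have "finite {i. 1 \<le> i \<and> r i \<noteq> 0}" using fin by (rule finite_subset[rotated]) auto
  have "(\<Sum>i\<in>{1..k}. r i) = (\<Sum>i\<in>{1..k} \<inter> {i. 1 \<le> i \<and> r i \<noteq> 0}. r i)"
    by (rule sum.mono_neutral_right) auto
  also have "\<dots> \<le> psize r" unfolding psize_def
    using \<open>finite {i. 1 \<le> i \<and> r i \<noteq> 0}\<close> by (intro sum_mono2) auto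
  finally have "(\<Sum>i\<in>{1..k}. r i) \<le> psize r" .
  moreover have "k * x \<le> (\<Sum>i\<in>{1..k}. r i)"
    using sum_bounded_below[of "{1..k}" x r] r by simp
  ultimately show "k * x \<le> psize r" by simp
qed

lemma le_floor_sqrt:
  assumes "x * x \<le> (n::nat)"
  shows "int x \<le> \<lfloor>sqrt (real n)\<rfloor>"
proof -
  have "(real x)\<^sup>2 \<le> real n" using assms by (simp add: power2_eq_square flip: of_nat_mult)
  then have "real x \<le> sqrt (real n)" by (rule real_le_rsqrt)
  then show ?thesis by (simp add: le_floor_iff)
qed

lemma le_floor_sqrt_pred:
  assumes "x * x + 1 \<le> (n::nat)"
  shows "int x \<le> \<lfloor>sqrt (real n - 1)\<rfloor>"
  using le_floor_sqrt[of x "n - 1"] assms by (simp add: of_nat_diff)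

definition brunovsky_bounds :: "(nat \<Rightarrow> nat) \<Rightarrow> (nat \<Rightarrow> nat) \<Rightarrow> bool" where
  "brunovsky_bounds r r' \<longleftrightarrow>
     (zero_partition r \<longrightarrow> (\<forall>i\<ge>0.
          min (1 - \<lfloor>sqrt (real (psize_star r) + 1)\<rfloor>) (- 1) \<le> int (r' i) - int (r i)
        \<and> int (r' i) - int (r i) \<le> max 2 (- 1 + \<lfloor>sqrt (real (psize_star r))\<rfloor>))) \<and>
     (\<not> zero_partition r \<longrightarrow> (\<forall>i\<ge>0.
          min (- \<lfloor>sqrt (real (psize_star r))\<rfloor>) (- 1 - \<lfloor>sqrt (real (psize r))\<rfloor>) \<le> int (r' i) - int (r i)
        \<and> int (r' i) - int (r i) \<le>
            max (2 + \<lfloor>sqrt (real (psize r) - 1)\<rfloor>) \<lfloor>sqrt (real (psize_star r))\<rfloor>))"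

text \<open>A decrease by \<open>y + 1\<close> comes with a square of side \<open>y\<close> in the diagram of \<open>r\<close>, and an increase by
\<open>t + 2\<close> with a rectangle with sides \<open>t\<close> and \<open>t + 2\<close>, which has at least \<open>t\<^sup>2 + 1\<close> cells if
\<open>t \<ge> 1\<close>. For the zero partition no such square or rectangle exists unless \<open>y = 0\<close> or \<open>t = 0\<close>. The index
\<open>k\<close> may be 0 in the second hypothesis only: then it allows an increase by 2 at most.\<close>

lemma brunovsky_boundsI:
  assumes anti: "antimono r" and fin: "finite {i. r i \<noteq> 0}"
    and drop: "\<And>i. r i \<le> r' i + 1 \<or> (\<exists>k\<ge>1. r i \<le> r' i + k + 1 \<and> r i \<le> r' i + r k + 1)"
    and rise: "\<And>i. r' i \<le> r i + 2 \<or> (\<exists>k. r' i \<le> r i + k + 2 \<and> r' i \<le> r i + r k)"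
  shows "brunovsky_bounds r r'"
proof -
  note size = psize_ge[OF anti fin]
  have drop_bound: "int (r i) - int (r' i) \<le> 1 + \<lfloor>sqrt (real (psize r))\<rfloor>" for i
  proof (cases "r i \<le> r' i + 1")
    case True
    have "0 \<le> \<lfloor>sqrt (real (psize r))\<rfloor>" by simp
    then show ?thesis using True by linarith
  next
    case False
    then obtain k where k: "r i \<le> r' i + k + 1" "r i \<le> r' i + r k + 1" using drop[of i] by blast
    define y where "y = r i - r' i - 1"
    have "y * y \<le> k * y" using k by (intro mult_right_mono) (auto simp: y_def)
    also have "\<dots> \<le> psize r" using k by (intro size) (auto simp: y_def)
    finally have "int y \<le> \<lfloor>sqrt (real (psize r))\<rfloor>" by (rule le_floor_sqrt)
    then show ?thesis using False by (simp add: y_def)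
  qed
  have rise_bound: "int (r' i) - int (r i) \<le> 2 + \<lfloor>sqrt (real (psize r) - 1)\<rfloor>"
    if nz: "\<not> zero_partition r" for i
  proof (cases "r' i \<le> r i + 2")
    case True
    obtain j where "1 \<le> j" "1 \<le> r j" using nz by (auto simp: zero_partition_def Suc_le_eq)
    then have "1 \<le> psize r" using size[of 1 j] by simp
    then have "int 0 \<le> \<lfloor>sqrt (real (psize r) - 1)\<rfloor>" by (intro le_floor_sqrt_pred) simp
    then show ?thesis using True by linarith
  next
    case False
    then obtain k where k: "r' i \<le> r i + k + 2" "r' i \<le> r i + r k" using rise[of i] by blast
    define t where "t = r' i - r i - 2"
    have t: "1 \<le> t" "t \<le> k" "t + 2 \<le> r k" "int (r' i) - int (r i) = int t + 2"
      using k False by (auto simp: t_def)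
    have "t * t + 1 \<le> t * (t + 2)" using t(1) by simp
    also have "\<dots> \<le> k * (t + 2)" using t(2) by (intro mult_right_mono) auto
    also have "\<dots> \<le> psize r" using t(3) by (rule size)
    finally have "int t \<le> \<lfloor>sqrt (real (psize r) - 1)\<rfloor>" by (rule le_floor_sqrt_pred)
    then show ?thesis using t(4) by simp
  qed
  show ?thesis unfolding brunovsky_bounds_def
  proof (intro conjI impI allI)
    fix i assume "zero_partition r"
    then have r0: "r k = 0" if "1 \<le> k" for k using that by (simp add: zero_partition_def)
    have "r i \<le> r' i + 1" using drop[of i] r0 by auto
    then show "min (1 - \<lfloor>sqrt (real (psize_star r) + 1)\<rfloor>) (- 1) \<le> int (r' i) - int (r i)" by linarith
    have "r' i \<le> r i + 2"
    proof (rule ccontr)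
      assume no: "\<not> r' i \<le> r i + 2"
      then obtain k where "r' i \<le> r i + k + 2" "r' i \<le> r i + r k" using rise[of i] by blast
      then show False using no r0[of k] by (cases k) auto
    qed
    then show "int (r' i) - int (r i) \<le> max 2 (- 1 + \<lfloor>sqrt (real (psize_star r))\<rfloor>)" by linarith
  next
    fix i assume nz: "\<not> zero_partition r"
    show "min (- \<lfloor>sqrt (real (psize_star r))\<rfloor>) (- 1 - \<lfloor>sqrt (real (psize r))\<rfloor>) \<le> int (r' i) - int (r i)"
      using drop_bound[of i] by linarith
    show "int (r' i) - int (r i) \<le>
        max (2 + \<lfloor>sqrt (real (psize r) - 1)\<rfloor>) \<lfloor>sqrt (real (psize_star r))\<rfloor>"
      using rise_bound[OF nz, of i] by linarith
  qed
qed

lemma brunovsky_bounds_refl: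
  assumes "antimono r" "finite {i. r i \<noteq> 0}"
  shows "brunovsky_bounds r r"
  using assms by (rule brunovsky_boundsI) simp_all

text \<open>An increase occurs only at some \<open>i > a\<close>, and then \<open>r a = r' a + 1 > r' i\<close>; so the entries of
\<open>r\<close> of index at most \<open>a\<close> all exceed the increase, which is at most \<open>a + 1\<close>.\<close>

lemma brunovsky_bounds_one_step:
  assumes "antimono r" "finite {i. r i \<noteq> 0}" "antimono r'" "one_step_relation b r r'" "b \<le> 1"
  shows "brunovsky_bounds r r'"
proof (rule brunovsky_boundsI[OF assms(1,2)])
  obtain a where a: "\<And>k. k \<le> a \<Longrightarrow> r k = Suc (r' k)" "\<And>k. a < k \<Longrightarrow> r k \<le> r' k"
    "\<And>k. a < k \<Longrightarrow> r' k \<le> r k + a + 1"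
    using one_step_relationE[OF assms(4,5)] by metis
  fix i
  show "r i \<le> r' i + 1 \<or> (\<exists>k\<ge>1. r i \<le> r' i + k + 1 \<and> r i \<le> r' i + r k + 1)"
    using a(1,2)[of i] by (cases "i \<le> a") auto
  show "r' i \<le> r i + 2 \<or> (\<exists>k. r' i \<le> r i + k + 2 \<and> r' i \<le> r i + r k)"
  proof (cases "i \<le> a")
    case False
    then have "r' i \<le> r' a" using antimonoD[OF assms(3), of a i] by simp
    then show ?thesis using a(1)[of a] a(3)[of i] False by (intro disjI2 exI[of _ a]) auto
  qed (use a(1)[of i] in simp)
qed

text \<open>At \<open>i \<le> a\<close> there is an increase by one. A decrease at \<open>i > a\<close> is at most
\<open>a + 1 \<le> i\<close> and at most \<open>r i\<close>.\<close>

lemma brunovsky_bounds_one_step_converse: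
  assumes "antimono r" "finite {i. r i \<noteq> 0}" "one_step_relation b r' r" "b \<le> 1"
  shows "brunovsky_bounds r r'"
proof (rule brunovsky_boundsI[OF assms(1,2)])
  obtain a where a: "\<And>k. k \<le> a \<Longrightarrow> r' k = Suc (r k)" "\<And>k. a < k \<Longrightarrow> r' k \<le> r k"
    "\<And>k. a < k \<Longrightarrow> r k \<le> r' k + a + 1"
    using one_step_relationE[OF assms(3,4)] by metis
  fix i
  show "r i \<le> r' i + 1 \<or> (\<exists>k\<ge>1. r i \<le> r' i + k + 1 \<and> r i \<le> r' i + r k + 1)"
  proof (cases "i \<le> a")
    case False
    then show ?thesis using a(3)[of i] by (intro disjI2 exI[of _ i]) auto
  qed (use a(1)[of i] in simp)
  show "r' i \<le> r i + 2 \<or> (\<exists>k. r' i \<le> r i + k + 2 \<and> r' i \<le> r i + r k)"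
    using a(1,2)[of i] by (cases "i \<le> a") auto
qed

text \<open>The change at \<open>i\<close> is the difference of the changes of the two steps. It is large and negative only if
\<open>r i\<close> is large and \<open>i > a\<close>. It is large and positive only if \<open>r' i\<close>
exceeds \<open>g i\<close> by much and \<open>i > a'\<close>; then \<open>r a'\<close>, which is at least \<open>r' a' = g a' - 1\<close>, is large too.\<close>

lemma brunovsky_bounds_common_superspace:
  assumes "antimono r" "finite {i. r i \<noteq> 0}" "antimono r'" "one_step_relation 1 g r" "one_step_relation 1 g r'"
  shows "brunovsky_bounds r r'"
proof (rule brunovsky_boundsI[OF assms(1,2)])
  obtain a where a: "\<And>k. k \<le> a \<Longrightarrow> g k = Suc (r k)" "\<And>k. a < k \<Longrightarrow> g k \<le> r k"
    "\<And>k. a < k \<Longrightarrow> r k \<le> g k + a + 1"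
    using one_step_relationE[OF assms(4) order_refl] by metis
  obtain a' where a': "\<And>k. k \<le> a' \<Longrightarrow> g k = Suc (r' k)" "\<And>k. a' < k \<Longrightarrow> g k \<le> r' k"
    "\<And>k. a' < k \<Longrightarrow> r' k \<le> g k + a' + 1"
    using one_step_relationE[OF assms(5) order_refl] by metis
  fix i
  show "r i \<le> r' i + 1 \<or> (\<exists>k\<ge>1. r i \<le> r' i + k + 1 \<and> r i \<le> r' i + r k + 1)"
  proof (cases "i \<le> a")
    case True
    then show ?thesis using a(1)[of i] a'(1,2)[of i] by (cases "i \<le> a'") auto
  next
    case False
    then show ?thesis using a(3)[of i] a'(1,2)[of i]
      by (cases "i \<le> a'") (intro disjI2 exI[of _ i]; auto)+
  qed
  show "r' i \<le> r i + 2 \<or> (\<exists>k. r' i \<le> r i + k + 2 \<and> r' i \<le> r i + r k)"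
  proof (cases "i \<le> a'")
    case True
    then show ?thesis using a'(1)[of i] a(1,2)[of i] by (cases "i \<le> a") auto
  next
    case i: False
    then have le: "r' i \<le> r' a'" using antimonoD[OF assms(3), of a' i] by simp
    have ga': "g a' = Suc (r' a')" using a'(1) by simp
    show ?thesis
    proof (cases "i \<le> a")
      case True
      then have "g i = Suc (r i)" "g a' = Suc (r a')" using a(1) i by auto
      then show ?thesis using le ga' a'(3)[of i] i by (intro disjI2 exI[of _ a']) auto
    next
      case False
      have "r' a' \<le> r a'" using ga' a(1,2)[of a'] by (cases "a' \<le> a") auto
      then show ?thesis using le a'(3)[of i] a(2)[of i] i False by (intro disjI2 exI[of _ a']) auto
    qed
  qed
qed

text \<open>Here the first step lowers the sequence up to \<open>a\<close> and raises it afterwards, and the second step is traversed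
backwards. A large increase at \<open>i\<close> comes from the first step and forces \<open>r a = g a + 1\<close> to be
large; a large decrease comes from the second step, which requires \<open>i > a'\<close> and a large \<open>r i\<close>.\<close>

lemma brunovsky_bounds_common_subspace:
  assumes "antimono r" "finite {i. r i \<noteq> 0}" "antimono g" "one_step_relation 0 r g" "one_step_relation 0 r' g"
  shows "brunovsky_bounds r r'"
proof (rule brunovsky_boundsI[OF assms(1,2)])
  obtain a where a: "\<And>k. k \<le> a \<Longrightarrow> r k = Suc (g k)" "\<And>k. a < k \<Longrightarrow> r k \<le> g k"
    "\<And>k. a < k \<Longrightarrow> g k \<le> r k + a + 0"
    using one_step_relationE[OF assms(4) order_refl] by metis
  obtain a' where a': "\<And>k. k \<le> a' \<Longrightarrow> r' k = Suc (g k)" "\<And>k. a' < k \<Longrightarrow> r' k \<le> g k"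
    "\<And>k. a' < k \<Longrightarrow> g k \<le> r' k + a' + 0"
    using one_step_relationE[OF assms(5) order_refl] by metis
  fix i
  show "r i \<le> r' i + 1 \<or> (\<exists>k\<ge>1. r i \<le> r' i + k + 1 \<and> r i \<le> r' i + r k + 1)"
  proof (cases "i \<le> a'")
    case True
    then show ?thesis using a'(1)[of i] a(1,2)[of i] by (cases "i \<le> a") auto
  next
    case False
    then show ?thesis using a'(3)[of i] a(1,2)[of i]
      by (cases "i \<le> a") (intro disjI2 exI[of _ i]; auto)+
  qed
  show "r' i \<le> r i + 2 \<or> (\<exists>k. r' i \<le> r i + k + 2 \<and> r' i \<le> r i + r k)"
  proof (cases "i \<le> a")
    case True
    then show ?thesis using a(1)[of i] a'(1,2)[of i] by (cases "i \<le> a'") auto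
  next
    case False
    then have "g i \<le> g a" using antimonoD[OF assms(3), of a i] by simp
    then show ?thesis using a(1)[of a] a(3)[of i] a'(1,2)[of i] False
      by (cases "i \<le> a'") (intro disjI2 exI[of _ a]; auto)+
  qed
qed

section \<open>Pencils of rank one\<close>

lemma fminor_1: "fminor A (Suc 0) f g = A (f 0) (g 0)"
  by (subst fminor_expand_row[of 0]) simp_all

lemma fminor_2: "fminor A (Suc (Suc 0)) f g = A (f 0) (g 0) * A (f 1) (g 1) - A (f 0) (g 1) * A (f 1) (g 0)"
  by (subst fminor_expand_row[of 0]) (simp_all add: fminor_1 insert_index_def)

lemma normal_rank_one:
  assumes A: "A \<in> carrier_mat m n" and rank: "normal_rank A = 1"
  shows "\<exists>i<m. \<exists>j<n. A $$ (i, j) \<noteq> 0"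
    and "\<lbrakk>i < m; k < m; j < n; l < n\<rbrakk> \<Longrightarrow> A $$ (i, j) * A $$ (k, l) = A $$ (i, l) * A $$ (k, j)"
proof -
  let ?K = "{k. \<exists>x\<in>minors k A. x \<noteq> 0}"
  have "?K \<subseteq> {..m}"
  proof
    fix k assume "k \<in> ?K"
    then obtain I where "I \<subseteq> {..<m}" "card I = k" using A by (auto simp: minors_def)
    then have "k \<le> card {..<m}" using card_mono[of "{..<m}" I] by simp
    then show "k \<in> {..m}" by simp
  qed
  then have fin: "finite ?K" by (rule finite_subset) simp
  have "submatrix A {} {} \<in> carrier_mat 0 0" by (simp add: submatrix_def)
  then have "det (submatrix A {} {}) = 1" by (rule det_dim_zero)
  moreover have "det (submatrix A {} {}) \<in> minors 0 A"
    unfolding minors_def by (intro CollectI exI[of _ "{}"]) simp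
  ultimately have "0 \<in> ?K" by (auto intro: bexI[of _ "1 :: 'a poly"])
  then have "Max ?K \<in> ?K" using fin by (intro Max_in) auto
  then have "\<exists>x\<in>minors 1 A. x \<noteq> 0" using rank by (simp add: normal_rank_def)
  then have "\<not> dvd_minors 0 1 (\<lambda>i j. A $$ (i, j)) {..<m} {..<n}"
    unfolding dvd_minors_iff_minors[OF A] by auto
  then obtain f g where "f ` {..<1} \<subseteq> {..<m}" "g ` {..<1} \<subseteq> {..<n}"
      "\<not> 0 dvd fminor (\<lambda>i j. A $$ (i, j)) 1 f g" unfolding dvd_minors_def by blast
  then have "f 0 < m" "g 0 < n" "A $$ (f 0, g 0) \<noteq> 0"
    by (simp_all add: fminor_1 image_subset_iff)
  then show "\<exists>i<m. \<exists>j<n. A $$ (i, j) \<noteq> 0" by blast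
  have "2 \<notin> ?K"
  proof
    assume "2 \<in> ?K"
    then have "2 \<le> Max ?K" using fin by (intro Max_ge)
    then show False using rank by (simp add: normal_rank_def)
  qed
  then have "dvd_minors 0 2 (\<lambda>i j. A $$ (i, j)) {..<m} {..<n}"
    unfolding dvd_minors_iff_minors[OF A] by auto
  moreover assume ijkl: "i < m" "k < m" "j < n" "l < n"
  then have "case_nat i (\<lambda>_. k) ` {..<2} \<subseteq> {..<m}" "case_nat j (\<lambda>_. l) ` {..<2} \<subseteq> {..<n}"
    by (auto split: nat.splits)
  ultimately have "0 dvd fminor (\<lambda>i j. A $$ (i, j)) 2 (case_nat i (\<lambda>_. k)) (case_nat j (\<lambda>_. l))"
    unfolding dvd_minors_def by blast
  then show "A $$ (i, j) * A $$ (k, l) = A $$ (i, l) * A $$ (k, j)"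
    by (simp add: numeral_2_eq_2 fminor_2)
qed

lemma poly_degree_1_eqI:
  assumes "degree p \<le> 1" "degree q \<le> 1" "coeff p 0 = coeff q 0" "coeff p 1 = coeff q 1"
  shows "p = q"
proof (rule poly_eqI)
  fix k
  show "coeff p k = coeff q k"
  proof (cases "k \<le> 1")
    case True
    then have "k = 0 \<or> k = 1" by linarith
    then show ?thesis using assms(3,4) by blast
  next
    case False
    then show ?thesis using assms(1,2) by (simp add: coeff_eq_0)
  qed
qed

text \<open>Suppose first that some column contains two entries that are linearly independent over the ground field.
These span all polynomials of degree at most one, so a combination of them is 1. Taking this column for \<open>u\<close>
and the same combination of the two rows for \<open>v\<close> gives the factorization; \<open>v\<close> is constant because \<open>u\<close>
has an entry of degree one. Otherwise the entries of any nonzero column are constant multiples of one of them, and the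
row of that entry serves as \<open>v\<close>.\<close>

lemma rank_one_pencil_factorization:
  assumes P: "P \<in> pencil m n" and rank: "normal_rank P = 1"
  obtains u v where "\<And>i j. i < m \<Longrightarrow> j < n \<Longrightarrow> P $$ (i, j) = u i * v j"
    and "((\<forall>i<m. degree (u i) = 0) \<and> (\<forall>j<n. degree (v j) \<le> 1)) \<or>
         ((\<forall>i<m. degree (u i) \<le> 1) \<and> (\<forall>j<n. degree (v j) = 0))"
proof -
  have carrier: "P \<in> carrier_mat m n" and deg: "\<And>i j. i < m \<Longrightarrow> j < n \<Longrightarrow> degree (P $$ (i, j)) \<le> 1"
    using P by (auto simp: pencil_def)
  note minor = normal_rank_one(2)[OF carrier rank]
  obtain i0 j0 where ij0: "i0 < m" "j0 < n" and nz: "P $$ (i0, j0) \<noteq> 0"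
    using normal_rank_one(1)[OF carrier rank] by blast
  define D where "D i k j = coeff (P $$ (i, j)) 0 * coeff (P $$ (k, j)) 1
      - coeff (P $$ (i, j)) 1 * coeff (P $$ (k, j)) 0" for i k j
  show thesis
  proof (cases "\<exists>i<m. \<exists>k<m. \<exists>j<n. D i k j \<noteq> 0")
    case True
    then obtain i k j where ikj: "i < m" "k < m" "j < n" and D: "D i k j \<noteq> 0" by blast
    define \<alpha> \<beta> where "\<alpha> = [:coeff (P $$ (k, j)) 1 / D i k j:]" and "\<beta> = [:- coeff (P $$ (i, j)) 1 / D i k j:]"
    have one: "\<alpha> * P $$ (i, j) + \<beta> * P $$ (k, j) = 1"
    proof (rule poly_degree_1_eqI)
      have "degree (\<alpha> * P $$ (i, j)) \<le> 1" "degree (\<beta> * P $$ (k, j)) \<le> 1"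
        using deg ikj order_trans[OF degree_smult_le] by (simp_all add: \<alpha>_def \<beta>_def)
      then show "degree (\<alpha> * P $$ (i, j) + \<beta> * P $$ (k, j)) \<le> 1" by (rule degree_add_le)
      have "coeff (\<alpha> * P $$ (i, j) + \<beta> * P $$ (k, j)) 0
          = (coeff (P $$ (i, j)) 0 * coeff (P $$ (k, j)) 1
            - coeff (P $$ (i, j)) 1 * coeff (P $$ (k, j)) 0) / D i k j"
        by (simp add: \<alpha>_def \<beta>_def diff_divide_distrib mult.commute)
      also have "\<dots> = D i k j / D i k j" by (simp only: D_def)
      finally show "coeff (\<alpha> * P $$ (i, j) + \<beta> * P $$ (k, j)) 0 = coeff 1 0" using D by simp
      show "coeff (\<alpha> * P $$ (i, j) + \<beta> * P $$ (k, j)) 1 = coeff 1 1"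
        by (simp add: \<alpha>_def \<beta>_def mult.commute)
    qed simp
    define u where "u r = P $$ (r, j)" for r
    define v where "v l = \<alpha> * P $$ (i, l) + \<beta> * P $$ (k, l)" for l
    have fact: "P $$ (r, l) = u r * v l" if "r < m" "l < n" for r l
    proof -
      have "P $$ (r, l) = (\<alpha> * P $$ (i, j) + \<beta> * P $$ (k, j)) * P $$ (r, l)" using one by simp
      also have "\<dots> = \<alpha> * (P $$ (r, l) * P $$ (i, j)) + \<beta> * (P $$ (r, l) * P $$ (k, j))"
        by (simp add: algebra_simps)
      also have "\<dots> = \<alpha> * (P $$ (r, j) * P $$ (i, l)) + \<beta> * (P $$ (r, j) * P $$ (k, l))"
        using minor[of r i l j] minor[of r k l j] that ikj by simp
      also have "\<dots> = u r * v l" by (simp add: u_def v_def algebra_simps)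
      finally show ?thesis .
    qed
    have "coeff (P $$ (i, j)) 1 \<noteq> 0 \<or> coeff (P $$ (k, j)) 1 \<noteq> 0" using D by (auto simp: D_def)
    then obtain r where r: "r < m" "coeff (u r) 1 \<noteq> 0" using ikj by (auto simp: u_def)
    then have ur: "1 \<le> degree (u r)" "u r \<noteq> 0" by (auto intro: le_degree)
    have "degree (v l) = 0" if l: "l < n" for l
    proof (cases "v l = 0")
      case False
      then have "degree (u r * v l) = degree (u r) + degree (v l)" using ur by (intro degree_mult_eq)
      then show ?thesis using deg[OF r(1) l] ur unfolding fact[OF r(1) l] by simp
    qed simp
    moreover have "degree (u r) \<le> 1" if "r < m" for r using deg that ikj by (simp add: u_def)
    ultimately show thesis using fact by (intro that[of u v]) auto
  next
    case False
    then have D: "D i k j = 0" if "i < m" "k < m" "j < n" for i k j using that by blast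
    let ?p = "P $$ (i0, j0)"
    obtain e where e: "e \<le> 1" "coeff ?p e \<noteq> 0"
      using leading_coeff_neq_0[OF nz] deg[OF ij0] by blast
    define u where "u i = [:coeff (P $$ (i, j0)) e / coeff ?p e:]" for i
    have scaled: "P $$ (i, j0) = u i * ?p" if i: "i < m" for i
    proof (rule poly_degree_1_eqI)
      show "degree (u i * ?p) \<le> 1" using deg[OF ij0] order_trans[OF degree_smult_le] by (simp add: u_def)
      have "e = 0 \<or> e = 1" using e by linarith
      then have "coeff (P $$ (i, j0)) 0 * coeff ?p e = coeff (P $$ (i, j0)) e * coeff ?p 0 \<and>
          coeff (P $$ (i, j0)) 1 * coeff ?p e = coeff (P $$ (i, j0)) e * coeff ?p 1"
        using D[OF i ij0] by (auto simp: D_def)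
      then show "coeff (P $$ (i, j0)) 0 = coeff (u i * ?p) 0" "coeff (P $$ (i, j0)) 1 = coeff (u i * ?p) 1"
        using e(2) by (simp_all add: u_def field_simps)
    qed (use deg i ij0 in auto)
    define v where "v l = P $$ (i0, l)" for l
    have "P $$ (r, l) = u r * v l" if "r < m" "l < n" for r l
    proof -
      have "P $$ (r, l) * ?p = P $$ (r, j0) * P $$ (i0, l)"
        by (rule minor[OF that(1) ij0(1) that(2) ij0(2)])
      also have "\<dots> = u r * v l * ?p"
        unfolding scaled[OF that(1)] v_def by (simp only: ac_simps)
      finally have "P $$ (r, l) * ?p = u r * v l * ?p" .
      then show ?thesis using nz by simp
    qed
    moreover have "degree (u i) = 0" for i by (simp add: u_def)
    moreover have "degree (v l) \<le> 1" if "l < n" for l using deg[OF ij0(1) that] by (simp only: v_def)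
    ultimately show thesis by (intro that[of u v]) simp_all
  qed
qed

section \<open>Perturbation by a pencil of rank one\<close>

lemma field_sol_iff:
  "x \<in> fld.res_sol 0 (\<lambda>i j. to_fract (A i j)) {..<m} {..<n} \<longleftrightarrow>
    x \<in> coord_space {..<n} \<and> (\<forall>i<m. eval_form n (A i) x = 0)"
  by (auto simp: fld.res_sol_def fld.sol_def eval_form_def)

lemma eval_form_comb:
  "eval_form n (\<lambda>j. c * l j + d * k j) x = to_fract c * eval_form n l x + to_fract d * eval_form n k x"
  by (simp add: eval_form_def sum_distrib_left algebra_simps sum.distrib)

lemma eval_form_cong: "(\<And>j. j < n \<Longrightarrow> l j = k j) \<Longrightarrow> eval_form n l x = eval_form n k x"
  unfolding eval_form_def by (intro sum.cong) auto

lemma finite_support_brunovsky_seq: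
  assumes J: "finite J" and N: "vs.subspace N" "N \<subseteq> coord_space J"
  shows "finite {i. brunovsky_seq N i \<noteq> 0}"
proof -
  obtain D where D: "N \<subseteq> vs.span (poly_part D N)" using span_poly_part[OF J N] by blast
  have "vs.dim N \<le> vs.dim (poly_part D N)"
    using order_trans[OF poly_part_subset N(2)] by (intro fdim_mono[OF J _ D])
  then have "brunovsky_seq N (Suc D) = 0" by (simp add: brunovsky_seq_def)
  then have zero: "brunovsky_seq N i = 0" if "Suc D \<le> i" for i
    using antimonoD[OF antimono_brunovsky_seq[OF J N(2)] that] by simp
  have "i \<le> D" if "brunovsky_seq N i \<noteq> 0" for i
  proof -
    have "\<not> Suc D \<le> i" using zero[of i] that by (rule contrapos_nn[rotated])
    then show ?thesis by simp
  qed
  then have "{i. brunovsky_seq N i \<noteq> 0} \<subseteq> {..D}" by blast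
  then show ?thesis by (rule finite_subset) simp
qed

locale rank_one_update =
  fixes H P :: "'a::alg_closed_field poly mat" and m n :: nat and u v :: "nat \<Rightarrow> 'a poly"
  assumes H: "H \<in> pencil m n" and P: "P \<in> pencil m n"
    and fact: "i < m \<Longrightarrow> j < n \<Longrightarrow> P $$ (i, j) = u i * v j"
    and degrees: "((\<forall>i<m. degree (u i) = 0) \<and> (\<forall>j<n. degree (v j) \<le> 1)) \<or>
         ((\<forall>i<m. degree (u i) \<le> 1) \<and> (\<forall>j<n. degree (v j) = 0))"
begin

abbreviation "H' \<equiv> H + P"

lemma dims: "dim_row H = m" "dim_col H = n" "dim_row P = m" "dim_col P = n"
    "dim_row H' = m" "dim_col H' = n"
  using H P by (auto simp: pencil_def)

lemma index: "i < m \<Longrightarrow> j < n \<Longrightarrow> H' $$ (i, j) = H $$ (i, j) + u i * v j"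
  using dims fact[of i j] by (simp add: index_add_mat)

lemma H': "H' \<in> pencil m n"
  using H P by (auto simp: pencil_def simp del: One_nat_def intro!: degree_add_le)

lemma rank_bounds: "normal_rank H' \<le> normal_rank H + 1" "normal_rank H \<le> normal_rank H' + 1"
proof -
  have "vs.dim (null_space H) \<le> Suc (vs.dim (null_space H'))"
    unfolding dims
    by (rule fld.dim_res_sol_rank_one[where u = "\<lambda>i. to_fract (u i)" and v = "\<lambda>j. to_fract (v j)"])
      (simp_all add: index)
  moreover have "vs.dim (null_space H') \<le> Suc (vs.dim (null_space H))"
    unfolding dims
    by (rule fld.dim_res_sol_rank_one[where u = "\<lambda>i. - to_fract (u i)" and v = "\<lambda>j. to_fract (v j)"])
      (simp_all add: index)
  ultimately show "normal_rank H' \<le> normal_rank H + 1" "normal_rank H \<le> normal_rank H' + 1"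
    using normal_rank_nullity[of H] normal_rank_nullity[of H'] dims by linarith+
qed

text \<open>A constant factor is homogenized in degree 0 and the other factor in degree 1.\<close>

lemma localization_rank_one:
  "\<exists>U V. \<forall>i<m. \<forall>j<n. localization H' \<mu> i j = localization H \<mu> i j + U i * V j"
proof -
  interpret loc: comm_ring_hom "localize \<mu>" by (rule localize_hom)
  have "\<exists>U V. \<forall>i<m. \<forall>j<n. hom_poly 1 (u i * v j) = U i * V j"
    using degrees
  proof
    assume d: "(\<forall>i<m. degree (u i) = 0) \<and> (\<forall>j<n. degree (v j) \<le> 1)"
    have eq: "hom_poly 1 (u i * v j) = hom_poly 0 (u i) * hom_poly 1 (v j)" if "i < m" "j < n" for i j
    proof -
      have "hom_poly (Suc 0) (v j * u i) = hom_poly 1 (v j) * hom_poly 0 (u i)"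
        by (rule hom_poly_mult) (use d that in auto)
      then show ?thesis by (simp only: One_nat_def mult.commute)
    qed
    show ?thesis
      by (intro exI[of _ "\<lambda>i. hom_poly 0 (u i)"] exI[of _ "\<lambda>j. hom_poly 1 (v j)"] allI impI)
        (erule (1) eq)
  next
    assume d: "(\<forall>i<m. degree (u i) \<le> 1) \<and> (\<forall>j<n. degree (v j) = 0)"
    have eq: "hom_poly 1 (u i * v j) = hom_poly 1 (u i) * hom_poly 0 (v j)" if "i < m" "j < n" for i j
    proof -
      have "hom_poly (Suc 0) (u i * v j) = hom_poly 1 (u i) * hom_poly 0 (v j)"
        by (rule hom_poly_mult) (use d that in auto)
      then show ?thesis by (simp only: One_nat_def)
    qed
    show ?thesis
      by (intro exI[of _ "\<lambda>i. hom_poly 1 (u i)"] exI[of _ "\<lambda>j. hom_poly 0 (v j)"] allI impI)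
        (erule (1) eq)
  qed
  then obtain U V where UV: "\<forall>i<m. \<forall>j<n. hom_poly 1 (u i * v j) = U i * V j" by blast
  have eq: "localization H' \<mu> i j = localization H \<mu> i j + localize \<mu> (U i) * localize \<mu> (V j)"
    if "i < m" "j < n" for i j
    unfolding localization_def[OF H] localization_def[OF H'] homogenize_index[OF H that] homogenize_index[OF H' that] index[OF that]
      hom_poly_add loc.hom_add UV[rule_format, OF that] loc.hom_mult ..
  show ?thesis
    by (intro exI[of _ "\<lambda>i. localize \<mu> (U i)"] exI[of _ "\<lambda>j. localize \<mu> (V j)"] allI impI)
      (erule (1) eq)
qed

lemma weyr_regular_bounds:
  assumes "j \<ge> 1"
  shows "weyr_regular H' \<mu> j \<le> weyr_regular H \<mu> j + 2" "weyr_regular H \<mu> j \<le> weyr_regular H' \<mu> j + 2"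
proof -
  let ?S = "\<lambda>H. ps.res_sol (fps_X ^ j) (localization H \<mu>) {..<m} {..<n}"
  obtain U V where UV: "\<forall>i<m. \<forall>j<n. localization H' \<mu> i j = localization H \<mu> i j + U i * V j"
    using localization_rank_one by blast
  have "vs.dim (?S H) \<le> Suc (vs.dim (?S H'))"
    using UV by (intro ps.dim_res_sol_rank_one[where u = U and v = V]) simp_all
  moreover have "vs.dim (?S H') \<le> Suc (vs.dim (?S H))"
    using UV by (intro ps.dim_res_sol_rank_one[where u = "\<lambda>i. - U i" and v = V]) simp_all
  ultimately show "weyr_regular H' \<mu> j \<le> weyr_regular H \<mu> j + 2"
    "weyr_regular H \<mu> j \<le> weyr_regular H' \<mu> j + 2"
    using weyr_regular_eq[OF H assms, of \<mu>] weyr_regular_eq[OF H' assms, of \<mu>] rank_bounds by linarith+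
qed

lemma null_space_iff:
  "x \<in> null_space H \<longleftrightarrow> x \<in> coord_space {..<n} \<and> (\<forall>i<m. eval_form n (\<lambda>j. H $$ (i, j)) x = 0)"
  "x \<in> null_space H' \<longleftrightarrow> x \<in> coord_space {..<n} \<and> (\<forall>i<m. eval_form n (\<lambda>j. H' $$ (i, j)) x = 0)"
  unfolding dims by (rule field_sol_iff)+

lemma brunovsky_conditions:
  "antimono (brunovsky_seq (null_space H))" "finite {i. brunovsky_seq (null_space H) i \<noteq> 0}"
  "antimono (brunovsky_seq (null_space H'))"
  by (rule antimono_brunovsky_seq[OF _ null_space_coord]
      finite_support_brunovsky_seq[OF _ subspace_null_space null_space_coord], simp)+

text \<open>The rows of \<open>P\<close> are constant multiples of one row, so the combinations
\<open>u\<^sub>i\<^sub>1 A\<^sub>i - u\<^sub>i A\<^sub>i\<^sub>1\<close> of rows are the same for \<open>A = H\<close> and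
\<open>A = H + P\<close>. Their common kernel contains both null spaces, and each of these is cut out of it by
row \<open>i1\<close>, since \<open>u\<^sub>i\<^sub>1 \<noteq> 0\<close>.\<close>

lemma column_bounds_constant_left:
  assumes u: "\<forall>i<m. degree (u i) = 0" and v: "\<forall>j<n. degree (v j) \<le> 1" and nz: "i1 < m" "u i1 \<noteq> 0"
  shows "brunovsky_bounds (brunovsky_seq (null_space H)) (brunovsky_seq (null_space H'))"
proof -
  define N where "N A = fld.res_sol 0 (\<lambda>i j. to_fract (u i1 * A $$ (i, j) + (- u i) * A $$ (i1, j)))
      {..<m} {..<n}" for A :: "'a poly mat"
  have N_iff: "x \<in> N A \<longleftrightarrow> x \<in> coord_space {..<n} \<and>
      (\<forall>i<m. to_fract (u i1) * eval_form n (\<lambda>j. A $$ (i, j)) x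
        + to_fract (- u i) * eval_form n (\<lambda>j. A $$ (i1, j)) x = 0)" for x A
    unfolding N_def field_sol_iff eval_form_comb ..
  have form_kernel_N: "x \<in> form_kernel n (\<lambda>j. A $$ (i1, j)) (N A) \<longleftrightarrow>
      x \<in> coord_space {..<n} \<and> (\<forall>i<m. eval_form n (\<lambda>j. A $$ (i, j)) x = 0)" for x A
    unfolding form_kernel_def mem_Collect_eq N_iff using nz by auto
  have HN: "null_space H = form_kernel n (\<lambda>j. H $$ (i1, j)) (N H)"
  proof (rule Set.set_eqI)
    show "x \<in> null_space H \<longleftrightarrow> x \<in> form_kernel n (\<lambda>j. H $$ (i1, j)) (N H)" for x
      using null_space_iff(1)[of x] form_kernel_N[of x H] by blast
  qed
  have H'N: "null_space H' = form_kernel n (\<lambda>j. H' $$ (i1, j)) (N H')"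
  proof (rule Set.set_eqI)
    show "x \<in> null_space H' \<longleftrightarrow> x \<in> form_kernel n (\<lambda>j. H' $$ (i1, j)) (N H')" for x
      using null_space_iff(2)[of x] form_kernel_N[of x H'] by blast
  qed
  have N': "N H' = N H"
  proof -
    have "eval_form n (\<lambda>j. u i1 * H' $$ (i, j) + (- u i) * H' $$ (i1, j)) x
        = eval_form n (\<lambda>j. u i1 * H $$ (i, j) + (- u i) * H $$ (i1, j)) x" if "i < m" for i x
      using that nz(1) by (intro eval_form_cong) (simp add: index algebra_simps)
    then show ?thesis unfolding N_def by (intro Set.set_eqI) (simp only: field_sol_iff cong: all_cong)
  qed
  have N: "vs.subspace (N H)" "N H \<subseteq> coord_space {..<n}"
    unfolding N_def by (rule subspace_field_sol, rule fld.res_sol_coord)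
  have deg: "degree (H $$ (i1, j)) \<le> 1" "degree (H' $$ (i1, j)) \<le> 1" if "j < n" for j
    using H H' nz(1) that by (auto simp: pencil_def)
  let ?r = "brunovsky_seq (null_space H)" and ?r' = "brunovsky_seq (null_space H')"
    and ?g = "brunovsky_seq (N H)"
  have r: "null_space H = N H \<or> one_step_relation 1 ?g ?r"
    using brunovsky_seq_form_kernel[OF N, of "\<lambda>j. H $$ (i1, j)" 1] deg(1) unfolding HN by blast
  have r': "null_space H' = N H \<or> one_step_relation 1 ?g ?r'"
    using brunovsky_seq_form_kernel[OF N, of "\<lambda>j. H' $$ (i1, j)" 1] deg(2) unfolding H'N N' by blast
  note cond = brunovsky_conditions
  from r r' show ?thesis
  proof (elim disjE)
    assume "null_space H = N H" "null_space H' = N H"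
    then show ?thesis using brunovsky_bounds_refl[OF cond(1,2)] by simp
  next
    assume "null_space H = N H" "one_step_relation 1 ?g ?r'"
    then show ?thesis using brunovsky_bounds_one_step[OF cond] by simp
  next
    assume "one_step_relation 1 ?g ?r" "null_space H' = N H"
    then show ?thesis using brunovsky_bounds_one_step_converse[OF cond(1,2)] by simp
  next
    assume "one_step_relation 1 ?g ?r" "one_step_relation 1 ?g ?r'"
    then show ?thesis by (rule brunovsky_bounds_common_superspace[OF cond])
  qed
qed

text \<open>On the kernel of the form \<open>v\<close> the two pencils agree, and \<open>v\<close> has degree 0.\<close>

lemma column_bounds_constant_right:
  assumes v: "\<forall>j<n. degree (v j) = 0"
  shows "brunovsky_bounds (brunovsky_seq (null_space H)) (brunovsky_seq (null_space H'))"
proof -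
  define N where "N = form_kernel n v (null_space H)"
  have row: "eval_form n (\<lambda>j. H' $$ (i, j)) x
      = eval_form n (\<lambda>j. H $$ (i, j)) x + to_fract (u i) * eval_form n v x" if "i < m" for i x
  proof -
    have "eval_form n (\<lambda>j. H' $$ (i, j)) x = eval_form n (\<lambda>j. 1 * H $$ (i, j) + u i * v j) x"
      using that by (intro eval_form_cong) (simp add: index)
    then show ?thesis unfolding eval_form_comb by simp
  qed
  have "x \<in> null_space H \<longleftrightarrow> x \<in> null_space H'" if "eval_form n v x = 0" for x
    unfolding null_space_iff using row that by simp
  then have N': "N = form_kernel n v (null_space H')"
    unfolding N_def form_kernel_def by blast
  have deg: "degree (v j) \<le> 0" if "j < n" for j using v that by simp
  have J: "null_space H \<subseteq> coord_space {..<n}" "null_space H' \<subseteq> coord_space {..<n}"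
    using null_space_coord[of H] null_space_coord[of H'] dims by simp_all
  let ?r = "brunovsky_seq (null_space H)" and ?r' = "brunovsky_seq (null_space H')"
    and ?g = "brunovsky_seq N"
  have r: "N = null_space H \<or> one_step_relation 0 ?r ?g"
    using brunovsky_seq_form_kernel[OF subspace_null_space J(1), of v 0] deg unfolding N_def by blast
  have r': "N = null_space H' \<or> one_step_relation 0 ?r' ?g"
    using brunovsky_seq_form_kernel[OF subspace_null_space J(2), of v 0] deg unfolding N' by blast
  have "N \<subseteq> coord_space {..<n}" using J(1) by (auto simp: N_def form_kernel_def)
  then have anti: "antimono ?g" by (rule antimono_brunovsky_seq[rotated]) simp
  note cond = brunovsky_conditions
  from r r' show ?thesis
  proof (elim disjE)
    assume "N = null_space H" "N = null_space H'"
    then show ?thesis using brunovsky_bounds_refl[OF cond(1,2)] by simp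
  next
    assume "N = null_space H" "one_step_relation 0 ?r' ?g"
    then show ?thesis using brunovsky_bounds_one_step_converse[OF cond(1,2)] by simp
  next
    assume "one_step_relation 0 ?r ?g" "N = null_space H'"
    then show ?thesis using brunovsky_bounds_one_step[OF cond] by simp
  next
    assume "one_step_relation 0 ?r ?g" "one_step_relation 0 ?r' ?g"
    then show ?thesis by (rule brunovsky_bounds_common_subspace[OF cond(1,2) anti])
  qed
qed

end

lemma column_brunovsky_bounds:
  fixes H P :: "'a::alg_closed_field poly mat"
  assumes H: "H \<in> pencil m n" and P: "P \<in> pencil m n" and rank: "normal_rank P = 1"
  shows "brunovsky_bounds (column_brunovsky H) (column_brunovsky (H + P))"
proof -
  obtain u v where fact: "\<And>i j. i < m \<Longrightarrow> j < n \<Longrightarrow> P $$ (i, j) = u i * v j"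
    and deg: "((\<forall>i<m. degree (u i) = 0) \<and> (\<forall>j<n. degree (v j) \<le> 1)) \<or>
         ((\<forall>i<m. degree (u i) \<le> 1) \<and> (\<forall>j<n. degree (v j) = 0))"
    using rank_one_pencil_factorization[OF P rank] by blast
  interpret rank_one_update H P m n u v using H P fact deg by unfold_locales
  have "\<exists>i<m. \<exists>j<n. P $$ (i, j) \<noteq> 0" using normal_rank_one(1)[OF _ rank] P by (auto simp: pencil_def)
  then obtain i1 where "i1 < m" "u i1 \<noteq> 0" using fact by auto
  then show ?thesis unfolding column_brunovsky_eq
    using deg column_bounds_constant_left column_bounds_constant_right by blast
qed

lemma row_brunovsky_eq: "row_brunovsky H = column_brunovsky (transpose_mat H)"
  by (simp add: fun_eq_iff row_brunovsky_def column_brunovsky_def row_minimal_indices_def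
      normal_rank_transpose)

lemma weyr_regular_bounds:
  fixes H P :: "'a::alg_closed_field poly mat"
  assumes H: "H \<in> pencil m n" and P: "P \<in> pencil m n" and rank: "normal_rank P = 1" and j: "j \<ge> 1"
  shows "weyr_regular (H + P) \<mu> j \<le> weyr_regular H \<mu> j + 2"
    and "weyr_regular H \<mu> j \<le> weyr_regular (H + P) \<mu> j + 2"
proof -
  obtain u v where fact: "\<And>i j. i < m \<Longrightarrow> j < n \<Longrightarrow> P $$ (i, j) = u i * v j"
    and deg: "((\<forall>i<m. degree (u i) = 0) \<and> (\<forall>j<n. degree (v j) \<le> 1)) \<or>
         ((\<forall>i<m. degree (u i) \<le> 1) \<and> (\<forall>j<n. degree (v j) = 0))"
    using rank_one_pencil_factorization[OF P rank] by blast
  interpret rank_one_update H P m n u v using H P fact deg by unfold_locales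
  show "weyr_regular (H + P) \<mu> j \<le> weyr_regular H \<mu> j + 2"
    "weyr_regular H \<mu> j \<le> weyr_regular (H + P) \<mu> j + 2"
    using weyr_regular_bounds[OF j] by simp_all
qed

lemma transpose_pencil: "H \<in> pencil m n \<Longrightarrow> transpose_mat H \<in> pencil n m"
  by (auto simp: pencil_def)

theorem corollary3p7:
  fixes H P :: "'a::alg_closed_field poly mat"
    and m n :: nat
    and W W' :: "'a closure_pt \<Rightarrow> nat \<Rightarrow> nat"
    and r s r' s' :: "nat \<Rightarrow> nat"
  assumes "H \<in> pencil m n"
    and "weyr_characteristic H = (W, r, s)"
    and "P \<in> pencil m n"
    and "normal_rank P = 1"
    and "weyr_characteristic (H + P) = (W', r', s')"
  shows "(\<forall>i\<ge>1. \<forall>\<mu>. - 2 \<le> int (W' \<mu> i) - int (W \<mu> i) \<and> int (W' \<mu> i) - int (W \<mu> i) \<le> 2)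
    \<and> (zero_partition r \<longrightarrow> (\<forall>i\<ge>0.
          min (1 - \<lfloor>sqrt (real (psize_star r) + 1)\<rfloor>) (- 1) \<le> int (r' i) - int (r i)
        \<and> int (r' i) - int (r i) \<le> max 2 (- 1 + \<lfloor>sqrt (real (psize_star r))\<rfloor>)))
    \<and> (\<not> zero_partition r \<longrightarrow> (\<forall>i\<ge>0.
          min (- \<lfloor>sqrt (real (psize_star r))\<rfloor>) (- 1 - \<lfloor>sqrt (real (psize r))\<rfloor>) \<le> int (r' i) - int (r i)
        \<and> int (r' i) - int (r i) \<le>
            max (2 + \<lfloor>sqrt (real (psize r) - 1)\<rfloor>) \<lfloor>sqrt (real (psize_star r))\<rfloor>))
    \<and> (zero_partition s \<longrightarrow> (\<forall>i\<ge>0.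
          min (1 - \<lfloor>sqrt (real (psize_star s) + 1)\<rfloor>) (- 1) \<le> int (s' i) - int (s i)
        \<and> int (s' i) - int (s i) \<le> max 2 (- 1 + \<lfloor>sqrt (real (psize_star s))\<rfloor>)))
    \<and> (\<not> zero_partition s \<longrightarrow> (\<forall>i\<ge>0.
          min (- \<lfloor>sqrt (real (psize_star s))\<rfloor>) (- 1 - \<lfloor>sqrt (real (psize s))\<rfloor>) \<le> int (s' i) - int (s i)
        \<and> int (s' i) - int (s i) \<le>
            max (2 + \<lfloor>sqrt (real (psize s) - 1)\<rfloor>) \<lfloor>sqrt (real (psize_star s))\<rfloor>))"
proof -
  note pencils = assms(1,3) and rank = assms(4)
  have W: "W = weyr_regular H" "W' = weyr_regular (H + P)"
    and r: "r = column_brunovsky H" "r' = column_brunovsky (H + P)"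
    and s: "s = column_brunovsky (transpose_mat H)" "s' = column_brunovsky (transpose_mat (H + P))"
    using assms(2,5) by (simp_all add: weyr_characteristic_def row_brunovsky_eq)
  have "- 2 \<le> int (W' \<mu> i) - int (W \<mu> i) \<and> int (W' \<mu> i) - int (W \<mu> i) \<le> 2" if "i \<ge> 1" for i \<mu>
    using weyr_regular_bounds[OF pencils rank that, of \<mu>] unfolding W by linarith
  then have regular: "\<forall>i\<ge>1. \<forall>\<mu>. - 2 \<le> int (W' \<mu> i) - int (W \<mu> i) \<and> int (W' \<mu> i) - int (W \<mu> i) \<le> 2"
    by simp
  have "brunovsky_bounds r r'"
    unfolding r by (rule column_brunovsky_bounds[OF pencils rank])
  note col = this[unfolded brunovsky_bounds_def]
  have "transpose_mat (H + P) = transpose_mat H + transpose_mat P"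
    using pencils by (intro transpose_add) (auto simp: pencil_def)
  moreover have "normal_rank (transpose_mat P) = 1" using rank by (simp only: normal_rank_transpose)
  ultimately have "brunovsky_bounds s s'"
    unfolding s by (simp only: column_brunovsky_bounds[OF pencils[THEN transpose_pencil]])
  note row = this[unfolded brunovsky_bounds_def]
  show ?thesis
    by (intro conjI regular col[THEN conjunct1] col[THEN conjunct2] row[THEN conjunct1] row[THEN conjunct2])
qed

end
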